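(* Let $G$ be a finite group, $p$ a prime, and $S$ a Sylow $p$-subgroup of $G$. Assume at least one of the following holds: (1) $p$ is odd; or (2) $Z(S) \leq O_{2',2}(G)$; or (3) $G$ is solvable. Then $W_G(S)$ is a direct factor of $Z(S)$, i.e., there is a subgroup $K \leq Z(S)$ with $Z(S) = W_G(S) \times K$.
   Context: For a finite group $G$ with Sylow $p$-subgroup $S$, an element $x \in S$ is weakly closed in $S$ with respect to $G$ if $x^g = x$ whenever $g \in G$ and $x^g := g^{-1}xg \in S$. $W_G(S)$ denotes the set of all elements of $S$ that are weakly closed in $S$ with respect to $G$; it is a subgroup of $Z(S)$. $O_{p'}(G)$ is the largest normal $p'$-subgroup of $G$, and $O_{p',p}(G)$ is the normal subgroup of $G$ containing $O_{p'}(G)$ with $O_{p',p}(G)/O_{p'}(G) = O_p(G/O_{p'}(G))$, where $O_p$ denotes the largest normal $p$-subgroup. (In case (2), the prime is $p=2$.) *)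

theory Defs
  imports "HOL-Algebra.Algebra"
begin

definition sylow_subgroup :: "('a, 'b) monoid_scheme \<Rightarrow> nat \<Rightarrow> 'a set \<Rightarrow> bool" where
  "sylow_subgroup G p S \<longleftrightarrow> subgroup S G \<and> card S = p ^ multiplicity p (order G)"

definition subgroup_center :: "('a, 'b) monoid_scheme \<Rightarrow> 'a set \<Rightarrow> 'a set" where
  "subgroup_center G S = {x \<in> S. \<forall>y \<in> S. x \<otimes>\<^bsub>G\<^esub> y = y \<otimes>\<^bsub>G\<^esub> x}"

definition weakly_closed_elems :: "('a, 'b) monoid_scheme \<Rightarrow> 'a set \<Rightarrow> 'a set" where
  "weakly_closed_elems G S =
     {x \<in> S. \<forall>g \<in> carrier G.
        inv\<^bsub>G\<^esub> g \<otimes>\<^bsub>G\<^esub> x \<otimes>\<^bsub>G\<^esub> g \<in> S \<longrightarrow> inv\<^bsub>G\<^esub> g \<otimes>\<^bsub>G\<^esub> x \<otimes>\<^bsub>G\<^esub> g = x}"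

definition largest_normal :: "('a, 'b) monoid_scheme \<Rightarrow> ('a set \<Rightarrow> bool) \<Rightarrow> 'a set" where
  "largest_normal G P = (THE N. N \<lhd> G \<and> P N \<and> (\<forall>M. M \<lhd> G \<and> P M \<longrightarrow> M \<subseteq> N))"

definition is_p_group :: "nat \<Rightarrow> 'a set \<Rightarrow> bool" where
  "is_p_group p N \<longleftrightarrow> finite N \<and> (\<exists>n. card N = p ^ n)"

definition is_p'_group :: "nat \<Rightarrow> 'a set \<Rightarrow> bool" where
  "is_p'_group p N \<longleftrightarrow> finite N \<and> \<not> p dvd card N"

definition O_p :: "('a, 'b) monoid_scheme \<Rightarrow> nat \<Rightarrow> 'a set" where
  "O_p G p = largest_normal G (is_p_group p)"

definition O_p' :: "('a, 'b) monoid_scheme \<Rightarrow> nat \<Rightarrow> 'a set" where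
  "O_p' G p = largest_normal G (is_p'_group p)"

text \<open>O_{p',p}(G): the preimage in G of O_p(G/O_{p'}(G)) (union of those cosets).\<close>
definition O_p'p :: "('a, 'b) monoid_scheme \<Rightarrow> nat \<Rightarrow> 'a set" where
  "O_p'p G p = \<Union> (O_p (G Mod (O_p' G p)) p)"

end

theory Submission
  imports Defs
begin

text \<open>
  Suppose that a subgroup \<open>R\<close> of \<open>S\<close> is normal in \<open>S\<close>, contains \<open>Z(S)\<close>, and that the weakly closed
  elements are exactly the elements of \<open>Z(S)\<close> centralized by \<open>N = N\<^sub>G(R)\<close>. Then \<open>Z(S)\<close> and \<open>W\<^sub>G(S)\<close> are
  the fixed points of \<open>S\<close> and of \<open>N\<close> on \<open>Z(R)\<close>; the index of \<open>S\<close> in \<open>N\<close> is prime to \<open>p\<close>, so the norm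
  map from the former to the latter restricts to an automorphism of \<open>W\<^sub>G(S)\<close>, and its kernel is a complement.

  If \<open>Z(S)\<close> lies in \<open>L = O\<^bsub>p',p\<^esub>(G)\<close>, take \<open>R = S \<inter> L\<close> and use the Frattini argument. For solvable \<open>G\<close>
  this inclusion holds by the Hall-Higman lemma.

  If \<open>p\<close> is odd, take for \<open>R\<close> the Thompson subgroup \<open>J(S)\<close>, generated by the abelian subgroups of maximal
  order. By a maximality argument in the style of Alperin and Glauberman, an element of \<open>Z(S)\<close> that is centralized by
  \<open>N\<^sub>G(J(S))\<close> but not weakly closed leads to a \<open>p\<close>-subgroup \<open>T\<close> with a Sylow subgroup \<open>P\<close> of \<open>N\<^sub>G(T)\<close>
  such that \<open>N\<^sub>G(T)\<close> moves the element. A norm argument, in which nontrivial orbits contribute nothing new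
  because \<open>p\<close> is odd, shows that every element of \<open>P\<close> acting quadratically on \<open>Z(T)\<close> lies in \<open>T\<close>.
  Thompson's replacement theorem then gives \<open>J(P) = J(T)\<close>, which contradicts the choice of \<open>T\<close>.
\<close>

section \<open>Conjugation and fixed points of p-groups\<close>

text \<open>Only elements that \<open>N\<close> already centralizes are followed through
  \<open>G\<close>, which is weaker than control of fusion. Control can fail for \<open>J(S)\<close>
  even when \<open>p\<close> is odd: let \<open>SL(2,p)\<close> act on a plane over the field of
  \<open>p\<close> elements and take the semidirect product. There \<open>J(S) = S\<close>, and
  central elements of \<open>S\<close> are conjugate to noncentral ones in \<open>S\<close>. This is
  no contradiction, because the normalizer of \<open>S\<close> moves every nontrivial central
  element. For \<open>p = 2\<close> the same construction is the symmetric group of degree four.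
  Then \<open>S\<close> is dihedral of order eight, \<open>J(S) = S\<close> is its own normalizer,
  and its central involution is centralized by \<open>N\<close> without being weakly closed. So the
  even prime needs the other choice of \<open>R\<close>. Quadratic action is the link to the
  Thompson subgroup: replacement leads to an abelian subgroup \<open>A\<close> normalized by
  \<open>Z(T)\<close>. All commutators of \<open>A\<close> with \<open>Z(T)\<close> then lie in
  \<open>A\<close> and are centralized by \<open>A\<close>, which is what makes the products over
  orbits computable.\<close>

definition conj_by :: "('a, 'b) monoid_scheme \<Rightarrow> 'a \<Rightarrow> 'a \<Rightarrow> 'a" where
  "conj_by G g x = g \<otimes>\<^bsub>G\<^esub> x \<otimes>\<^bsub>G\<^esub> inv\<^bsub>G\<^esub> g"

context group
begin

abbreviation cj :: "'a \<Rightarrow> 'a \<Rightarrow> 'a" where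
  "cj \<equiv> conj_by G"

lemma cancel_left [simp]:
  "\<lbrakk>x \<in> carrier G; y \<in> carrier G\<rbrakk> \<Longrightarrow> inv x \<otimes> (x \<otimes> y) = y"
  "\<lbrakk>x \<in> carrier G; y \<in> carrier G\<rbrakk> \<Longrightarrow> x \<otimes> (inv x \<otimes> y) = y"
  by (simp_all add: m_assoc [symmetric])

lemma cj_closed [simp]: "\<lbrakk>g \<in> carrier G; x \<in> carrier G\<rbrakk> \<Longrightarrow> cj g x \<in> carrier G"
  by (simp add: conj_by_def)

lemma cj_m: "\<lbrakk>g \<in> carrier G; h \<in> carrier G; x \<in> carrier G\<rbrakk> \<Longrightarrow> cj (g \<otimes> h) x = cj g (cj h x)"
  by (simp add: conj_by_def inv_mult_group m_assoc)

lemma cj_hom: "\<lbrakk>g \<in> carrier G; x \<in> carrier G; y \<in> carrier G\<rbrakk> \<Longrightarrow> cj g (x \<otimes> y) = cj g x \<otimes> cj g y"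
  by (simp add: conj_by_def m_assoc)

lemma cj_one [simp]: "g \<in> carrier G \<Longrightarrow> cj g \<one> = \<one>" "x \<in> carrier G \<Longrightarrow> cj \<one> x = x"
  by (simp_all add: conj_by_def)

lemma cj_inv: "\<lbrakk>g \<in> carrier G; x \<in> carrier G\<rbrakk> \<Longrightarrow> cj g (inv x) = inv (cj g x)"
  by (simp add: conj_by_def inv_mult_group m_assoc)

lemma cj_cancel [simp]:
  "\<lbrakk>g \<in> carrier G; x \<in> carrier G\<rbrakk> \<Longrightarrow> cj (inv g) (cj g x) = x"
  "\<lbrakk>g \<in> carrier G; x \<in> carrier G\<rbrakk> \<Longrightarrow> cj g (cj (inv g) x) = x"
  by (simp_all add: cj_m [symmetric])

lemma cj_fix_iff: "\<lbrakk>g \<in> carrier G; x \<in> carrier G\<rbrakk> \<Longrightarrow> cj g x = x \<longleftrightarrow> g \<otimes> x = x \<otimes> g"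
  by (metis cj_closed conj_by_def inv_solve_right' m_closed)

lemma cj_eq_iff: "\<lbrakk>g \<in> carrier G; x \<in> carrier G; y \<in> carrier G\<rbrakk> \<Longrightarrow> cj g x = cj g y \<longleftrightarrow> x = y"
  by (metis cj_cancel(1))

lemma inj_on_cj: "\<lbrakk>g \<in> carrier G; H \<subseteq> carrier G\<rbrakk> \<Longrightarrow> inj_on (cj g) H"
  by (auto simp: inj_on_def cj_eq_iff subset_iff)

lemma card_cj: "\<lbrakk>g \<in> carrier G; H \<subseteq> carrier G\<rbrakk> \<Longrightarrow> card (cj g ` H) = card H"
  by (simp add: card_image inj_on_cj)

lemma cj_image_subset: "\<lbrakk>g \<in> carrier G; H \<subseteq> carrier G\<rbrakk> \<Longrightarrow> cj g ` H \<subseteq> carrier G"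
  by auto

lemma cj_image_m: "\<lbrakk>g \<in> carrier G; h \<in> carrier G; H \<subseteq> carrier G\<rbrakk> \<Longrightarrow> cj (g \<otimes> h) ` H = cj g ` cj h ` H"
  by (force simp: cj_m subset_iff image_image)

lemma cj_image_one: "H \<subseteq> carrier G \<Longrightarrow> cj \<one> ` H = H"
  by (force simp: subset_iff image_iff)

lemma cj_image_cancel:
  assumes "g \<in> carrier G" "H \<subseteq> carrier G"
  shows "cj (inv g) ` cj g ` H = H" "cj g ` cj (inv g) ` H = H"
  using assms by (simp_all add: cj_image_m [symmetric] cj_image_one)

lemma cj_image_subset_iff:
  assumes "g \<in> carrier G" "H \<subseteq> carrier G" "K \<subseteq> carrier G"
  shows "cj g ` H \<subseteq> K \<longleftrightarrow> H \<subseteq> cj (inv g) ` K"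
  using assms cj_image_cancel image_mono by (metis inv_closed)

lemma mem_cj_image_iff:
  assumes "g \<in> carrier G" "H \<subseteq> carrier G" "x \<in> carrier G"
  shows "x \<in> cj g ` H \<longleftrightarrow> cj (inv g) x \<in> H"
  using assms by (force simp: image_iff subset_iff)

lemma subgroup_cj: 
  assumes "subgroup H G" "g \<in> carrier G"
  shows "subgroup (cj g ` H) G"
proof -
  interpret H: subgroup H G by fact
  show ?thesis
  proof (rule subgroupI)
    fix a b assume "a \<in> cj g ` H" "b \<in> cj g ` H"
    then obtain x y where "x \<in> H" "y \<in> H" "a = cj g x" "b = cj g y" by auto
    then show "a \<otimes> b \<in> cj g ` H" "inv a \<in> cj g ` H"
      using assms by (auto simp flip: cj_hom cj_inv)
  qed (use assms in \<open>auto intro: H.one_closed\<close>)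
qed

lemma normalizer_iff:
  assumes "H \<subseteq> carrier G"
  shows "g \<in> normalizer G H \<longleftrightarrow> g \<in> carrier G \<and> cj g ` H = H"
proof -
  have "g <# H #> inv g = cj g ` H"
    by (auto simp: l_coset_def r_coset_def conj_by_def)
  then show ?thesis using assms
    by (auto simp: normalizer_def stabilizer_def)
qed

lemma normalizer_subgroup: "H \<subseteq> carrier G \<Longrightarrow> subgroup (normalizer G H) G"
  by (rule normalizer_imp_subgroup)

lemma normalizer_subset: "H \<subseteq> carrier G \<Longrightarrow> normalizer G H \<subseteq> carrier G"
  using normalizer_iff by auto

lemma cj_image_self: "\<lbrakk>subgroup H G; g \<in> H\<rbrakk> \<Longrightarrow> cj g ` H = H"
proof -
  assume H: "subgroup H G" "g \<in> H"
  interpret H: subgroup H G by fact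
  have *: "cj h ` H \<subseteq> H" if "h \<in> H" for h using that by (auto simp: conj_by_def)
  show ?thesis
    using *[OF \<open>g \<in> H\<close>] *[of "inv g"] H cj_image_subset_iff[of "inv g" H H] H.subset
    by (metis H.m_inv_closed H.mem_carrier inv_closed inv_inv subset_antisym)
qed

lemma subgroup_subset_normalizer: "subgroup H G \<Longrightarrow> H \<subseteq> normalizer G H"
  by (meson cj_image_self normalizer_iff subgroup.mem_carrier subgroup.subset subsetI)

lemma subgroup_fixed_points:
  assumes "subgroup H G" "E \<subseteq> carrier G"
  shows "subgroup {g \<in> H. \<forall>x\<in>E. cj g x = x} G"
proof -
  interpret H: subgroup H G by fact
  show ?thesis
  proof (rule subgroupI)
    fix a assume a: "a \<in> {g \<in> H. \<forall>x\<in>E. cj g x = x}"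
    then have "cj (inv a) x = x" if "x \<in> E" for x
    proof -
      have "x \<in> carrier G" "a \<in> carrier G" "cj a x = x" using a that assms(2) by auto
      then show ?thesis using cj_cancel(1)[of a x] by simp
    qed
    with a show "inv a \<in> {g \<in> H. \<forall>x\<in>E. cj g x = x}" by auto
  next
    fix a b assume "a \<in> {g \<in> H. \<forall>x\<in>E. cj g x = x}" "b \<in> {g \<in> H. \<forall>x\<in>E. cj g x = x}"
    moreover have "x \<in> carrier G" if "x \<in> E" for x using assms(2) that by blast
    ultimately show "a \<otimes> b \<in> {g \<in> H. \<forall>x\<in>E. cj g x = x}" by (auto simp: cj_m)
  next
    have "\<one> \<in> {g \<in> H. \<forall>x\<in>E. cj g x = x}"
      using assms(2) by (simp add: H.one_closed subset_iff)
    then show "{g \<in> H. \<forall>x\<in>E. cj g x = x} \<noteq> {}" by blast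
  qed auto
qed

lemma card_subgroup_dvd:
  assumes "subgroup H G" "subgroup K G" "H \<subseteq> K" "finite K"
  shows "card H dvd card K"
proof -
  interpret K: group "G\<lparr>carrier := K\<rparr>" by (rule subgroup_imp_group) fact
  have "subgroup H (G\<lparr>carrier := K\<rparr>)" by (rule subgroup_incl) fact+
  from K.lagrange[OF this] show ?thesis by (simp add: order_def) (metis dvd_triv_right)
qed

lemma subset_set_mult:
  assumes "subgroup A G" "subgroup B G"
  shows "A \<subseteq> A <#> B" "B \<subseteq> A <#> B"
proof -
  interpret A: subgroup A G by fact
  interpret B: subgroup B G by fact
  have "a = a \<otimes> \<one>" if "a \<in> A" for a using that by simp
  then show "A \<subseteq> A <#> B" unfolding set_mult_def using B.one_closed by blast
  have "b = \<one> \<otimes> b" if "b \<in> B" for b using that by simp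
  then show "B \<subseteq> A <#> B" unfolding set_mult_def using A.one_closed by blast
qed

text \<open>Orbit lengths divide the order of the \<open>p\<close>-group, so every orbit with more
  than one point has length divisible by \<open>p\<close>. The action is a bare function with
  closure laws, so that cosets, translates and conjugates can all be plugged in directly.\<close>

lemma p_group_fixed_points:
  assumes P: "subgroup P G" "card P = p ^ n" "Factorial_Ring.prime p" and E: "finite E"
    and act: "\<And>g x. \<lbrakk>g \<in> P; x \<in> E\<rbrakk> \<Longrightarrow> \<phi> g x \<in> E"
      "\<And>g h x. \<lbrakk>g \<in> P; h \<in> P; x \<in> E\<rbrakk> \<Longrightarrow> \<phi> (g \<otimes> h) x = \<phi> g (\<phi> h x)"
      "\<And>x. x \<in> E \<Longrightarrow> \<phi> \<one> x = x"
  shows "card E mod p = card {x \<in> E. \<forall>g\<in>P. \<phi> g x = x} mod p"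
proof -
  interpret P: subgroup P G by fact
  \<comment> \<open>The restriction to \<open>E\<close> is needed because members of
    \<open>Bij E\<close> are extensional functions.\<close>
  let ?P = "G\<lparr>carrier := P\<rparr>" let ?\<phi> = "\<lambda>g. \<lambda>x\<in>E. \<phi> g x"
  interpret GP: group ?P by (rule subgroup_imp_group) fact
  have inv: "\<phi> (inv g) (\<phi> g x) = x" "\<phi> g (\<phi> (inv g) x) = x" if "g \<in> P" "x \<in> E" for g x
    using act(2)[of "inv g" g x] act(2)[of g "inv g" x] act(3) that by auto
  have bij: "bij_betw (\<phi> g) E E" if "g \<in> P" for g
    by (rule bij_betw_byWitness[where f' = "\<phi> (inv g)"]) (use inv act that in auto)
  have "group_action ?P E ?\<phi>"
  proof (unfold group_action_def group_hom_def group_hom_axioms_def, intro conjI)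
    have Bij: "?\<phi> g \<in> Bij E" if "g \<in> P" for g
      using bij[OF that] by (simp add: Bij_def cong: bij_betw_cong)
    show "?\<phi> \<in> hom ?P (BijGroup E)"
    proof (rule homI)
      fix g h assume "g \<in> carrier ?P" "h \<in> carrier ?P"
      then show "?\<phi> (g \<otimes>\<^bsub>?P\<^esub> h) = ?\<phi> g \<otimes>\<^bsub>BijGroup E\<^esub> ?\<phi> h"
        using act Bij by (auto simp: BijGroup_def compose_def fun_eq_iff)
    qed (use Bij in \<open>auto simp: BijGroup_def\<close>)
  qed (auto simp: group_BijGroup GP.is_group)
  then interpret A: group_action ?P E ?\<phi> .
  let ?F = "{x \<in> E. \<forall>g\<in>P. \<phi> g x = x}" and ?O = "orbits ?P E ?\<phi>"
  have orb: "orbit ?P ?\<phi> x = (\<lambda>g. \<phi> g x) ` P" if "x \<in> E" for x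
    using that by (auto simp: orbit_def)
  have fin: "finite ?O" using E A.orbits_coverture finite_UnionD by metis
  have single: "card o' = 1 \<longleftrightarrow> (\<exists>x\<in>?F. o' = {x})" if o': "o' \<in> ?O" for o'
  proof
    obtain x where x: "x \<in> E" "o' = orbit ?P ?\<phi> x" using o' by (auto simp: orbits_def)
    assume "card o' = 1"
    then obtain y where y: "o' = {y}" by (auto simp: card_1_singleton_iff)
    then have "(\<lambda>g. \<phi> g x) ` P = {y}" using orb x by simp
    then have *: "\<forall>g\<in>P. \<phi> g x = y" by blast
    then have "x = y" using P.one_closed act(3)[OF x(1)] by metis
    with x y * show "\<exists>x\<in>?F. o' = {x}" by blast
  qed auto
  have Fo: "{x} \<in> ?O" if "x \<in> ?F" for x
  proof -
    have "orbit ?P ?\<phi> x = {x}" using that orb[of x] P.one_closed by (simp add: image_constant_conv cong: image_cong) (use P.one_closed in blast)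
    then show ?thesis using that by (auto simp: orbits_def)
  qed
  have "card E = (\<Sum>o'\<in>?O. card o')"
    using A.disjoint_sum[OF E, of "\<lambda>_. 1 :: nat"] by simp
  also have "\<dots> = (\<Sum>o'\<in>{o'\<in>?O. card o' = 1}. card o') + (\<Sum>o'\<in>{o'\<in>?O. card o' \<noteq> 1}. card o')"
    by (subst sum.union_disjoint [symmetric]) (use fin in \<open>auto intro!: sum.cong\<close>)
  also have "{o'\<in>?O. card o' = 1} = (\<lambda>x. {x}) ` ?F"
    using single Fo by auto
  also have "(\<Sum>o'\<in>(\<lambda>x. {x}) ` ?F. card o') = card ?F"
    by (subst sum.reindex) auto
  finally have eq: "card E = card ?F + (\<Sum>o'\<in>{o'\<in>?O. card o' \<noteq> 1}. card o')" .
  have "p dvd card o'" if o': "o' \<in> ?O" "card o' \<noteq> 1" for o'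
  proof -
    obtain x where x: "x \<in> E" "o' = orbit ?P ?\<phi> x" using o' by (auto simp: orbits_def)
    have "card o' dvd p ^ n"
      using A.orbit_stabilizer_theorem[OF x(1)] P(2) x(2) by (simp add: order_def) (metis dvd_triv_left)
    then obtain i where "card o' = p ^ i" using P(3) divides_primepow_nat by blast
    with o' show ?thesis by (cases i) auto
  qed
  then have "p dvd (\<Sum>o'\<in>{o'\<in>?O. card o' \<noteq> 1}. card o')"
    by (intro dvd_sum) auto
  then obtain k where "(\<Sum>o'\<in>{o'\<in>?O. card o' \<noteq> 1}. card o') = p * k" by (rule dvdE)
  with eq have "card E = card ?F + p * k" by (rule trans [OF _ arg_cong])
  then show ?thesis by simp
qed

section \<open>Sylow subgroups\<close>

lemma lcoset_eq_iff:
  assumes "subgroup D G" "h \<in> carrier G" "k \<in> carrier G"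
  shows "h <# D = k <# D \<longleftrightarrow> inv h \<otimes> k \<in> D"
proof -
  interpret D: subgroup D G by fact
  show ?thesis
  proof
    assume "h <# D = k <# D"
    then have "k \<in> h <# D" using lcos_self assms by blast
    then show "inv h \<otimes> k \<in> D" using D.lcos_module_imp assms by blast
  next
    assume "inv h \<otimes> k \<in> D"
    then have "k \<in> h <# D" using D.lcos_module_rev assms by blast
    then show "h <# D = k <# D" using l_repr_independence assms by blast
  qed
qed

text \<open>The stabilizer of \<open>h <# D\<close> under left translation is the conjugate of
  \<open>D\<close> by \<open>h\<close>. All counts of fixed cosets below are read through this
  equivalence.\<close>

lemma cj_mem_iff_lcoset:
  assumes "subgroup D G" "g \<in> carrier G" "h \<in> carrier G"
  shows "g <# (h <# D) = h <# D \<longleftrightarrow> g \<in> cj h ` D"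
proof -
  have "g <# (h <# D) = (g \<otimes> h) <# D"
    using assms by (simp add: lcos_m_assoc subgroup.subset)
  also have "\<dots> = h <# D \<longleftrightarrow> inv h \<otimes> (g \<otimes> h) \<in> D"
    using assms lcoset_eq_iff[of D h "g \<otimes> h"] by auto
  also have "inv h \<otimes> (g \<otimes> h) = cj (inv h) g"
    using assms by (simp add: conj_by_def m_assoc)
  finally show ?thesis using assms by (simp add: mem_cj_image_iff subgroup.subset)
qed

lemma card_lcosets:
  assumes "subgroup H G" "subgroup D G" "D \<subseteq> H" "finite H"
  shows "card ((\<lambda>h. h <# D) ` H) * card D = card H"
proof -
  interpret H: group "G\<lparr>carrier := H\<rparr>" by (rule subgroup_imp_group) fact
  have "subgroup D (G\<lparr>carrier := H\<rparr>)" by (rule subgroup_incl) fact+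
  from H.l_lagrange[OF _ this] have "card D * card (lcosets\<^bsub>G\<lparr>carrier := H\<rparr>\<^esub> D) = card H"
    using assms(4) by (simp add: order_def mult.commute)
  moreover have "lcosets\<^bsub>G\<lparr>carrier := H\<rparr>\<^esub> D = (\<lambda>h. h <# D) ` H"
    by (auto simp: LCOSETS_def)
  ultimately show ?thesis by (simp add: mult.commute)
qed

end

locale finite_group_prime = group +
  fixes p :: nat
  assumes fin: "finite (carrier G)" and prime_p: "Factorial_Ring.prime p"
begin

definition psub :: "'a set \<Rightarrow> bool" where
  "psub P \<longleftrightarrow> subgroup P G \<and> (\<exists>n. card P = p ^ n)"

text \<open>Sylow subgroups are taken relative to a subset \<open>H\<close> of the ambient group, so
  that passing to normalizers and centralizers never changes the group structure.\<close>

definition syl :: "'a set \<Rightarrow> 'a set \<Rightarrow> bool" where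
  "syl H S \<longleftrightarrow> subgroup S G \<and> S \<subseteq> H \<and> card S = p ^ multiplicity p (card H)"

lemma p_gt_1: "1 < p"
  using prime_p prime_gt_1_nat by blast

lemma finite_subgroup: "subgroup H G \<Longrightarrow> finite H"
  using fin finite_subset subgroup.subset by blast

lemma card_subgroup_pos: "subgroup H G \<Longrightarrow> 0 < card H"
  using finite_subgroup subgroup.one_closed card_gt_0_iff by blast

lemma psub_subgroup: "psub P \<Longrightarrow> subgroup P G"
  by (simp add: psub_def)

lemma syl_subgroup: "syl H S \<Longrightarrow> subgroup S G"
  by (simp add: syl_def)

lemma syl_subset: "syl H S \<Longrightarrow> S \<subseteq> H"
  by (simp add: syl_def)

lemma syl_psub: "syl H S \<Longrightarrow> psub S"
  by (auto simp add: syl_def psub_def)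

lemma psub_mono: "\<lbrakk>psub P; subgroup Q G; Q \<subseteq> P\<rbrakk> \<Longrightarrow> psub Q"
  using card_subgroup_dvd[of Q P] finite_subgroup[of P]
  by (auto simp: psub_def divides_primepow_nat[OF prime_p])

lemma psub_cj: "\<lbrakk>psub P; g \<in> carrier G\<rbrakk> \<Longrightarrow> psub (cj g ` P)"
  unfolding psub_def using subgroup_cj card_cj subgroup.subset by metis

lemma syl_cj:
  assumes "syl H S" "subgroup H G" "h \<in> H"
  shows "syl H (cj h ` S)"
proof -
  have "h \<in> carrier G" by (rule subgroup.mem_carrier) fact+
  then show ?thesis
    using assms cj_image_self[OF assms(2,3)] by (auto simp: syl_def subgroup_cj card_cj subgroup.subset)
qed

lemma syl_exists:
  assumes "subgroup H G"
  shows "\<exists>S. syl H S"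
proof -
  interpret H: group "G\<lparr>carrier := H\<rparr>" by (rule subgroup_imp_group) fact
  obtain m where "card H = p ^ multiplicity p (card H) * m"
    using multiplicity_dvd by (meson dvdE)
  then obtain S where S: "subgroup S (G\<lparr>carrier := H\<rparr>)" "card S = p ^ multiplicity p (card H)"
    using sylow_thm[OF prime_p H.is_group, of "multiplicity p (card H)" m] finite_subgroup[OF assms]
    by (auto simp: order_def)
  then show ?thesis
    using incl_subgroup[OF assms S(1)] subgroup.subset[OF S(1)] by (auto simp: syl_def)
qed

lemma syl_index:
  assumes "syl H S" "card H = m * card S" "0 < card H"
  shows "\<not> p dvd m"
proof
  assume "p dvd m"
  then have "p ^ Suc (multiplicity p (card H)) dvd card H"
    using assms by (metis mult_dvd_mono dvd_refl power_Suc syl_def)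
  then show False
    using assms(3) p_gt_1 by (simp add: power_dvd_iff_le_multiplicity del: power_Suc)
qed

lemma coset_fixed_points:
  assumes "subgroup H G" "subgroup D G" "D \<subseteq> H" "psub P" "P \<subseteq> H"
  shows "card ((\<lambda>h. h <# D) ` H) mod p
    = card {C \<in> (\<lambda>h. h <# D) ` H. \<exists>h\<in>H. C = h <# D \<and> P \<subseteq> cj h ` D} mod p"
proof -
  interpret H: subgroup H G by fact
  interpret D: subgroup D G by fact
  interpret P: subgroup P G by (rule psub_subgroup) fact
  obtain n where n: "card P = p ^ n" using assms by (auto simp: psub_def)
  have PH: "g \<in> H" if "g \<in> P" for g using that assms by blast
  let ?E = "(\<lambda>h. h <# D) ` H"
  have "card ?E mod p = card {C \<in> ?E. \<forall>g\<in>P. g <# C = C} mod p"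
  proof (rule p_group_fixed_points[where P = P, OF P.subgroup_axioms n prime_p])
    show "finite ?E" using finite_subgroup[OF assms(1)] by blast
  next
    fix g C assume g: "g \<in> P" "C \<in> ?E"
    then obtain h where "h \<in> H" "C = h <# D" by blast
    with g PH show "g <# C \<in> ?E"
      by (auto simp: lcos_m_assoc D.subset intro!: image_eqI[of _ _ "g \<otimes> h"])
  qed (auto simp: lcos_m_assoc D.subset lcos_mult_one l_coset_subset_G m_assoc)
  also have "{C \<in> ?E. \<forall>g\<in>P. g <# C = C} = {C \<in> ?E. \<exists>h\<in>H. C = h <# D \<and> P \<subseteq> cj h ` D}"
  proof -
    have *: "(\<forall>g\<in>P. g <# (h <# D) = h <# D) \<longleftrightarrow> P \<subseteq> cj h ` D" if "h \<in> H" for h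
      using that cj_mem_iff_lcoset[OF assms(2)] by (auto simp: subset_iff)
    show ?thesis
    proof (intro Collect_cong conj_cong refl)
      fix C assume "C \<in> ?E"
      then obtain h where "h \<in> H" "C = h <# D" by (rule imageE)
      then show "(\<forall>g\<in>P. g <# C = C) \<longleftrightarrow> (\<exists>h\<in>H. C = h <# D \<and> P \<subseteq> cj h ` D)"
        using * by metis
    qed
  qed
  finally show ?thesis .
qed

text \<open>The number of cosets of \<open>S\<close> in \<open>H\<close> is prime to
  \<open>p\<close>, so the \<open>p\<close>-group \<open>P\<close> fixes one of them, and its
  stabilizer is a conjugate of \<open>S\<close>.\<close>

lemma syl_conj:
  assumes H: "subgroup H G" and S: "syl H S" and P: "psub P" "P \<subseteq> H"
  shows "\<exists>h\<in>H. P \<subseteq> cj h ` S"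
proof -
  let ?E = "(\<lambda>h. h <# S) ` H"
  have "card H = card ?E * card S"
    using card_lcosets[OF H syl_subgroup[OF S] syl_subset[OF S] finite_subgroup[OF H]] by simp
  from syl_index[OF S this] card_subgroup_pos[OF H] have "card ?E mod p \<noteq> 0" by (auto simp: dvd_eq_mod_eq_0)
  then have "{C \<in> ?E. \<exists>h\<in>H. C = h <# S \<and> P \<subseteq> cj h ` S} \<noteq> {}"
    using coset_fixed_points[OF H syl_subgroup[OF S] syl_subset[OF S] P] by (metis card.empty mod_0)
  then show ?thesis by blast
qed

lemma syl_card_max:
  assumes "subgroup H G" "syl H S" "psub P" "P \<subseteq> H"
  shows "card P \<le> card S"
proof -
  obtain h where "h \<in> H" "P \<subseteq> cj h ` S" using syl_conj assms by blast
  moreover have "h \<in> carrier G" by (rule subgroup.mem_carrier) fact+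
  ultimately show ?thesis
    using card_mono[of "cj h ` S" P] assms(2) by (metis card_cj finite_subgroup finite_imageI syl_subgroup subgroup.subset)
qed

lemma syl_maximal:
  assumes "subgroup H G" "syl H S" "psub P" "P \<subseteq> H" "S \<subseteq> P"
  shows "P = S"
  using assms syl_card_max[OF assms(1-4)] finite_subgroup psub_subgroup by (metis card_seteq)

lemma syl_contains:
  assumes "subgroup H G" "psub P" "P \<subseteq> H"
  shows "\<exists>S. syl H S \<and> P \<subseteq> S"
  using assms syl_exists syl_conj syl_cj by metis

lemma syl_conj_eq:
  assumes H: "subgroup H G" "syl H S" "syl H T"
  shows "\<exists>h\<in>H. T = cj h ` S"
proof -
  obtain h where h: "h \<in> H" "T \<subseteq> cj h ` S" using syl_conj[OF H(1,2) syl_psub[OF H(3)] syl_subset[OF H(3)]] by blast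
  then show ?thesis
    using syl_maximal[OF H(1,3), of "cj h ` S"] syl_cj[OF H(2,1) h(1)] syl_psub syl_subset by blast
qed

lemma syl_if_card:
  assumes "subgroup H G" "syl H S" "psub P" "P \<subseteq> H" "card S \<le> card P"
  shows "syl H P"
  using assms syl_card_max[OF assms(1-4)] by (simp add: syl_def psub_def)

lemma syl_mono:
  assumes "subgroup K G" "subgroup H G" "H \<subseteq> K" "syl K S" "S \<subseteq> H"
  shows "syl H S"
proof -
  obtain T where "syl H T" using syl_exists assms by blast
  moreover have "card T \<le> card S"
    using syl_card_max[OF assms(1,4)] syl_psub[OF \<open>syl H T\<close>] syl_subset[OF \<open>syl H T\<close>] assms(3) by blast
  ultimately show ?thesis using syl_if_card[OF assms(2) _ syl_psub[OF assms(4)] assms(5)] by blast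
qed

lemma normal_psub_subset_syl:
  assumes "subgroup H G" "psub Q" "Q \<subseteq> H" "H \<subseteq> normalizer G Q" "syl H S"
  shows "Q \<subseteq> S"
proof -
  have Q: "Q \<subseteq> carrier G" and S: "S \<subseteq> carrier G"
    using assms psub_subgroup syl_subgroup subgroup.subset by blast+
  obtain h where h: "h \<in> H" "Q \<subseteq> cj h ` S" using syl_conj assms by blast
  have "h \<in> carrier G" "inv h \<in> H" using h assms(1) by (auto simp: subgroup.mem_carrier subgroup.m_inv_closed)
  then have "cj (inv h) ` Q = Q" using assms(4) normalizer_iff[OF Q] by blast
  moreover have "cj (inv h) ` Q \<subseteq> S"
    using h \<open>h \<in> carrier G\<close> Q S by (simp add: cj_image_subset_iff)
  ultimately show ?thesis by simp
qed

text \<open>\<open>M\<close> acts on its own cosets in \<open>P\<close>. Their number is a positive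
  power of \<open>p\<close>, so the number of fixed cosets is divisible by \<open>p\<close>; the
  coset \<open>M\<close> is fixed, hence so is another one, and its representative normalizes
  \<open>M\<close>.\<close>

lemma normalizer_grows:
  assumes P: "psub P" and M: "subgroup M G" "M \<subset> P"
  shows "\<exists>g \<in> P - M. cj g ` M = M"
proof -
  let ?E = "(\<lambda>h. h <# M) ` P" and ?F = "\<lambda>C. \<exists>h\<in>P. C = h <# M \<and> M \<subseteq> cj h ` M"
  note sP = psub_subgroup[OF P]
  have eq: "card ?E * card M = card P"
    using card_lcosets[OF sP M(1)] M(2) finite_subgroup[OF sP] by auto
  have lt: "card M < card P" using M(2) finite_subgroup[OF sP] psubset_card_mono by blast
  have "card ?E dvd card P" using eq by (metis dvd_triv_left)
  then obtain i where i: "card ?E = p ^ i" using P divides_primepow_nat[OF prime_p] by (auto simp: psub_def)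
  with eq lt have "i \<noteq> 0" by (intro notI) simp
  then have "card ?E mod p = 0" using i by (simp add: mod_0_imp_dvd dvd_imp_mod_0)
  then have 0: "card {C \<in> ?E. ?F C} mod p = 0"
    using coset_fixed_points[OF sP M(1) _ psub_mono[OF P M(1)]] M(2) by auto
  have one: "\<one> \<in> P" using sP subgroup.one_closed by blast
  have "M = \<one> <# M" "M \<subseteq> cj \<one> ` M"
    using lcos_mult_one[of M] cj_image_one[of M] subgroup.subset[OF M(1)] by simp_all
  with one have "M \<in> {C \<in> ?E. ?F C}" by blast
  moreover have "{C \<in> ?E. ?F C} \<noteq> {M}" 
    using 0 p_gt_1 by auto
  ultimately obtain h where h: "h \<in> P" "h <# M \<noteq> M" "M \<subseteq> cj h ` M" by blast
  have hc: "h \<in> carrier G" using subgroup.mem_carrier[OF sP h(1)] .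
  have "h \<notin> M" using h(2) hc lcoset_eq_iff[OF M(1), of \<one> h] lcos_mult_one[OF subgroup.subset[OF M(1)]] by auto
  moreover have "cj h ` M = M"
    using h(3) card_cj[OF hc subgroup.subset[OF M(1)]] finite_subgroup[OF M(1)] card_seteq[of "cj h ` M" M] by auto
  ultimately show ?thesis using h(1) by blast
qed

section \<open>Norms and fixed points of actions on abelian groups\<close>

text \<open>A maximal proper subgroup \<open>M\<close> above \<open>R\<close> is normal in
  \<open>J\<close> because normalizers grow, and it cannot contain the generating set
  \<open>A\<close>. Any \<open>a\<close> in \<open>A\<close> outside \<open>M\<close> therefore
  generates \<open>J\<close> modulo \<open>M\<close>. Taking \<open>a\<close> from \<open>A\<close>
  itself is the point: in \<open>orbit_norm\<close> only members of \<open>A\<close> are known to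
  act quadratically.\<close>

lemma generator_of_cyclic_quotient:
  assumes J: "psub J" "J = generate G A" "A \<subseteq> J" and R: "subgroup R G" "R \<subset> J"
  obtains M a and n :: nat where "subgroup M G" "R \<subseteq> M" "M \<subseteq> J" "a \<in> A" "p dvd n" "0 < n" "n dvd card J"
    "a [^] n \<in> M" "inj_on (\<lambda>i. a [^] i <# M) {..<n}" "J = (\<Union>i<n. a [^] i <# M)"
proof -
  note sJ = psub_subgroup[OF J(1)]
  interpret J: subgroup J G by fact
  have finP: "finite {M. subgroup M G \<and> R \<subseteq> M \<and> M \<subset> J}"
    by (rule finite_subset[of _ "Pow J"]) (use finite_subgroup[OF sJ] in auto)
  obtain M where M: "subgroup M G" "R \<subseteq> M" "M \<subset> J"
    and max: "\<And>M'. \<lbrakk>subgroup M' G; M \<subseteq> M'; M' \<subset> J\<rbrakk> \<Longrightarrow> M' = M"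
    using finite_has_maximal2[OF finP, of R] R by (smt (verit) mem_Collect_eq order_refl order_trans)
  interpret M: subgroup M G by fact
  have M': "M' = J" if "subgroup M' G" "M \<subseteq> M'" "M' \<subseteq> J" "M' \<noteq> M" for M'
    using max[OF that(1,2)] that by blast
  define N where "N = J \<inter> normalizer G M"
  have "N = J"
  proof (rule M')
    show "subgroup N G"
      unfolding N_def by (rule subgroups_Inter_pair[OF sJ normalizer_subgroup[OF M.subset]])
    show "M \<subseteq> N" unfolding N_def using M subgroup_subset_normalizer[OF M(1)] by blast
    obtain g where "g \<in> J - M" "cj g ` M = M" using normalizer_grows[OF J(1) M(1,3)] by blast
    then show "N \<noteq> M" unfolding N_def using normalizer_iff[OF M.subset] J.mem_carrier by blast
  qed (auto simp: N_def)
  then have norm: "cj g ` M = M" if "g \<in> J" for g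
    using that normalizer_iff[OF M.subset] N_def by blast
  have "\<not> A \<subseteq> M" using generate_subgroup_incl[of A M] M J(2) by blast
  then obtain a where a: "a \<in> A" "a \<notin> M" by blast
  then have aJ: "a \<in> J" using J by blast
  then have ac [simp]: "a \<in> carrier G" by (rule J.mem_carrier)
  have aiJ: "a [^] i \<in> J" for i :: nat by (induction i) (auto simp: aJ)
  have ex: "\<exists>n>0. a [^] (n::nat) \<in> M"
    using ord_ge_1[OF fin ac] pow_ord_eq_1[OF ac] M.one_closed by (intro exI[of _ "ord a"]) auto
  \<comment> \<open>The order of \<open>a\<close> modulo \<open>M\<close>, introduced as a least
    exponent because no quotient group is formed.\<close>
  define n :: nat where "n = (LEAST n. 0 < n \<and> a [^] n \<in> M)"
  have n: "0 < n" "a [^] n \<in> M" using LeastI_ex[OF ex] by (auto simp: n_def)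
  have n_le: "n \<le> i" if "0 < i" "a [^] i \<in> M" for i
    using that unfolding n_def by (simp add: Least_le)
  have diff: "inv (a [^] i) \<otimes> a [^] j = a [^] (j - i)" if "i \<le> j" for i j :: nat
  proof -
    have "a [^] j = a [^] i \<otimes> a [^] (j - i)" using that by (simp add: nat_pow_mult)
    then show ?thesis by simp
  qed
  have inj: "inj_on (\<lambda>i. a [^] i <# M) {..<n}"
  proof -
    have "i = j" if "i \<le> j" "j < n" "a [^] i <# M = a [^] j <# M" for i j
      using that lcoset_eq_iff[OF M(1), of "a [^] i" "a [^] j"] diff[of i j] n_le[of "j - i"] by fastforce
    then show ?thesis
      by (intro inj_onI) (metis lessThan_iff linear)
  qed
  \<comment> \<open>This is closed under products since \<open>J\<close> normalizes
    \<open>M\<close>, and it contains \<open>M\<close> and \<open>a\<close>, so maximality of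
    \<open>M\<close> makes it all of \<open>J\<close>. Only natural exponents occur; inverses are
    recovered as powers in the finite group.\<close>
  define K where "K = (\<Union>i. a [^] (i::nat) <# M)"
  have K: "k \<in> K \<longleftrightarrow> (\<exists>i m. m \<in> M \<and> k = a [^] (i::nat) \<otimes> m)" for k
    by (auto simp: K_def l_coset_def)
  have KJ: "K \<subseteq> J" using aiJ M(3) by (auto simp: K intro!: J.m_closed)
  have Kmult: "u \<otimes> v \<in> K" if uv: "u \<in> K" "v \<in> K" for u v
  proof -
    obtain i m where u: "m \<in> M" "u = a [^] (i::nat) \<otimes> m"
      using uv(1) unfolding K by blast
    obtain j m' where v: "m' \<in> M" "v = a [^] (j::nat) \<otimes> m'"
      using uv(2) unfolding K by blast
    note * = u v
    have "cj (inv (a [^] j)) m \<in> M" using norm[of "inv (a [^] j)"] aiJ * by blast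
    moreover have "u \<otimes> v = a [^] (i + j) \<otimes> (cj (inv (a [^] j)) m \<otimes> m')"
      using * by (simp add: conj_by_def m_assoc flip: nat_pow_mult)
    ultimately show ?thesis using * K by blast
  qed
  have "K = J"
  proof (rule M')
    have "\<one> \<in> K" unfolding K by (rule exI[of _ 0], rule exI[of _ \<one>]) (use M.one_closed in auto)
    have "inv u \<in> K" if "u \<in> K" for u
    proof -
      have uc: "u \<in> carrier G" using subsetD[OF KJ that] by simp
      have "u [^] i \<in> K" for i :: nat by (induction i) (auto simp: \<open>\<one> \<in> K\<close> that Kmult)
      moreover have "inv u = u [^] (ord u - 1)"
      proof (rule inv_equality)
        have "u [^] (ord u - 1) \<otimes> u = u [^] Suc (ord u - 1)" by simp
        also have "\<dots> = \<one>" using ord_ge_1[OF fin uc] pow_ord_eq_1[OF uc] by (simp del: nat_pow_Suc)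
        finally show "u [^] (ord u - 1) \<otimes> u = \<one>" .
      qed (use uc in auto)
      ultimately show ?thesis by simp
    qed
    with \<open>\<one> \<in> K\<close> Kmult KJ show "subgroup K G" by (intro subgroupI) auto
    show "M \<subseteq> K" unfolding subset_iff K by (metis M.mem_carrier l_one nat_pow_0)
    have "a = a [^] (1::nat) \<otimes> \<one>" by simp
    then have "a \<in> K" using K M.one_closed by blast
    with a show "K \<noteq> M" by blast
  qed (rule KJ)
  have cover: "J = (\<Union>i<n. a [^] i <# M)"
  proof
    show "J \<subseteq> (\<Union>i<n. a [^] i <# M)"
    proof
      fix k assume "k \<in> J"
      then obtain i m where im: "m \<in> M" "k = a [^] (i::nat) \<otimes> m" using K \<open>K = J\<close> by blast
      have "(a [^] n) [^] q \<in> M" for q :: nat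
        by (induction q) (auto simp: n)
      then have "(a [^] n) [^] (i div n) \<otimes> m \<in> M" using im by auto
      moreover have "a [^] i = a [^] (i mod n) \<otimes> (a [^] n) [^] (i div n)"
        by (simp add: nat_pow_pow nat_pow_mult)
      ultimately have "k \<in> a [^] (i mod n) <# M"
        using im by (force simp: l_coset_def m_assoc)
      with n(1) show "k \<in> (\<Union>i<n. a [^] i <# M)" by auto
    qed
  qed (use \<open>K = J\<close> in \<open>auto simp: K_def\<close>)
  have "(\<lambda>h. h <# M) ` J = (\<lambda>i. a [^] i <# M) ` {..<n}"
  proof
    show "(\<lambda>h. h <# M) ` J \<subseteq> (\<lambda>i. a [^] i <# M) ` {..<n}"
    proof
      fix C assume "C \<in> (\<lambda>h. h <# M) ` J"
      then obtain h where h: "h \<in> J" "C = h <# M" by blast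
      then obtain i where "i < n" "h \<in> a [^] i <# M" using cover by blast
      then show "C \<in> (\<lambda>i. a [^] i <# M) ` {..<n}"
        using l_repr_independence[OF _ _ M(1)] h by auto
    qed
  qed (use aiJ in auto)
  then have "card ((\<lambda>h. h <# M) ` J) = n" using inj by (simp add: card_image)
  then have nJ: "n * card M = card J"
    using card_lcosets[OF sJ M(1)] M(3) finite_subgroup[OF sJ] by auto
  then have "n dvd card J" by (metis dvd_triv_left)
  then obtain k where k: "n = p ^ k" using J(1) divides_primepow_nat[OF prime_p] by (auto simp: psub_def)
  have "card M < card J" using M(3) finite_subgroup[OF sJ] psubset_card_mono by blast
  with nJ k have "k \<noteq> 0" by (intro notI) simp
  with k have "p dvd n" by simp
  with that[OF M(1,2) _ a(1) _ n(1) \<open>n dvd card J\<close> n(2) inj cover] M(3) show thesis by blast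
qed

end

section \<open>Actions on an abelian group and the norm from a subgroup\<close>

locale p_action = finite_group_prime +
  V: comm_group V for V (structure) +
  fixes act :: "'a \<Rightarrow> 'c \<Rightarrow> 'c"
  assumes act_hom: "g \<in> carrier G \<Longrightarrow> act g \<in> hom V V"
    and act_m: "\<lbrakk>g \<in> carrier G; h \<in> carrier G; v \<in> carrier V\<rbrakk> \<Longrightarrow> act (g \<otimes> h) v = act g (act h v)"
    and act_one: "v \<in> carrier V \<Longrightarrow> act \<one> v = v"

lemma (in comm_monoid) finprod_pow:
  assumes "f \<in> A \<rightarrow> carrier G"
  shows "finprod G f A [^] (k::nat) = finprod G (\<lambda>i. f i [^] k) A"
  using assms
proof (induction A rule: infinite_finite_induct)
  case (insert a A)
  then have "f a \<in> carrier G" "f \<in> A \<rightarrow> carrier G" by auto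
  moreover from this have "(\<lambda>i. f i [^] k) \<in> A \<rightarrow> carrier G" by auto
  ultimately show ?case using insert by (simp add: nat_pow_distrib)
qed auto

lemma (in comm_monoid) finprod_hom:
  assumes "h \<in> hom G G" "h \<one> = \<one>" "f \<in> A \<rightarrow> carrier G"
  shows "h (finprod G f A) = finprod G (\<lambda>i. h (f i)) A"
  using assms(3)
proof (induction A rule: infinite_finite_induct)
  case (insert a A)
  then have "f a \<in> carrier G" "f \<in> A \<rightarrow> carrier G" by auto
  moreover from this have "h (f a) \<in> carrier G" "(\<lambda>i. h (f i)) \<in> A \<rightarrow> carrier G"
    using hom_in_carrier[OF assms(1)] by auto
  ultimately show ?case using insert hom_mult[OF assms(1)] by simp
qed (auto simp: assms(2))

lemma (in comm_monoid) finprod_progression: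
  assumes "u \<in> carrier G" "c \<in> carrier G"
  shows "finprod G (\<lambda>i. u \<otimes> c [^] i) {..<n::nat} = u [^] n \<otimes> c [^] (\<Sum>{..<n})"
proof (induction n)
  case (Suc n)
  have "finprod G (\<lambda>i. u \<otimes> c [^] i) {..<Suc n} = (u \<otimes> c [^] n) \<otimes> finprod G (\<lambda>i. u \<otimes> c [^] i) {..<n}"
    using assms by (simp add: lessThan_Suc Pi_def del: finprod_multf)
  also have "\<dots> = u [^] Suc n \<otimes> c [^] (\<Sum>{..<Suc n})"
    unfolding Suc using assms by (simp add: m_ac flip: nat_pow_mult)
  finally show ?case .
qed auto

lemma (in group) pow_coprime_eq_one:
  assumes "z \<in> carrier G" "z [^] (m::nat) = \<one>" "z [^] (n::nat) = \<one>" "coprime m n"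
  shows "z = \<one>"
proof -
  have "ord z dvd m" "ord z dvd n" using pow_eq_id[OF assms(1)] assms(2,3) by blast+
  then have "ord z = 1" using coprime_common_divisor[OF assms(4)] by simp
  then show ?thesis using assms(1) pow_ord_eq_1[of z] by simp
qed

context p_action
begin

lemma act_closed [simp]: "\<lbrakk>g \<in> carrier G; v \<in> carrier V\<rbrakk> \<Longrightarrow> act g v \<in> carrier V"
  by (rule hom_in_carrier[OF act_hom])

lemma act_mult: "\<lbrakk>g \<in> carrier G; u \<in> carrier V; v \<in> carrier V\<rbrakk> \<Longrightarrow> act g (u \<otimes>\<^bsub>V\<^esub> v) = act g u \<otimes>\<^bsub>V\<^esub> act g v"
  using hom_mult[OF act_hom] .

lemma act_group_hom: "g \<in> carrier G \<Longrightarrow> group_hom V V (act g)"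
  by (simp add: group_hom_def group_hom_axioms_def act_hom)

lemma act_V_one [simp]: "g \<in> carrier G \<Longrightarrow> act g \<one>\<^bsub>V\<^esub> = \<one>\<^bsub>V\<^esub>"
  using group_hom.hom_one[OF act_group_hom] .

lemma act_inv: "\<lbrakk>g \<in> carrier G; v \<in> carrier V\<rbrakk> \<Longrightarrow> act g (inv\<^bsub>V\<^esub> v) = inv\<^bsub>V\<^esub> (act g v)"
  using group_hom.hom_inv[OF act_group_hom] .

lemma act_pow: "\<lbrakk>g \<in> carrier G; v \<in> carrier V\<rbrakk> \<Longrightarrow> act g (v [^]\<^bsub>V\<^esub> (k::nat)) = act g v [^]\<^bsub>V\<^esub> k"
  using group_hom.hom_nat_pow[OF act_group_hom] .

definition fixed :: "'a set \<Rightarrow> 'c set" where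
  "fixed D = {v \<in> carrier V. \<forall>g\<in>D. act g v = v}"

lemma fixed_carrier: "x \<in> fixed D \<Longrightarrow> x \<in> carrier V"
  by (simp add: fixed_def)

lemma fixed_antimono: "D \<subseteq> D' \<Longrightarrow> fixed D' \<subseteq> fixed D"
  by (auto simp: fixed_def)

lemma subgroup_fixed: "D \<subseteq> carrier G \<Longrightarrow> subgroup (fixed D) V"
proof (rule V.subgroupI)
  assume D: "D \<subseteq> carrier G"
  show "fixed D \<noteq> {}" using D by (auto simp: fixed_def subset_iff intro!: exI[of _ "\<one>\<^bsub>V\<^esub>"])
qed (auto simp: fixed_def act_mult act_inv subset_iff)

definition cosets :: "'a set \<Rightarrow> 'a set set" where
  "cosets D = (\<lambda>h. h <# D) ` carrier G"

text \<open>For \<open>x\<close> fixed by \<open>D\<close> the element \<open>act h x\<close>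
  depends only on the coset of \<open>h\<close>, so the choice of a representative is harmless.
  \<open>translate_eq\<close> is the rule for computing with it.\<close>

definition translate :: "'a set \<Rightarrow> 'c \<Rightarrow> 'a set \<Rightarrow> 'c" where
  "translate D x C = act (SOME h. h \<in> carrier G \<and> C = h <# D) x"

text \<open>The relative norm (trace, in additive notation) from \<open>D\<close>-fixed points to
  \<open>G\<close>-fixed points. Left translation by \<open>G\<close> only permutes the factors,
  which is why the value is fixed by \<open>G\<close>.\<close>

definition norm :: "'a set \<Rightarrow> 'c \<Rightarrow> 'c" where
  "norm D x = finprod V (translate D x) (cosets D)"

lemma finite_cosets: "finite (cosets D)"
  using fin by (simp add: cosets_def)

lemma translate_eq:
  assumes "subgroup D G" "x \<in> fixed D" "h \<in> carrier G"
  shows "translate D x (h <# D) = act h x"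
proof -
  define k where "k = (SOME k. k \<in> carrier G \<and> h <# D = k <# D)"
  have k: "k \<in> carrier G \<and> h <# D = k <# D"
    unfolding k_def by (rule someI[of _ h]) (use assms in auto)
  then have "inv h \<otimes> k \<in> D" using lcoset_eq_iff assms by blast
  then have "act h (act (inv h \<otimes> k) x) = act h x" using assms(2) by (simp add: fixed_def)
  moreover have "act h (act (inv h \<otimes> k) x) = act k x"
    using k assms fixed_carrier[OF assms(2)] by (simp flip: act_m)
  ultimately show ?thesis by (simp add: translate_def k_def)
qed

lemma translate_closed:
  assumes "subgroup D G" "x \<in> fixed D"
  shows "translate D x \<in> cosets D \<rightarrow> carrier V"
  using translate_eq[OF assms] fixed_carrier[OF assms(2)] by (auto simp: cosets_def)

lemma translate_act:
  assumes "subgroup D G" "x \<in> fixed D" "g \<in> carrier G" "C \<in> cosets D"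
  shows "translate D x (g <# C) = act g (translate D x C)"
proof -
  obtain h where "h \<in> carrier G" "C = h <# D" using assms by (auto simp: cosets_def)
  then show ?thesis
    using assms translate_eq[OF assms(1,2)] fixed_carrier[OF assms(2)]
    by (simp add: lcos_m_assoc subgroup.subset act_m)
qed

lemma coset_translate_closed:
  assumes "subgroup D G" "g \<in> carrier G" "C \<in> cosets D"
  shows "g <# C \<in> cosets D"
  using assms by (auto simp: cosets_def lcos_m_assoc subgroup.subset)

lemma cosets_subset: "\<lbrakk>subgroup D G; C \<in> cosets D\<rbrakk> \<Longrightarrow> C \<subseteq> carrier G"
  by (auto simp: cosets_def dest: l_coset_subset_G[OF subgroup.subset, THEN subsetD])

lemma inj_on_lcoset:
  assumes "subgroup D G" "g \<in> carrier G"
  shows "inj_on (\<lambda>C. g <# C) (cosets D)"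
proof (rule inj_onI)
  fix B C assume "B \<in> cosets D" "C \<in> cosets D" "g <# B = g <# C"
  then have "inv g <# (g <# B) = inv g <# (g <# C)" by simp
  then show "B = C"
    using assms cosets_subset[OF assms(1)] \<open>B \<in> _\<close> \<open>C \<in> _\<close> by (simp add: lcos_m_assoc lcos_mult_one)
qed

lemma finprod_translate_shift:
  assumes "subgroup D G" "x \<in> fixed D" "g \<in> carrier G" "B \<subseteq> cosets D"
  shows "finprod V (translate D x) ((\<lambda>C. g <# C) ` B) = act g (finprod V (translate D x) B)"
proof -
  have B: "translate D x \<in> B \<rightarrow> carrier V" using translate_closed[OF assms(1,2)] assms(4) by blast
  have "finprod V (translate D x) ((\<lambda>C. g <# C) ` B) = finprod V (\<lambda>C. translate D x (g <# C)) B"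
  proof (rule V.finprod_reindex)
    show "translate D x \<in> (\<lambda>C. g <# C) ` B \<rightarrow> carrier V"
      using translate_closed[OF assms(1,2)] coset_translate_closed[OF assms(1,3)] assms(4) by blast
    show "inj_on (\<lambda>C. g <# C) B" using inj_on_lcoset[OF assms(1,3)] assms(4) inj_on_subset by blast
  qed
  also have "\<dots> = finprod V (\<lambda>C. act g (translate D x C)) B"
    using B assms translate_act[OF assms(1-3)] by (intro V.finprod_cong') (auto simp: subset_iff Pi_iff)
  also have "\<dots> = act g (finprod V (translate D x) B)"
    using V.finprod_hom[OF act_hom[OF assms(3)] act_V_one[OF assms(3)] B] by simp
  finally show ?thesis .
qed

lemma lcoset_image_cosets:
  assumes "subgroup D G" "g \<in> carrier G"
  shows "(\<lambda>C. g <# C) ` cosets D = cosets D"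
  using inj_on_lcoset[OF assms] coset_translate_closed[OF assms] finite_cosets
  by (intro endo_inj_surj) auto

lemma norm_fixed:
  assumes "subgroup D G" "x \<in> fixed D"
  shows "norm D x \<in> fixed (carrier G)"
proof -
  have "norm D x \<in> carrier V" unfolding norm_def using V.finprod_closed translate_closed[OF assms] by blast
  moreover have "act g (norm D x) = norm D x" if "g \<in> carrier G" for g
    using finprod_translate_shift[OF assms that order_refl] lcoset_image_cosets[OF assms(1) that]
    by (simp add: norm_def)
  ultimately show ?thesis by (simp add: fixed_def)
qed

lemma norm_mult:
  assumes "subgroup D G" "x \<in> fixed D" "y \<in> fixed D"
  shows "norm D (x \<otimes>\<^bsub>V\<^esub> y) = norm D x \<otimes>\<^bsub>V\<^esub> norm D y"
proof -
  have xy: "x \<otimes>\<^bsub>V\<^esub> y \<in> fixed D"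
    using subgroup.m_closed[OF subgroup_fixed[OF subgroup.subset[OF assms(1)]]] assms by blast
  have "norm D (x \<otimes>\<^bsub>V\<^esub> y) = finprod V (\<lambda>C. translate D x C \<otimes>\<^bsub>V\<^esub> translate D y C) (cosets D)"
    unfolding norm_def
  proof (rule V.finprod_cong')
    fix C assume "C \<in> cosets D"
    then obtain h where "h \<in> carrier G" "C = h <# D" by (auto simp: cosets_def)
    then show "translate D (x \<otimes>\<^bsub>V\<^esub> y) C = translate D x C \<otimes>\<^bsub>V\<^esub> translate D y C"
      using translate_eq[OF assms(1)] assms xy by (simp add: act_mult fixed_carrier)
  qed (use translate_closed[OF assms(1)] assms in \<open>auto simp: Pi_iff\<close>)
  then show ?thesis
    unfolding norm_def using translate_closed[OF assms(1)] assms by simp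
qed

lemma norm_of_fixed:
  assumes "subgroup D G" "x \<in> fixed (carrier G)"
  shows "norm D x = x [^]\<^bsub>V\<^esub> card (cosets D)"
proof -
  have x: "x \<in> fixed D" using fixed_antimono[OF subgroup.subset[OF assms(1)]] assms(2) by blast
  have "translate D x C = x" if "C \<in> cosets D" for C
    using that translate_eq[OF assms(1) x] assms(2) by (auto simp: cosets_def fixed_def)
  then have "norm D x = finprod V (\<lambda>_. x) (cosets D)"
    unfolding norm_def using fixed_carrier[OF x] by (intro V.finprod_cong') auto
  then show ?thesis using V.finprod_const fixed_carrier[OF x] by simp
qed

lemma fixed_complement:
  assumes D: "subgroup D G" and p': "\<not> p dvd card (cosets D)"
    and V: "\<And>v. v \<in> carrier V \<Longrightarrow> v [^]\<^bsub>V\<^esub> (p ^ e) = \<one>\<^bsub>V\<^esub>"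
  shows "\<exists>K. subgroup K V \<and> K \<subseteq> fixed D \<and> fixed (carrier G) <#>\<^bsub>V\<^esub> K = fixed D
    \<and> fixed (carrier G) \<inter> K = {\<one>\<^bsub>V\<^esub>}"
proof -
  let ?W = "fixed (carrier G)" and ?m = "card (cosets D)"
  define K where "K = {x \<in> fixed D. norm D x = \<one>\<^bsub>V\<^esub>}"
  interpret F: subgroup "fixed D" V by (rule subgroup_fixed[OF subgroup.subset[OF D]])
  interpret W: subgroup ?W V by (rule subgroup_fixed) simp
  have WF: "?W \<subseteq> fixed D" by (rule fixed_antimono[OF subgroup.subset[OF D]])
  have n1: "norm D \<one>\<^bsub>V\<^esub> = \<one>\<^bsub>V\<^esub>" using norm_of_fixed[OF D W.one_closed] by simp
  have ncl: "norm D x \<in> carrier V" if "x \<in> fixed D" for x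
    using norm_fixed[OF D that] fixed_carrier by blast
  have ninv: "norm D (inv\<^bsub>V\<^esub> x) = inv\<^bsub>V\<^esub> (norm D x)" if "x \<in> fixed D" for x
  proof -
    have "norm D (inv\<^bsub>V\<^esub> x) \<otimes>\<^bsub>V\<^esub> norm D x = \<one>\<^bsub>V\<^esub>"
      using norm_mult[OF D, of "inv\<^bsub>V\<^esub> x" x] that n1 by simp
    then show ?thesis using V.inv_equality[of "norm D (inv\<^bsub>V\<^esub> x)" "norm D x"] ncl that by simp
  qed
  have cop: "coprime ?m (p ^ e)"
    using prime_imp_coprime[OF prime_p p'] coprime_commute coprime_power_right_iff by blast
  have K: "subgroup K V"
  proof (rule V.subgroupI)
    show "K \<noteq> {}" using n1 F.one_closed unfolding K_def by blast
  qed (auto simp: K_def norm_mult[OF D] ninv)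
  have int: "?W \<inter> K = {\<one>\<^bsub>V\<^esub>}"
  proof -
    have "x = \<one>\<^bsub>V\<^esub>" if "x \<in> ?W" "x \<in> K" for x
      using V.pow_coprime_eq_one[of x ?m "p ^ e"] cop V norm_of_fixed[OF D that(1)] that fixed_carrier
      by (auto simp: K_def)
    then show ?thesis using W.one_closed F.one_closed n1 by (auto simp: K_def)
  qed
  have "?W <#>\<^bsub>V\<^esub> K = fixed D"
  proof
    show "?W <#>\<^bsub>V\<^esub> K \<subseteq> fixed D"
      using WF by (auto simp: set_mult_def K_def)
    show "fixed D \<subseteq> ?W <#>\<^bsub>V\<^esub> K"
    proof
      fix z assume z: "z \<in> fixed D"
      have "?m \<noteq> 0" using p' by (intro notI) simp
      \<comment> \<open>\<open>k\<close> will be an inverse of the index modulo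
        \<open>p ^ e\<close>. The \<open>k\<close>-th power \<open>w\<close> of the norm of
        \<open>z\<close> then lies in \<open>?W\<close> and has the same norm as \<open>z\<close>,
        so \<open>w\<close> is the component of \<open>z\<close> in \<open>?W\<close>.\<close>
      from bezout_add_strong_nat[OF this, of "p ^ e"] obtain d k l
        where "d dvd ?m" "d dvd p ^ e" and eq: "?m * k = p ^ e * l + d" by blast
      then have "d = 1" using coprime_common_divisor[OF cop] by simp
      define w where "w = norm D z [^]\<^bsub>V\<^esub> k"
      have "w \<in> ?W"
        unfolding w_def by (induction k) (auto simp: norm_fixed[OF D z])
      then have w: "w \<in> ?W" "w \<in> fixed D" "w \<in> carrier V" using WF by auto
      have "norm D w = norm D z [^]\<^bsub>V\<^esub> (p ^ e * l + 1)"
        using norm_of_fixed[OF D w(1)] ncl[OF z] eq \<open>d = 1\<close>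
        by (simp add: w_def V.nat_pow_pow mult.commute)
      also have "\<dots> = norm D z"
        using ncl[OF z] V[OF ncl[OF z]] by (simp flip: V.nat_pow_pow)
      finally have "inv\<^bsub>V\<^esub> w \<otimes>\<^bsub>V\<^esub> z \<in> K"
        using w z ncl[OF z] by (simp add: K_def norm_mult[OF D] ninv)
      moreover have "z = w \<otimes>\<^bsub>V\<^esub> (inv\<^bsub>V\<^esub> w \<otimes>\<^bsub>V\<^esub> z)"
        using w fixed_carrier[OF z] by simp
      ultimately show "z \<in> ?W <#>\<^bsub>V\<^esub> K" using w(1) unfolding set_mult_def by blast
    qed
  qed
  with K int show ?thesis by (intro exI[of _ K]) (auto simp: K_def)
qed

text \<open>Quadratic action says that the commutator of \<open>a\<close> and \<open>u\<close> is
  fixed by \<open>a\<close>, so each further application of \<open>a\<close> contributes the same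
  factor once more.\<close>

lemma quadratic_pow:
  assumes a: "a \<in> carrier G" and u: "u \<in> carrier V"
    and quad: "act a (act a u \<otimes>\<^bsub>V\<^esub> inv\<^bsub>V\<^esub> u) = act a u \<otimes>\<^bsub>V\<^esub> inv\<^bsub>V\<^esub> u"
  shows "act (a [^] (i::nat)) u = u \<otimes>\<^bsub>V\<^esub> (act a u \<otimes>\<^bsub>V\<^esub> inv\<^bsub>V\<^esub> u) [^]\<^bsub>V\<^esub> i"
proof -
  define c where "c = act a u \<otimes>\<^bsub>V\<^esub> inv\<^bsub>V\<^esub> u"
  have c: "c \<in> carrier V" "act a c = c" "act a u = u \<otimes>\<^bsub>V\<^esub> c"
    using a u quad by (auto simp: c_def V.m_ac)
  have "act (a [^] i) u = u \<otimes>\<^bsub>V\<^esub> c [^]\<^bsub>V\<^esub> i"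
  proof (induction i)
    case (Suc i)
    have "act (a [^] Suc i) u = act a (act (a [^] i) u)"
      unfolding nat_pow_Suc2[OF a] using a u by (simp add: act_m)
    also have "\<dots> = u \<otimes>\<^bsub>V\<^esub> c [^]\<^bsub>V\<^esub> Suc i"
      unfolding Suc using a u c(1) by (simp add: act_mult act_pow c(2,3) V.m_ac)
    finally show ?case .
  qed (use u in \<open>simp add: act_one\<close>)
  then show ?thesis by (simp add: c_def)
qed

text \<open>For odd \<open>n\<close> the exponent \<open>n (n - 1) / 2\<close> of the commutator is divisible by \<open>n\<close>;
  this is the only place where the argument needs an odd prime.\<close>

lemma quadratic_norm:
  assumes a: "a \<in> carrier G" and u: "u \<in> carrier V"
    and quad: "act a (act a u \<otimes>\<^bsub>V\<^esub> inv\<^bsub>V\<^esub> u) = act a u \<otimes>\<^bsub>V\<^esub> inv\<^bsub>V\<^esub> u"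
    and n: "odd n" "act (a [^] n) u = u"
  shows "finprod V (\<lambda>i. act (a [^] i) u) {..<n} = u [^]\<^bsub>V\<^esub> (n::nat)"
proof -
  define c where "c = act a u \<otimes>\<^bsub>V\<^esub> inv\<^bsub>V\<^esub> u"
  have c: "c \<in> carrier V" using a u by (simp add: c_def)
  have pow: "act (a [^] i) u = u \<otimes>\<^bsub>V\<^esub> c [^]\<^bsub>V\<^esub> i" for i :: nat
    unfolding c_def by (rule quadratic_pow[OF a u quad])
  \<comment> \<open>Since \<open>a [^] n\<close> fixes \<open>u\<close>, the formula for powers with
    exponent \<open>n\<close> leaves only the \<open>n\<close>-th power of \<open>c\<close>.\<close>
  have cn: "c [^]\<^bsub>V\<^esub> n = \<one>\<^bsub>V\<^esub>"
    using n(2) c u unfolding pow by simp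
  obtain k where k: "n = 2 * k + 1" using n(1) oddE by blast
  have "\<Sum>{..<n} = n * k"
    unfolding k by (induction k) (auto simp: lessThan_Suc algebra_simps)
  then have "c [^]\<^bsub>V\<^esub> (\<Sum>{..<n}) = \<one>\<^bsub>V\<^esub>"
    using c cn by (simp flip: V.nat_pow_pow)
  then show ?thesis
    unfolding pow using V.finprod_progression[OF u c, of n] u by simp
qed

text \<open>Let \<open>M\<close> be a maximal subgroup of \<open>J\<close> above the stabilizer of
  \<open>C\<close>, and \<open>O'\<close> the \<open>M\<close>-orbit of \<open>C\<close>. The
  \<open>J\<close>-orbit is the disjoint union of the \<open>n\<close> translates of
  \<open>O'\<close> by powers of some \<open>a\<close> in \<open>A\<close>. The product
  \<open>u\<close> over \<open>O'\<close> is fixed by \<open>M\<close>, hence by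
  \<open>a [^] n\<close>, so \<open>quadratic_norm\<close> gives the \<open>n\<close>-th power of
  \<open>u\<close> for the whole orbit. As \<open>p\<close> divides \<open>n\<close> and the
  \<open>p\<close>-th power of \<open>x\<close> is fixed by \<open>G\<close>, this is a power of
  \<open>x\<close> alone.\<close>

lemma orbit_norm:
  assumes "odd p" and D: "subgroup D G" and x: "x \<in> fixed D" "x [^]\<^bsub>V\<^esub> p \<in> fixed (carrier G)"
    and J: "psub J" "J = generate G A" "A \<subseteq> J"
    and quad: "\<And>a v. \<lbrakk>a \<in> A; v \<in> carrier V\<rbrakk> \<Longrightarrow>
      act a (act a v \<otimes>\<^bsub>V\<^esub> inv\<^bsub>V\<^esub> v) = act a v \<otimes>\<^bsub>V\<^esub> inv\<^bsub>V\<^esub> v"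
    and C: "C \<in> cosets D" and j: "j \<in> J" "j <# C \<noteq> C"
  shows "finprod V (translate D x) ((\<lambda>g. g <# C) ` J) = x [^]\<^bsub>V\<^esub> card ((\<lambda>g. g <# C) ` J)"
proof -
  let ?f = "translate D x"
  interpret J: subgroup J G by (rule psub_subgroup) fact
  note xV = fixed_carrier[OF x(1)]
  have assoc: "g <# (h <# B) = (g \<otimes> h) <# B" if "g \<in> carrier G" "h \<in> carrier G" "B \<in> cosets D" for g h B
    using that cosets_subset[OF D] by (simp add: lcos_m_assoc)
  define R where "R = {g \<in> J. g <# C = C}"
  have R: "subgroup R G"
  proof (rule subgroupI)
    show "R \<noteq> {}" unfolding R_def using J.one_closed cosets_subset[OF D C] lcos_mult_one by blast
    fix g assume g: "g \<in> R"
    then have "inv g <# C = inv g <# (g <# C)" by (simp add: R_def)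
    also have "\<dots> = (inv g \<otimes> g) <# C" using g C by (intro assoc) (auto simp: R_def)
    also have "\<dots> = C" using g cosets_subset[OF D C] by (simp add: R_def lcos_mult_one)
    finally show "inv g \<in> R" using g by (simp add: R_def)
  next
    fix g h assume "g \<in> R" "h \<in> R"
    then show "g \<otimes> h \<in> R" using C by (auto simp: R_def simp flip: assoc)
  qed (auto simp: R_def)
  have "R \<subset> J" using j by (auto simp: R_def)
  from generator_of_cyclic_quotient[OF J R this]
  obtain M a and n :: nat where M: "subgroup M G" "R \<subseteq> M" "M \<subseteq> J" and a: "a \<in> A" and n: "p dvd n" "0 < n" "n dvd card J"
    "a [^] n \<in> M" and inj: "inj_on (\<lambda>i. a [^] i <# M) {..<n}" and cover: "J = (\<Union>i<n. a [^] i <# M)" .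
  interpret M: subgroup M G by fact
  have aJ: "a \<in> J" using a J(3) by blast
  then have ac [simp]: "a \<in> carrier G" by simp
  have aiJ: "a [^] i \<in> J" for i :: nat by (induction i) (auto simp: aJ)
  have "odd (card J)" using J(1) \<open>odd p\<close> by (auto simp: psub_def)
  then have "odd n" using n(3) by (meson dvd_trans)
  define O' where "O' = (\<lambda>m. m <# C) ` M"
  define u where "u = finprod V ?f O'"
  have O': "O' \<subseteq> cosets D" unfolding O'_def using coset_translate_closed[OF D _ C] by auto
  have finO': "finite O'" using finite_subset[OF O' finite_cosets] .
  have fO': "?f \<in> O' \<rightarrow> carrier V" using translate_closed[OF D x(1)] O' by blast
  have u: "u \<in> carrier V" unfolding u_def using V.finprod_closed[OF fO'] .
  have shift: "finprod V ?f ((\<lambda>B. g <# B) ` O') = act g u" if "g \<in> carrier G" for g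
    unfolding u_def by (rule finprod_translate_shift[OF D x(1) that O'])
  have Mu: "act m u = u" if "m \<in> M" for m
  proof -
    have "(\<lambda>B. m <# B) ` O' = (\<lambda>k. (m \<otimes> k) <# C) ` M"
      unfolding O'_def image_image using that C by (intro image_cong) (auto simp: assoc)
    also have "\<dots> = (\<lambda>k. k <# C) ` ((\<lambda>k. m \<otimes> k) ` M)" by (simp add: image_image)
    also have "(\<lambda>k. m \<otimes> k) ` M = M"
    proof -
      have "k = m \<otimes> (inv m \<otimes> k)" "inv m \<otimes> k \<in> M" if "k \<in> M" for k
        using that \<open>m \<in> M\<close> by auto
      then have "M \<subseteq> (\<lambda>k. m \<otimes> k) ` M" by (rule_tac subsetI, rule image_eqI)
      then show ?thesis using that by auto
    qed
    finally show ?thesis using shift[of m] that by (simp add: O'_def u_def)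
  qed
  have orbit: "(\<lambda>g. g <# C) ` J = (\<Union>i<n. (\<lambda>B. a [^] i <# B) ` O')"
  proof -
    have "(\<lambda>g. g <# C) ` (a [^] i <# M) = (\<lambda>B. a [^] i <# B) ` O'" for i :: nat
    proof -
      have "a [^] i <# M = (\<lambda>m. a [^] i \<otimes> m) ` M" by (auto simp: l_coset_def)
      then show ?thesis unfolding O'_def using C by (auto simp: image_image assoc intro!: image_cong)
    qed
    then show ?thesis unfolding cover image_UN by simp
  qed
  \<comment> \<open>If two translates met, the quotient of the two elements of \<open>J\<close>
    would stabilize \<open>C\<close> and so lie in \<open>R\<close>, which is inside
    \<open>M\<close>; then the two powers of \<open>a\<close> would lie in one coset of
    \<open>M\<close>.\<close>
  have disj: "pairwise (\<lambda>i k. disjnt ((\<lambda>B. a [^] i <# B) ` O') ((\<lambda>B. a [^] k <# B) ` O')) {..<n}"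
  proof (rule pairwiseI)
    fix i k assume ik: "i \<in> {..<n}" "k \<in> {..<n}" "i \<noteq> k"
    have "(a [^] i \<otimes> m) <# C \<noteq> (a [^] k \<otimes> m') <# C" if m: "m \<in> M" "m' \<in> M" for m m'
    proof
      define g where "g = a [^] i \<otimes> m"
      define h where "h = a [^] k \<otimes> m'"
      have gh: "g \<in> J" "h \<in> J" unfolding g_def h_def using m M(3) aiJ by auto
      assume "(a [^] i \<otimes> m) <# C = (a [^] k \<otimes> m') <# C"
      then have "inv g <# (g <# C) = inv g <# (h <# C)" by (simp add: g_def h_def)
      then have "inv g \<otimes> h \<in> R"
        using gh C cosets_subset[OF D C] by (simp add: R_def assoc lcos_mult_one)
      then have "m \<otimes> (inv g \<otimes> h) \<otimes> inv m' \<in> M" using M(2) m by auto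
      also have "m \<otimes> (inv g \<otimes> h) \<otimes> inv m' = inv (a [^] i) \<otimes> a [^] k"
        using m by (simp add: g_def h_def inv_mult_group m_assoc)
      finally have "a [^] i <# M = a [^] k <# M"
        using lcoset_eq_iff[OF M(1)] by simp
      with ik inj show False by (auto dest: inj_onD)
    qed
    then show "disjnt ((\<lambda>B. a [^] i <# B) ` O') ((\<lambda>B. a [^] k <# B) ` O')"
      using C by (auto simp: disjnt_iff O'_def assoc)
  qed
  have card: "card ((\<lambda>g. g <# C) ` J) = n * card O'"
  proof -
    have "card ((\<lambda>g. g <# C) ` J) = (\<Sum>i<n. card ((\<lambda>B. a [^] i <# B) ` O'))"
      unfolding orbit using disj finO'
      by (intro card_UN_disjoint) (auto simp: pairwise_def disjnt_def)
    also have "\<dots> = (\<Sum>i<n. card O')"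
      using inj_on_subset[OF inj_on_lcoset[OF D] O'] by (intro sum.cong) (auto simp: card_image)
    finally show ?thesis by simp
  qed
  have "finprod V ?f ((\<lambda>g. g <# C) ` J) = finprod V (\<lambda>i. finprod V ?f ((\<lambda>B. a [^] i <# B) ` O')) {..<n}"
    unfolding orbit
  proof (rule V.finprod_UN_disjoint)
    fix i :: nat and B assume "B \<in> (\<lambda>B. a [^] i <# B) ` O'"
    then have "B \<in> cosets D" using coset_translate_closed[OF D, of "a [^] i"] O' by auto
    then show "?f B \<in> carrier V" using translate_closed[OF D x(1)] by blast
  qed (use finO' disj in auto)
  also have "\<dots> = finprod V (\<lambda>i. act (a [^] i) u) {..<n}"
    using shift u by (intro V.finprod_cong') auto
  also have "\<dots> = u [^]\<^bsub>V\<^esub> n"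
    using quadratic_norm[OF ac u quad[OF a u] \<open>odd n\<close> Mu[OF n(4)]] .
  also have "\<dots> = x [^]\<^bsub>V\<^esub> (n * card O')"
  proof -
    \<comment> \<open>Each factor of \<open>u\<close> is some \<open>act h x\<close>, and
      \<open>act h\<close> fixes the \<open>p\<close>-th power of \<open>x\<close>. So the factors
      may differ, but their \<open>p\<close>-th powers do not.\<close>
    have "?f B [^]\<^bsub>V\<^esub> p = x [^]\<^bsub>V\<^esub> p" if B: "B \<in> O'" for B
    proof -
      obtain h where "h \<in> carrier G" "B = h <# D" using B O' by (auto simp: cosets_def)
      then show ?thesis
        using translate_eq[OF D x(1)] x(2) xV by (simp add: fixed_def flip: act_pow)
    qed
    then have "u [^]\<^bsub>V\<^esub> p = finprod V (\<lambda>_. x [^]\<^bsub>V\<^esub> p) O'"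
      unfolding u_def V.finprod_pow[OF fO'] using xV by (intro V.finprod_cong') auto
    also have "\<dots> = x [^]\<^bsub>V\<^esub> (p * card O')" using xV by (simp add: V.finprod_const V.nat_pow_pow)
    finally have up: "u [^]\<^bsub>V\<^esub> p = x [^]\<^bsub>V\<^esub> (p * card O')" .
    obtain l where l: "n = p * l" using n(1) by blast
    have "u [^]\<^bsub>V\<^esub> n = (x [^]\<^bsub>V\<^esub> (p * card O')) [^]\<^bsub>V\<^esub> l"
      using u by (simp add: l flip: up V.nat_pow_pow)
    then show ?thesis using xV by (simp add: l V.nat_pow_pow mult_ac)
  qed
  finally show ?thesis by (simp add: card)
qed

text \<open>The translates of \<open>x\<close> over a \<open>J\<close>-orbit \<open>O\<close> of cosets multiply to \<open>x\<close> to the power \<open>|O|\<close>. Hence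
  \<open>x\<close> to the power \<open>|G : D|\<close> is a norm and so fixed by \<open>G\<close>, and \<open>|G : D| \<equiv> 1 (mod p)\<close>.\<close>

lemma control_of_fixed_points_step:
  assumes "odd p" and D: "subgroup D G" and x: "x \<in> fixed D" "x [^]\<^bsub>V\<^esub> p \<in> fixed (carrier G)"
    and J: "psub J" "J = generate G A" "A \<subseteq> J"
    and quad: "\<And>a v. \<lbrakk>a \<in> A; v \<in> carrier V\<rbrakk> \<Longrightarrow>
      act a (act a v \<otimes>\<^bsub>V\<^esub> inv\<^bsub>V\<^esub> v) = act a v \<otimes>\<^bsub>V\<^esub> inv\<^bsub>V\<^esub> v"
    and JD: "J \<subseteq> D" "\<And>h. \<lbrakk>h \<in> carrier G; J \<subseteq> cj h ` D\<rbrakk> \<Longrightarrow> h \<in> D"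
  shows "x \<in> fixed (carrier G)"
proof -
  let ?f = "translate D x"
  interpret J: subgroup J G by (rule psub_subgroup) fact
  interpret D: subgroup D G by fact
  note xV = fixed_carrier[OF x(1)]
  have D_coset: "h <# D = D" if "h \<in> D" for h
    using that lcoset_eq_iff[OF D, of \<one> h] lcos_mult_one[OF D.subset] by auto
  \<comment> \<open>Induction over \<open>J\<close>-invariant sets of cosets, splitting off one
    orbit \<open>O'\<close> at a time.\<close>
  have inv: "finprod V ?f U = x [^]\<^bsub>V\<^esub> card U"
    if "U \<subseteq> cosets D" "\<And>C j. \<lbrakk>C \<in> U; j \<in> J\<rbrakk> \<Longrightarrow> j <# C \<in> U" for U
    using that
  proof (induction "card U" arbitrary: U rule: less_induct)
    case less
    show ?case
    proof (cases "U = {}")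
      case False
      then obtain C where C: "C \<in> U" by blast
      then have CD: "C \<in> cosets D" using less by blast
      have assoc: "g <# (h <# B) = (g \<otimes> h) <# B" if "g \<in> J" "h \<in> J" "B \<in> U" for g h B
        using that cosets_subset[OF D, of B] less(2) by (auto simp: lcos_m_assoc)
      define O' where "O' = (\<lambda>g. g <# C) ` J"
      have "\<one> <# C = C" using cosets_subset[OF D CD] lcos_mult_one by blast
      then have "C \<in> O'" unfolding O'_def using J.one_closed by (metis image_eqI)
      have O'U: "O' \<subseteq> U" unfolding O'_def using less(3)[OF C] by blast
      have finU: "finite U" using finite_subset[OF less(2) finite_cosets] .
      have lt: "card (U - O') < card U"
        using \<open>C \<in> O'\<close> C finU by (intro psubset_card_mono) auto
      have "j <# B \<in> U - O'" if B: "B \<in> U - O'" "j \<in> J" for B j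
      proof -
        have "j <# B \<notin> O'"
        proof
          assume "j <# B \<in> O'"
          then obtain g where g: "g \<in> J" "j <# B = g <# C" by (auto simp: O'_def)
          then have "inv j <# (j <# B) = inv j <# (g <# C)" by simp
          moreover have "inv j <# (j <# B) = B"
            using B assoc[of "inv j" j B] cosets_subset[OF D, of B] less(2) by (auto simp: lcos_mult_one)
          ultimately have "B = (inv j \<otimes> g) <# C"
            using B g C by (simp add: assoc)
          then show False using B g unfolding O'_def by blast
        qed
        then show ?thesis using B less(3) by blast
      qed
      then have rest: "finprod V ?f (U - O') = x [^]\<^bsub>V\<^esub> card (U - O')"
        using less(1)[OF lt] less(2) by blast
      have orb: "finprod V ?f O' = x [^]\<^bsub>V\<^esub> card O'"
      proof (cases "\<exists>j\<in>J. j <# C \<noteq> C")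
        case True
        then obtain j where "j \<in> J" "j <# C \<noteq> C" by blast
        from orbit_norm[OF assms(1-7) quad CD this] show ?thesis by (simp add: O'_def)
      next
        \<comment> \<open>Here \<open>J\<close> fixes the coset \<open>h <# D\<close>, so it lies in
          the conjugate of \<open>D\<close> by \<open>h\<close>; \<open>JD(2)\<close> then leaves
          only the trivial coset, whose translate is \<open>x\<close> itself.\<close>
        case False
        obtain h where h: "h \<in> carrier G" "C = h <# D" using CD by (auto simp: cosets_def)
        have "J \<subseteq> cj h ` D"
          using False h cj_mem_iff_lcoset[OF D _ h(1)] by auto
        then have "C = D" using JD(2) h D_coset by blast
        then have "?f C = x"
          using translate_eq[OF D x(1), of \<one>] lcos_mult_one[OF D.subset] xV by (simp add: act_one)
        moreover have "O' \<subseteq> {C}" using False by (auto simp: O'_def)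
        then have "O' = {C}" using \<open>C \<in> O'\<close> by blast
        ultimately show ?thesis using xV by simp
      qed
      have fU: "?f \<in> U \<rightarrow> carrier V" using translate_closed[OF D x(1)] less(2) by blast
      have "finprod V ?f U = finprod V ?f (O' \<union> (U - O'))"
        using O'U by (simp add: Un_absorb1)
      also have "\<dots> = finprod V ?f O' \<otimes>\<^bsub>V\<^esub> finprod V ?f (U - O')"
        using finU O'U fU by (intro V.finprod_Un_disjoint) (auto intro: finite_subset)
      also have "\<dots> = x [^]\<^bsub>V\<^esub> (card O' + card (U - O'))"
        using xV by (simp add: orb rest V.nat_pow_mult)
      also have "card O' + card (U - O') = card U"
        using O'U finU by (metis card_Diff_subset card_mono finite_subset le_add_diff_inverse)
      finally show ?thesis .
    qed simp
  qed
  have "finprod V ?f (cosets D) = x [^]\<^bsub>V\<^esub> card (cosets D)"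
    by (rule inv) (auto intro: coset_translate_closed[OF D])
  then have e: "x [^]\<^bsub>V\<^esub> card (cosets D) \<in> fixed (carrier G)"
    using norm_fixed[OF D x(1)] by (simp add: norm_def)
  have "{C \<in> cosets D. \<exists>h\<in>carrier G. C = h <# D \<and> J \<subseteq> cj h ` D} = {D}"
  proof -
    have "D = \<one> <# D" "J \<subseteq> cj \<one> ` D"
      using JD(1) lcos_mult_one[OF D.subset] cj_image_one[OF D.subset] by auto
    then have "D \<in> {C \<in> cosets D. \<exists>h\<in>carrier G. C = h <# D \<and> J \<subseteq> cj h ` D}"
      unfolding cosets_def using one_closed by blast
    then show ?thesis using JD(2) D_coset by blast
  qed
  then have "card (cosets D) mod p = 1"
    using coset_fixed_points[OF subgroup_self D D.subset J(1) J.subset] p_gt_1 by (simp add: cosets_def)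
  then obtain q where q: "card (cosets D) = p * q + 1"
    by (metis mult_div_mod_eq)
  interpret F: subgroup "fixed (carrier G)" V by (rule subgroup_fixed) simp
  \<comment> \<open>The index is \<open>p * q + 1\<close>, so \<open>x\<close> is a quotient of two
    fixed elements: its power with exponent the index, and the \<open>q\<close>-th power of the
    \<open>p\<close>-th power of \<open>x\<close>.\<close>
  have "(x [^]\<^bsub>V\<^esub> p) [^]\<^bsub>V\<^esub> q \<in> fixed (carrier G)"
    by (induction q) (auto simp: x(2))
  then have "inv\<^bsub>V\<^esub> ((x [^]\<^bsub>V\<^esub> p) [^]\<^bsub>V\<^esub> q) \<otimes>\<^bsub>V\<^esub> x [^]\<^bsub>V\<^esub> card (cosets D) \<in> fixed (carrier G)"
    using e by blast
  also have "inv\<^bsub>V\<^esub> ((x [^]\<^bsub>V\<^esub> p) [^]\<^bsub>V\<^esub> q) \<otimes>\<^bsub>V\<^esub> x [^]\<^bsub>V\<^esub> card (cosets D) = x"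
    using xV by (simp add: q V.nat_pow_pow)
  finally show ?thesis .
qed

text \<open>Induction on the exponent: the \<open>p\<close>-th power of \<open>x\<close> is again
  fixed by \<open>D\<close> and has smaller exponent, so it is already fixed by \<open>G\<close>.
  That is the extra assumption under which the preceding lemma works.\<close>

theorem control_of_fixed_points:
  assumes "odd p" and D: "subgroup D G" and x: "x \<in> fixed D" "x [^]\<^bsub>V\<^esub> (p ^ k) = \<one>\<^bsub>V\<^esub>"
    and J: "psub J" "J = generate G A" "A \<subseteq> J"
    and quad: "\<And>a v. \<lbrakk>a \<in> A; v \<in> carrier V\<rbrakk> \<Longrightarrow>
      act a (act a v \<otimes>\<^bsub>V\<^esub> inv\<^bsub>V\<^esub> v) = act a v \<otimes>\<^bsub>V\<^esub> inv\<^bsub>V\<^esub> v"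
    and JD: "J \<subseteq> D" "\<And>h. \<lbrakk>h \<in> carrier G; J \<subseteq> cj h ` D\<rbrakk> \<Longrightarrow> h \<in> D"
  shows "x \<in> fixed (carrier G)"
  using x
proof (induction k arbitrary: x)
  case 0
  interpret F: subgroup "fixed (carrier G)" V by (rule subgroup_fixed) simp
  show ?case using 0 fixed_carrier[OF 0(1)] F.one_closed by simp
next
  case (Suc k)
  interpret F: subgroup "fixed D" V by (rule subgroup_fixed[OF subgroup.subset[OF D]])
  have "x [^]\<^bsub>V\<^esub> n \<in> fixed D" for n :: nat by (induction n) (auto simp: Suc.prems(1))
  moreover have "(x [^]\<^bsub>V\<^esub> p) [^]\<^bsub>V\<^esub> (p ^ k) = \<one>\<^bsub>V\<^esub>"
    using Suc.prems fixed_carrier by (simp add: V.nat_pow_pow)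
  ultimately have "x [^]\<^bsub>V\<^esub> p \<in> fixed (carrier G)" using Suc.IH by blast
  from control_of_fixed_points_step[OF assms(1) D Suc.prems(1) this J quad JD] show ?case .
qed

end

section \<open>Weakly closed elements and fixed points of normalizers\<close>

context group
begin

lemma subgroup_center_alt:
  "H \<subseteq> carrier G \<Longrightarrow> subgroup_center G H = {x \<in> H. \<forall>y\<in>H. cj y x = x}"
  unfolding subgroup_center_def using cj_fix_iff by (auto simp: subset_iff)

lemma subgroup_subgroup_center:
  assumes "subgroup H G"
  shows "subgroup (subgroup_center G H) G"
proof -
  interpret H: subgroup H G by fact
  show ?thesis
    unfolding subgroup_center_alt[OF H.subset]
  proof (rule subgroupI)
    have "\<one> \<in> {x \<in> H. \<forall>y\<in>H. cj y x = x}" by (simp add: H.one_closed)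
    then show "{x \<in> H. \<forall>y\<in>H. cj y x = x} \<noteq> {}" by blast
  qed (auto simp: cj_hom cj_inv)
qed

lemma subgroup_center_subset: "subgroup_center G H \<subseteq> H"
  by (auto simp: subgroup_center_def)

lemma subgroup_center_comm:
  "\<lbrakk>x \<in> subgroup_center G H; y \<in> H\<rbrakk> \<Longrightarrow> x \<otimes> y = y \<otimes> x"
  by (auto simp: subgroup_center_def)

lemma normalizer_subgroup_center:
  assumes H: "subgroup H G"
  shows "normalizer G H \<subseteq> normalizer G (subgroup_center G H)"
proof
  interpret H: subgroup H G by fact
  note Z = subgroup.subset[OF subgroup_subgroup_center[OF H]]
  have *: "cj g ` subgroup_center G H \<subseteq> subgroup_center G H" if "g \<in> carrier G" "cj g ` H = H" for g
  proof
    fix y assume "y \<in> cj g ` subgroup_center G H"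
    then obtain x where x: "x \<in> subgroup_center G H" "y = cj g x" by blast
    then have xH: "x \<in> H" using subgroup_center_subset by blast
    then have "y \<in> H" using that x by blast
    moreover have "y \<otimes> z = z \<otimes> y" if "z \<in> H" for z
    proof -
      obtain w where w: "w \<in> H" "z = cj g w" using \<open>z \<in> H\<close> \<open>cj g ` H = H\<close> by blast
      have "cj g (x \<otimes> w) = cj g (w \<otimes> x)" using subgroup_center_comm[OF x(1) w(1)] by simp
      then show ?thesis using \<open>g \<in> carrier G\<close> w x xH by (simp add: cj_hom)
    qed
    ultimately show "y \<in> subgroup_center G H" by (simp add: subgroup_center_def)
  qed
  fix g assume "g \<in> normalizer G H"
  then have g: "g \<in> carrier G" "cj g ` H = H" using normalizer_iff[OF H.subset] by auto
  then have "cj (inv g) ` H = H" using cj_image_cancel(1)[of g H] H.subset by simp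
  then have "cj (inv g) ` subgroup_center G H \<subseteq> subgroup_center G H" using * g by simp
  then have "subgroup_center G H \<subseteq> cj g ` subgroup_center G H"
    using cj_image_subset_iff[of "inv g"] g Z by simp
  then have "cj g ` subgroup_center G H = subgroup_center G H" using *[OF g] by blast
  then show "g \<in> normalizer G (subgroup_center G H)"
    using normalizer_iff[OF Z] g by simp
qed

text \<open>The statement of the theorem conjugates from the right, whereas \<open>cj\<close>
  conjugates from the left to give a left action. The quantifier over all \<open>g\<close> absorbs
  the inverse.\<close>

lemma weakly_closed_elems_alt:
  assumes "S \<subseteq> carrier G"
  shows "weakly_closed_elems G S = {x \<in> S. \<forall>g\<in>carrier G. cj g x \<in> S \<longrightarrow> cj g x = x}"
proof -
  have 1: "inv g \<otimes> x \<otimes> g = cj (inv g) x" if "g \<in> carrier G" for g x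
    using that by (simp add: conj_by_def)
  have 2: "(\<forall>g\<in>carrier G. P (inv g)) \<longleftrightarrow> (\<forall>g\<in>carrier G. P g)" for P
    by (metis inv_closed inv_inv)
  show ?thesis
    unfolding weakly_closed_elems_def using 2[of "\<lambda>g. cj g _ \<in> S \<longrightarrow> cj g _ = _"]
    by (simp add: 1 cong: ball_cong)
qed

text \<open>\<open>conj_by\<close> depends on the carrier through the inverse, whence the
  restriction to \<open>g\<close> in \<open>N\<close>.\<close>

lemma conj_by_subgroup:
  "\<lbrakk>subgroup N G; g \<in> N\<rbrakk> \<Longrightarrow> conj_by (G\<lparr>carrier := N\<rparr>) g x = cj g x"
  by (simp add: conj_by_def)

end

context finite_group_prime
begin

lemma finite_group_prime_subgroup:
  assumes "subgroup N G"
  shows "finite_group_prime (G\<lparr>carrier := N\<rparr>) p"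
proof -
  interpret N: group "G\<lparr>carrier := N\<rparr>" by (rule subgroup_imp_group) fact
  show ?thesis by unfold_locales (use finite_subgroup[OF assms] prime_p in auto)
qed

lemma conjugation_p_action:
  assumes V: "subgroup V G" "\<And>u v. \<lbrakk>u \<in> V; v \<in> V\<rbrakk> \<Longrightarrow> u \<otimes> v = v \<otimes> u"
    and N: "subgroup N G" "N \<subseteq> normalizer G V"
  shows "p_action (G\<lparr>carrier := N\<rparr>) p (G\<lparr>carrier := V\<rparr>) cj"
proof -
  interpret V: subgroup V G by fact
  interpret N: subgroup N G by fact
  interpret GN: finite_group_prime "G\<lparr>carrier := N\<rparr>" p by (rule finite_group_prime_subgroup) fact
  interpret GV: group "G\<lparr>carrier := V\<rparr>" by (rule subgroup_imp_group) fact
  have closed: "cj g v \<in> V" if "g \<in> N" "v \<in> V" for g v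
    using that N(2) normalizer_iff[OF V.subset] by blast
  show ?thesis
  proof unfold_locales
    show "cj g \<in> hom (G\<lparr>carrier := V\<rparr>) (G\<lparr>carrier := V\<rparr>)" if "g \<in> carrier (G\<lparr>carrier := N\<rparr>)" for g
      using that closed by (auto simp: hom_def cj_hom)
  qed (auto simp: cj_m V(2))
qed

lemma p_group_exponent:
  assumes "psub V"
  obtains e where "\<And>v. v \<in> V \<Longrightarrow> v [^] (p ^ e) = \<one>"
proof -
  note sV = psub_subgroup[OF assms]
  obtain e where e: "card V = p ^ e" using assms by (auto simp: psub_def)
  interpret GV: group "G\<lparr>carrier := V\<rparr>" by (rule subgroup_imp_group) fact
  have "v [^] (p ^ e) = \<one>" if "v \<in> V" for v
    using GV.pow_order_eq_1[of v] that e nat_pow_consistent[of v "p ^ e" V] by (simp add: order_def)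
  then show thesis using that by blast
qed

lemma fixed_points_complement:
  assumes V: "psub V" "\<And>u v. \<lbrakk>u \<in> V; v \<in> V\<rbrakk> \<Longrightarrow> u \<otimes> v = v \<otimes> u"
    and N: "subgroup N G" "N \<subseteq> normalizer G V" and S: "syl N S"
  shows "\<exists>K. subgroup K G \<and> K \<subseteq> {v\<in>V. \<forall>g\<in>S. cj g v = v}
    \<and> {v\<in>V. \<forall>g\<in>N. cj g v = v} <#> K = {v\<in>V. \<forall>g\<in>S. cj g v = v}
    \<and> {v\<in>V. \<forall>g\<in>N. cj g v = v} \<inter> K = {\<one>}"
proof -
  note sV = psub_subgroup[OF V(1)]
  interpret A: p_action "G\<lparr>carrier := N\<rparr>" p "G\<lparr>carrier := V\<rparr>" cj
    by (rule conjugation_p_action) (use sV V N in auto)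
  obtain e where e: "\<And>v. v \<in> V \<Longrightarrow> v [^] (p ^ e) = \<one>" by (rule p_group_exponent[OF V(1)]) blast
  have S': "subgroup S (G\<lparr>carrier := N\<rparr>)"
    by (rule subgroup_incl[OF syl_subgroup[OF S] N(1) syl_subset[OF S]])
  have "card N = card (A.cosets S) * card S"
    using card_lcosets[OF N(1) syl_subgroup[OF S] syl_subset[OF S] finite_subgroup[OF N(1)]]
    by (simp add: A.cosets_def)
  from syl_index[OF S this card_subgroup_pos[OF N(1)]] have "\<not> p dvd card (A.cosets S)" .
  from A.fixed_complement[OF S' this, of e] e obtain K where
    K: "subgroup K (G\<lparr>carrier := V\<rparr>)" "K \<subseteq> A.fixed S" "A.fixed N <#> K = A.fixed S" "A.fixed N \<inter> K = {\<one>}"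
    using nat_pow_consistent[of _ "p ^ e" V] by auto
  have "subgroup K G" using incl_subgroup[OF sV K(1)] .
  with K show ?thesis by (auto simp: A.fixed_def)
qed

text \<open>Assumption \<open>W\<close> is the only place where fusion in \<open>G\<close> enters;
  the cases of the theorem differ in \<open>R\<close> and in how they establish it. The opposite
  inclusion is automatic: \<open>normalizer G R\<close> carries a central element of
  \<open>S\<close> into \<open>R\<close>, hence into \<open>S\<close>, so it must fix weakly closed
  elements.\<close>

lemma weakly_closed_direct_factor:
  assumes S: "syl (carrier G) S" and R: "subgroup R G" "R \<subseteq> S" "S \<subseteq> normalizer G R"
    and Z: "subgroup_center G S \<subseteq> R"
    and W: "\<And>x g. \<lbrakk>x \<in> subgroup_center G S; \<forall>h\<in>normalizer G R. cj h x = x; g \<in> carrier G; cj g x \<in> S\<rbrakk> \<Longrightarrow> cj g x = x"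
  shows "\<exists>K. subgroup K G \<and> K \<subseteq> subgroup_center G S
           \<and> weakly_closed_elems G S <#> K = subgroup_center G S
           \<and> weakly_closed_elems G S \<inter> K = {\<one>}"
proof -
  define N where "N = normalizer G R"
  define V where "V = subgroup_center G R"
  note sS = syl_subgroup[OF S]
  interpret S: subgroup S G by fact
  have N: "subgroup N G" unfolding N_def using normalizer_subgroup[OF subgroup.subset[OF R(1)]] .
  have ZV: "subgroup_center G S \<subseteq> V"
    using Z R(2) by (auto simp: V_def subgroup_center_def)
  have VS: "V \<subseteq> S" using R(2) subgroup_center_subset[of R] by (auto simp: V_def)
  have psubV: "psub V"
    using psub_mono[OF syl_psub[OF S] subgroup_subgroup_center[OF R(1)]] VS by (simp add: V_def)
  have commV: "u \<otimes> v = v \<otimes> u" if "u \<in> V" "v \<in> V" for u v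
    using subgroup_center_comm[of u R v] subgroup_center_subset[of R] that unfolding V_def by (meson subsetD)
  have NV: "N \<subseteq> normalizer G V"
    unfolding N_def V_def by (rule normalizer_subgroup_center[OF R(1)])
  have sylN: "syl N S"
    by (rule syl_mono[OF subgroup_self N subgroup.subset[OF N] S]) (simp add: N_def R(3))
  have center: "{v\<in>V. \<forall>g\<in>S. cj g v = v} = subgroup_center G S"
    unfolding subgroup_center_alt[OF S.subset] using VS ZV subgroup_center_alt[OF S.subset] by blast
  have "weakly_closed_elems G S = {v\<in>V. \<forall>g\<in>N. cj g v = v}"
  proof (intro equalityI subsetI)
    fix x assume "x \<in> weakly_closed_elems G S"
    then have x: "x \<in> S" "\<And>g. \<lbrakk>g \<in> carrier G; cj g x \<in> S\<rbrakk> \<Longrightarrow> cj g x = x"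
      by (auto simp: weakly_closed_elems_alt[OF S.subset])
    have "cj g x = x" if "g \<in> S" for g
    proof (rule x(2))
      show "cj g x \<in> S" using imageI[OF x(1), of "cj g"] unfolding cj_image_self[OF sS that] .
    qed (use that in simp)
    with x(1) have xZ: "x \<in> subgroup_center G S" by (simp add: subgroup_center_alt[OF S.subset])
    have "cj g x = x" if "g \<in> N" for g
    proof (rule x(2))
      show "g \<in> carrier G" using that subgroup.subset[OF N] by (rule rev_subsetD)
      have "cj g ` R = R" using that normalizer_iff[OF subgroup.subset[OF R(1)]] unfolding N_def by simp
      moreover have "x \<in> R" using xZ Z by (rule rev_subsetD)
      ultimately have "cj g x \<in> R" by blast
      then show "cj g x \<in> S" using R(2) by blast
    qed
    then show "x \<in> {v\<in>V. \<forall>g\<in>N. cj g v = v}" using xZ ZV by blast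
  next
    fix x assume x: "x \<in> {v\<in>V. \<forall>g\<in>N. cj g v = v}"
    then have "x \<in> subgroup_center G S"
      unfolding center [symmetric] using R(3) by (auto simp: N_def)
    then show "x \<in> weakly_closed_elems G S"
      unfolding weakly_closed_elems_alt[OF S.subset] using x VS W by (auto simp: N_def)
  qed
  with fixed_points_complement[OF psubV commV N NV sylN] center show ?thesis by simp
qed

lemma conjugation_control:
  assumes "odd p" and V: "psub V" "\<And>u v. \<lbrakk>u \<in> V; v \<in> V\<rbrakk> \<Longrightarrow> u \<otimes> v = v \<otimes> u"
    and N: "subgroup N G" "N \<subseteq> normalizer G V"
    and J: "psub J" "J = generate G A" "A \<subseteq> J"
    and quad: "\<And>a v. \<lbrakk>a \<in> A; v \<in> V\<rbrakk> \<Longrightarrow> cj a (cj a v \<otimes> inv v) = cj a v \<otimes> inv v"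
    and D: "subgroup D G" "J \<subseteq> D" "D \<subseteq> N" "\<And>h. \<lbrakk>h \<in> N; J \<subseteq> cj h ` D\<rbrakk> \<Longrightarrow> h \<in> D"
    and x: "x \<in> V" "\<And>g. g \<in> D \<Longrightarrow> cj g x = x"
  shows "g \<in> N \<Longrightarrow> cj g x = x"
proof -
  note sV = psub_subgroup[OF V(1)]
  interpret N: subgroup N G by fact
  interpret A: p_action "G\<lparr>carrier := N\<rparr>" p "G\<lparr>carrier := V\<rparr>" cj
    by (rule conjugation_p_action) (use sV V N in auto)
  obtain e where e: "\<And>v. v \<in> V \<Longrightarrow> v [^] (p ^ e) = \<one>" by (rule p_group_exponent[OF V(1)]) blast
  have JN: "J \<subseteq> N" using D by blast
  have "A.cj g y = cj g y" if "g \<in> N" for g y using conj_by_subgroup[OF N(1) that] .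
  then have A_cj: "A.cj h ` D = cj h ` D" if "h \<in> N" for h using that by simp
  have "x \<in> A.fixed (carrier (G\<lparr>carrier := N\<rparr>))"
  proof (rule A.control_of_fixed_points[OF \<open>odd p\<close>, where D = D and k = e and J = J and A = A])
    show "subgroup D (G\<lparr>carrier := N\<rparr>)" by (rule subgroup_incl[OF D(1) N(1) D(3)])
    show "x \<in> A.fixed D" using x by (simp add: A.fixed_def)
    show "x [^]\<^bsub>G\<lparr>carrier := V\<rparr>\<^esub> p ^ e = \<one>\<^bsub>G\<lparr>carrier := V\<rparr>\<^esub>"
      using e[OF x(1)] nat_pow_consistent[of x "p ^ e" V] by simp
    show "A.psub J"
      using J(1) subgroup_incl[OF psub_subgroup[OF J(1)] N(1) JN] by (auto simp: A.psub_def psub_def)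
    show "J = generate (G\<lparr>carrier := N\<rparr>) A"
      using J(2,3) JN generate_consistent[OF _ N(1), of A] by auto
    show "h \<in> D" if "h \<in> carrier (G\<lparr>carrier := N\<rparr>)" "J \<subseteq> A.cj h ` D" for h
      using that D(4) A_cj by auto
  qed (use J D quad sV in auto)
  then show "cj g x = x" if "g \<in> N" using that by (simp add: A.fixed_def)
qed

section \<open>The Thompson subgroup\<close>

definition abelian_sub :: "'a set \<Rightarrow> bool" where
  "abelian_sub A \<longleftrightarrow> subgroup A G \<and> (\<forall>x\<in>A. \<forall>y\<in>A. x \<otimes> y = y \<otimes> x)"

definition max_abelian :: "'a set \<Rightarrow> 'a set \<Rightarrow> bool" where
  "max_abelian P A \<longleftrightarrow> abelian_sub A \<and> A \<subseteq> P \<and> (\<forall>B. abelian_sub B \<longrightarrow> B \<subseteq> P \<longrightarrow> card B \<le> card A)"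

definition thompson :: "'a set \<Rightarrow> 'a set" where
  "thompson P = generate G (\<Union>{A. max_abelian P A})"

lemma abelian_subD: "\<lbrakk>abelian_sub A; x \<in> A; y \<in> A\<rbrakk> \<Longrightarrow> x \<otimes> y = y \<otimes> x"
  unfolding abelian_sub_def by metis

lemma abelian_sub_subgroup: "abelian_sub A \<Longrightarrow> subgroup A G"
  by (simp add: abelian_sub_def)

lemma max_abelian_abelian: "max_abelian P A \<Longrightarrow> abelian_sub A"
  by (simp add: max_abelian_def)

lemma max_abelian_subset: "max_abelian P A \<Longrightarrow> A \<subseteq> P"
  by (simp add: max_abelian_def)

lemma abelian_sub_cj:
  assumes "abelian_sub A" "g \<in> carrier G"
  shows "abelian_sub (cj g ` A)"
proof -
  interpret A: subgroup A G by (rule abelian_sub_subgroup) fact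
  have "cj g x \<otimes> cj g y = cj g y \<otimes> cj g x" if "x \<in> A" "y \<in> A" for x y
    using abelian_subD[OF assms(1) that] assms(2) that by (simp flip: cj_hom)
  then show ?thesis
    using subgroup_cj[OF A.subgroup_axioms assms(2)] by (auto simp: abelian_sub_def)
qed

lemma abelian_sub_set_mult:
  assumes A: "abelian_sub A" and B: "abelian_sub B" and AB: "\<And>a b. \<lbrakk>a \<in> A; b \<in> B\<rbrakk> \<Longrightarrow> a \<otimes> b = b \<otimes> a"
  shows "abelian_sub (A <#> B)"
proof -
  interpret A: subgroup A G by (rule abelian_sub_subgroup) fact
  interpret B: subgroup B G by (rule abelian_sub_subgroup) fact
  have eq: "(a \<otimes> b) \<otimes> (a' \<otimes> b') = (a \<otimes> a') \<otimes> (b \<otimes> b')" if "a \<in> A" "b \<in> B" "a' \<in> A" "b' \<in> B" for a b a' b'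
  proof -
    have "(a \<otimes> b) \<otimes> (a' \<otimes> b') = a \<otimes> (b \<otimes> a') \<otimes> b'" using that by (simp add: m_assoc)
    also have "b \<otimes> a' = a' \<otimes> b" using AB[OF that(3,2)] by simp
    finally show ?thesis using that by (simp add: m_assoc)
  qed
  have "subgroup (A <#> B) G"
  proof (rule subgroupI)
    fix x y assume "x \<in> A <#> B" "y \<in> A <#> B"
    then obtain a b a' b' where *: "a \<in> A" "b \<in> B" "x = a \<otimes> b" "a' \<in> A" "b' \<in> B" "y = a' \<otimes> b'"
      unfolding set_mult_def by blast
    have "inv x = inv a \<otimes> inv b" using * AB[of "inv a" "inv b"] by (simp add: inv_mult_group)
    then show "inv x \<in> A <#> B" using * unfolding set_mult_def by blast
    show "x \<otimes> y \<in> A <#> B" using eq[of a b a' b'] * unfolding set_mult_def by blast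
  next
    show "A <#> B \<noteq> {}" using A.one_closed B.one_closed unfolding set_mult_def by blast
  qed (auto simp: set_mult_def)
  moreover have "x \<otimes> y = y \<otimes> x" if xy: "x \<in> A <#> B" "y \<in> A <#> B" for x y
  proof -
    obtain a b where 1: "a \<in> A" "b \<in> B" "x = a \<otimes> b" using xy(1) unfolding set_mult_def by blast
    obtain a' b' where 2: "a' \<in> A" "b' \<in> B" "y = a' \<otimes> b'" using xy(2) unfolding set_mult_def by blast
    show ?thesis
      using eq[of a b a' b'] eq[of a' b' a b] abelian_subD[OF A 1(1) 2(1)] abelian_subD[OF B 1(2) 2(2)] 1 2
      by simp
  qed
  ultimately show ?thesis unfolding abelian_sub_def by blast
qed

lemma set_mult_subset:
  assumes "subgroup P G" "A \<subseteq> P" "B \<subseteq> P"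
  shows "A <#> B \<subseteq> P"
  unfolding set_mult_def using assms subgroup.m_closed[OF assms(1)] by blast

lemma abelian_sub_centralizer:
  assumes "abelian_sub A" "subgroup H G"
  shows "abelian_sub {v \<in> A. \<forall>y\<in>H. cj v y = y}"
  using subgroup_fixed_points[OF abelian_sub_subgroup[OF assms(1)] subgroup.subset[OF assms(2)]]
    abelian_subD[OF assms(1)]
  unfolding abelian_sub_def by blast

lemma max_abelian_exists:
  assumes "subgroup P G"
  shows "\<exists>A. max_abelian P A"
proof -
  let ?P = "\<lambda>B. abelian_sub B \<and> B \<subseteq> P"
  have "?P {\<one>}"
    using triv_subgroup subgroup.one_closed[OF assms] by (simp add: abelian_sub_def)
  moreover have "\<forall>B. ?P B \<longrightarrow> card B < Suc (card P)"
    using finite_subgroup[OF assms] by (simp add: card_mono less_Suc_eq_le)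
  ultimately obtain A where "?P A" "\<forall>B. ?P B \<longrightarrow> card B \<le> card A"
    using ex_has_greatest_nat[of ?P "{\<one>}" card "Suc (card P)"] by blast
  then show ?thesis unfolding max_abelian_def by blast
qed

text \<open>\<open>A <#> B\<close> is an abelian subgroup of \<open>P\<close> that contains
  \<open>A\<close>, so by maximality of the order it equals \<open>A\<close>.\<close>

lemma max_abelian_contains:
  assumes A: "max_abelian P A" and P: "subgroup P G" and B: "abelian_sub B" "B \<subseteq> P"
    and comm: "\<And>a b. \<lbrakk>a \<in> A; b \<in> B\<rbrakk> \<Longrightarrow> a \<otimes> b = b \<otimes> a"
  shows "B \<subseteq> A"
proof -
  note aA = max_abelian_abelian[OF A]
  note sub = subset_set_mult[OF abelian_sub_subgroup[OF aA] abelian_sub_subgroup[OF B(1)]]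
  have AP: "A <#> B \<subseteq> P" by (rule set_mult_subset[OF P max_abelian_subset[OF A] B(2)])
  then have "card (A <#> B) \<le> card A"
    using A abelian_sub_set_mult[OF aA B(1) comm] by (simp add: max_abelian_def)
  then have "A = A <#> B"
    using sub(1) finite_subset[OF AP finite_subgroup[OF P]] card_seteq by blast
  with sub(2) show ?thesis by simp
qed

lemma max_abelian_cj:
  assumes "max_abelian P A" "P \<subseteq> carrier G" "g \<in> carrier G"
  shows "max_abelian (cj g ` P) (cj g ` A)"
proof -
  note A = max_abelian_abelian[OF assms(1)]
  note sA = abelian_sub_subgroup[OF A]
  have "card B \<le> card (cj g ` A)" if B: "abelian_sub B" "B \<subseteq> cj g ` P" for B
  proof -
    have Bc: "B \<subseteq> carrier G" using subgroup.subset[OF abelian_sub_subgroup[OF B(1)]] .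
    have "abelian_sub (cj (inv g) ` B)" using abelian_sub_cj[OF B(1)] assms(3) by simp
    moreover have "cj (inv g) ` B \<subseteq> P"
      using B(2) cj_image_subset_iff[of "inv g" B P] Bc assms(2,3) by simp
    ultimately have "card (cj (inv g) ` B) \<le> card A" using assms(1) by (simp add: max_abelian_def)
    then show ?thesis using card_cj[of "inv g" B] card_cj[of g A] Bc subgroup.subset[OF sA] assms(3) by simp
  qed
  then show ?thesis
    using abelian_sub_cj[OF A assms(3)] max_abelian_subset[OF assms(1)] by (auto simp: max_abelian_def)
qed

lemma thompson_subgroup:
  assumes "subgroup P G"
  shows "subgroup (thompson P) G" "thompson P \<subseteq> P"
proof -
  have "\<Union>{A. max_abelian P A} \<subseteq> P" using max_abelian_subset by blast
  then show "thompson P \<subseteq> P" unfolding thompson_def by (rule generate_subgroup_incl[OF _ assms])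
  show "subgroup (thompson P) G"
    unfolding thompson_def using max_abelian_subset subgroup.subset[OF assms]
    by (intro generate_is_subgroup) blast
qed

lemma center_subset_thompson:
  assumes "subgroup P G"
  shows "subgroup_center G P \<subseteq> thompson P"
proof -
  obtain A where A: "max_abelian P A" using max_abelian_exists[OF assms] by blast
  have "subgroup_center G P \<subseteq> A"
  proof (rule max_abelian_contains[OF A assms])
    show "abelian_sub (subgroup_center G P)"
      unfolding abelian_sub_def
      using subgroup_subgroup_center[OF assms] subgroup_center_comm subgroup_center_subset by blast
    show "subgroup_center G P \<subseteq> P" by (rule subgroup_center_subset)
    show "a \<otimes> b = b \<otimes> a" if "a \<in> A" "b \<in> subgroup_center G P" for a b
      using subgroup_center_comm[OF that(2)] that(1) max_abelian_subset[OF A] by force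
  qed
  moreover have "A \<subseteq> thompson P"
    unfolding thompson_def using A generate.incl[of _ "\<Union>{A. max_abelian P A}" G] by blast
  ultimately show ?thesis by blast
qed

lemma generate_cj_subset:
  assumes "g \<in> carrier G" "E \<subseteq> carrier G" "subgroup H G" "cj g ` E \<subseteq> H"
  shows "cj g ` generate G E \<subseteq> H"
proof -
  have H: "H \<subseteq> carrier G" using subgroup.subset[OF assms(3)] .
  have "E \<subseteq> cj (inv g) ` H" using assms(4) cj_image_subset_iff[OF assms(1,2) H] by simp
  then have "generate G E \<subseteq> cj (inv g) ` H"
    by (rule generate_subgroup_incl[OF _ subgroup_cj[OF assms(3) inv_closed[OF assms(1)]]])
  then show ?thesis
    using cj_image_subset_iff[OF assms(1) generate_incl[OF assms(2)] H] by simp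
qed

lemma cj_image_eqI:
  assumes "g \<in> carrier G" "subgroup H G" "cj g ` H \<subseteq> H"
  shows "cj g ` H = H"
  using assms finite_subgroup[OF assms(2)] card_cj[OF assms(1) subgroup.subset[OF assms(2)]]
  by (metis card_seteq order_refl)

lemma thompson_cj:
  assumes "subgroup P G" "g \<in> carrier G"
  shows "thompson (cj g ` P) = cj g ` thompson P"
proof -
  have sub: "cj g ` thompson P \<subseteq> thompson (cj g ` P)" if "subgroup P G" "g \<in> carrier G" for P g
  proof -
    have "\<Union>{A. max_abelian P A} \<subseteq> carrier G"
      using max_abelian_subset subgroup.subset[OF that(1)] by blast
    moreover have "cj g ` \<Union>{A. max_abelian P A} \<subseteq> thompson (cj g ` P)"
      unfolding thompson_def
    proof (rule subsetI, elim imageE UnionE CollectE)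
      fix y a A assume "y = cj g a" "a \<in> A" "max_abelian P A"
      then have "y \<in> \<Union>{A. max_abelian (cj g ` P) A}"
        using max_abelian_cj[OF _ subgroup.subset[OF that(1)] that(2)] by blast
      then show "y \<in> generate G (\<Union>{A. max_abelian (cj g ` P) A})" by (rule generate.incl)
    qed
    ultimately show ?thesis
      using generate_cj_subset[OF that(2)] thompson_subgroup(1)[OF subgroup_cj[OF that]]
      by (subst thompson_def) blast
  qed
  note sP = subgroup_cj[OF assms]
  have "cj (inv g) ` thompson (cj g ` P) \<subseteq> thompson P"
    using sub[OF sP, of "inv g"] cj_image_cancel(1)[of g P] assms subgroup.subset[OF assms(1)] by simp
  then have "thompson (cj g ` P) \<subseteq> cj g ` thompson P"
    using cj_image_subset_iff[of "inv g" "thompson (cj g ` P)" "thompson P"] assms(2)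
      subgroup.subset[OF thompson_subgroup(1)[OF sP]] subgroup.subset[OF thompson_subgroup(1)[OF assms(1)]] by simp
  with sub[OF assms] show ?thesis by blast
qed

lemma normalizer_thompson:
  assumes "subgroup P G"
  shows "normalizer G P \<subseteq> normalizer G (thompson P)"
proof
  fix g assume "g \<in> normalizer G P"
  then have g: "g \<in> carrier G" "cj g ` P = P" using normalizer_iff[OF subgroup.subset[OF assms]] by simp_all
  then have "cj g ` thompson P = thompson P" using thompson_cj[OF assms g(1)] by simp
  then show "g \<in> normalizer G (thompson P)"
    using g(1) normalizer_iff[OF subgroup.subset[OF thompson_subgroup(1)[OF assms]]] by simp
qed

text \<open>Since an abelian subgroup of largest order in \<open>P\<close> lies in \<open>T\<close>,
  the largest order is the same for both, and hence so is the family of generating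
  subgroups.\<close>

lemma thompson_eq:
  assumes "subgroup P G" "T \<subseteq> P" "\<And>A. max_abelian P A \<Longrightarrow> A \<subseteq> T"
  shows "thompson T = thompson P"
proof -
  obtain B where B: "max_abelian P B" using max_abelian_exists[OF assms(1)] by blast
  have "max_abelian T A \<longleftrightarrow> max_abelian P A" for A
  proof
    assume "max_abelian P A"
    then show "max_abelian T A" using assms(2,3) unfolding max_abelian_def by blast
  next
    assume A: "max_abelian T A"
    then have "card B \<le> card A" using B assms(3)[OF B] unfolding max_abelian_def by blast
    then show "max_abelian P A" using A B assms(2) unfolding max_abelian_def by (meson order_trans)
  qed
  then show ?thesis by (simp add: thompson_def)
qed

section \<open>Thompson replacement and quadratic elements\<close>

lemma generate_cj_fixed:
  assumes "c \<in> carrier G" "E \<subseteq> carrier G" "\<And>y. y \<in> E \<Longrightarrow> cj c y = y" "y \<in> generate G E"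
  shows "cj c y = y"
  using assms(4)
proof induction
  case (inv h)
  then show ?case using assms by (simp add: cj_inv subset_iff)
next
  case (eng h1 h2)
  then show ?case using assms generate_in_carrier[OF assms(2)] by (simp add: cj_hom)
qed (use assms in auto)

text \<open>The \<open>p\<close>-group \<open>A\<close> permutes the cosets of \<open>N\<close> in
  \<open>V\<close> by conjugation. Their number is divisible by \<open>p\<close> and the trivial
  coset is fixed, so a second coset is fixed as well; \<open>x\<close> represents it.\<close>

lemma conj_fixed_coset:
  assumes A: "psub A" and V: "psub V" "A \<subseteq> normalizer G V"
    and N: "subgroup N G" "N \<subset> V" "A \<subseteq> normalizer G N"
  obtains x where "x \<in> V" "x \<notin> N" "\<And>a. a \<in> A \<Longrightarrow> inv x \<otimes> cj a x \<in> N"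
proof -
  note sV = psub_subgroup[OF V(1)] and sA = psub_subgroup[OF A]
  interpret A: subgroup A G by fact
  interpret V: subgroup V G by fact
  interpret N: subgroup N G by fact
  let ?E = "(\<lambda>v. v <# N) ` V"
  obtain n where n: "card A = p ^ n" using A by (auto simp: psub_def)
  have cjV: "cj a v \<in> V" if "a \<in> A" "v \<in> V" for a v
    using that V(2) normalizer_iff[OF V.subset] by blast
  have coset: "cj a ` (v <# N) = cj a v <# N" if "a \<in> A" "v \<in> V" for a v
  proof -
    have 1: "cj a ` N = N" using that(1) N(3) normalizer_iff[OF N.subset] by blast
    have lc: "g <# N = (\<lambda>h. g \<otimes> h) ` N" for g by (auto simp: l_coset_def)
    have "cj a ` (v <# N) = (\<lambda>h. cj a v \<otimes> cj a h) ` N"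
      unfolding lc image_image using that by (intro image_cong) (auto simp: cj_hom)
    also have "\<dots> = (\<lambda>y. cj a v \<otimes> y) ` cj a ` N" by (simp add: image_image)
    finally show ?thesis unfolding 1 lc .
  qed
  have fix_iff: "cj a ` (v <# N) = v <# N \<longleftrightarrow> inv v \<otimes> cj a v \<in> N" if "a \<in> A" "v \<in> V" for a v
    using coset[OF that] lcoset_eq_iff[OF N(1), of v "cj a v"] that by auto
  have Ec: "C \<subseteq> carrier G" if C: "C \<in> ?E" for C
  proof -
    obtain v where "v \<in> V" "C = v <# N" using C by (elim imageE)
    then show ?thesis using l_coset_subset_G[OF N.subset, of v] by simp
  qed
  have "card ?E mod p = card {C \<in> ?E. \<forall>a\<in>A. cj a ` C = C} mod p"
  proof (rule p_group_fixed_points[OF sA n prime_p])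
    show "finite ?E" using finite_subgroup[OF sV] by blast
    fix g C assume g: "g \<in> A" "C \<in> ?E"
    then obtain v where v: "v \<in> V" "C = v <# N" by (elim imageE)
    then show "cj g ` C \<in> ?E" using imageI[OF cjV[OF g(1) v(1)], of "\<lambda>v. v <# N"] coset[OF g(1) v(1)] by simp
  next
    fix g h C assume "g \<in> A" "h \<in> A" "C \<in> ?E"
    then show "cj (g \<otimes> h) ` C = cj g ` cj h ` C"
      using Ec by (intro cj_image_m) auto
  next
    fix C assume "C \<in> ?E"
    then show "cj \<one> ` C = C" using Ec by (intro cj_image_one) auto
  qed
  moreover have "p dvd card ?E"
  proof -
    have eq: "card ?E * card N = card V"
      using card_lcosets[OF sV N(1)] N(2) finite_subgroup[OF sV] by auto
    have "card N < card V" using N(2) finite_subgroup[OF sV] psubset_card_mono by blast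
    have "card ?E dvd card V" using eq by (metis dvd_triv_left)
    then obtain i where i: "card ?E = p ^ i" using V(1) divides_primepow_nat[OF prime_p] by (auto simp: psub_def)
    with eq \<open>card N < card V\<close> have "i \<noteq> 0" by (intro notI) simp
    then show ?thesis using i by simp
  qed
  ultimately have 0: "card {C \<in> ?E. \<forall>a\<in>A. cj a ` C = C} mod p = 0" by (simp add: dvd_imp_mod_0)
  have one: "\<one> <# N = N" by (rule lcos_mult_one[OF N.subset])
  have "inv \<one> \<otimes> cj a \<one> \<in> N" if "a \<in> A" for a using that by (simp add: N.one_closed)
  then have "\<forall>a\<in>A. cj a ` N = N" using fix_iff[OF _ V.one_closed] one by metis
  then have "N \<in> {C \<in> ?E. \<forall>a\<in>A. cj a ` C = C}" using one V.one_closed by (auto intro!: image_eqI[of _ _ \<one>])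
  have "{C \<in> ?E. \<forall>a\<in>A. cj a ` C = C} \<noteq> {N}" using 0 p_gt_1 by auto
  have "\<exists>C. C \<in> {C \<in> ?E. \<forall>a\<in>A. cj a ` C = C} \<and> C \<noteq> N" 
  proof -
    have "\<exists>C. C \<in> F \<and> C \<noteq> N" if "N \<in> F" "F \<noteq> {N}" for F using that by blast
    from this[OF \<open>N \<in> _\<close> \<open>_ \<noteq> {N}\<close>] show ?thesis .
  qed
  then obtain C where C: "C \<in> ?E" "\<forall>a\<in>A. cj a ` C = C" "C \<noteq> N" by (elim exE conjE CollectE)
  from C(1) obtain x where x: "x \<in> V" "C = x <# N" by (elim imageE)
  show thesis
  proof (rule that[of x])
    show "x \<notin> N" using x C(3) lcoset_eq_iff[OF N(1), of \<one> x] one by auto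
    show "inv x \<otimes> cj a x \<in> N" if "a \<in> A" for a
      using fix_iff[OF that x(1)] C(2) x(2) that by simp
  qed fact
qed

text \<open>For \<open>x\<close> as in the previous lemma with \<open>N = V \<inter> N\<^sub>G(A)\<close>, the replacement for \<open>A\<close> is \<open>M C\<^sub>A(M)\<close>, where
  \<open>M\<close> is generated by the commutators \<open>m a\<close> of \<open>x\<close> with the elements of \<open>A\<close>. It is large enough because
  \<open>a \<mapsto> m a\<close> is injective modulo \<open>C\<^sub>A(M)\<close>.\<close>

lemma thompson_replacement:
  assumes P: "psub P" and V: "abelian_sub V" "V \<subseteq> P" "P \<subseteq> normalizer G V"
    and A: "max_abelian P A" and not_norm: "\<not> V \<subseteq> normalizer G A"
  obtains B where "max_abelian P B" "A \<inter> V \<subset> B \<inter> V" "B \<subseteq> normalizer G A"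
proof -
  note sP = psub_subgroup[OF P]
  note aA = max_abelian_abelian[OF A]
  note sA = abelian_sub_subgroup[OF aA] and sV = abelian_sub_subgroup[OF V(1)]
  have AP: "A \<subseteq> P" by (rule max_abelian_subset) fact
  interpret A: subgroup A G by fact
  interpret V: subgroup V G by fact
  define N where "N = V \<inter> normalizer G A"
  have sN: "subgroup N G"
    unfolding N_def by (rule subgroups_Inter_pair[OF sV normalizer_subgroup[OF A.subset]])
  have NV: "N \<subset> V" using not_norm by (auto simp: N_def)
  \<comment> \<open>\<open>A\<close> normalizes both \<open>V\<close> and its own normalizer, hence
    their intersection.\<close>
  have AN: "A \<subseteq> normalizer G N"
  proof
    fix a assume a: "a \<in> A"
    have "cj a ` V = V" using a AP V(3) normalizer_iff[OF V.subset] by blast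
    moreover have "cj a ` normalizer G A = normalizer G A"
      using a subgroup_subset_normalizer[OF sA] by (intro cj_image_self normalizer_subgroup A.subset) auto
    moreover have "cj a ` (V \<inter> normalizer G A) = cj a ` V \<inter> cj a ` normalizer G A"
      using a by (intro inj_on_image_Int[OF inj_on_cj]) (use normalizer_subset[OF A.subset] in auto)
    ultimately have "cj a ` N = N" by (simp add: N_def)
    then show "a \<in> normalizer G N" using a normalizer_iff[OF subgroup.subset[OF sN]] by simp
  qed
  have psubs: "psub A" "psub V" using psub_mono[OF P] sA sV AP V(2) by auto
  obtain x where x: "x \<in> V" "x \<notin> N" "\<And>a. a \<in> A \<Longrightarrow> inv x \<otimes> cj a x \<in> N"
    using conj_fixed_coset[OF psubs _ sN NV AN] AP V(3) by blast
  define m where "m a = inv x \<otimes> cj a x" for a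
  define M where "M = generate G (m ` A)"
  have xc [simp]: "x \<in> carrier G" using x(1) by simp
  have mN: "m a \<in> N" if "a \<in> A" for a using x(3)[OF that] by (simp add: m_def)
  then have mV: "m a \<in> V" if "a \<in> A" for a using that NV by blast
  have Vcomm: "u \<otimes> v = v \<otimes> u" if "u \<in> V" "v \<in> V" for u v using abelian_subD[OF V(1) that] .
  have Acomm: "u \<otimes> v = v \<otimes> u" if "u \<in> A" "v \<in> A" for u v using abelian_subD[OF aA that] .
  have mc: "m ` A \<subseteq> carrier G" using mV by auto
  have cjx: "cj a x = x \<otimes> m a" if "a \<in> A" for a using that by (simp add: m_def)
  have MN: "M \<subseteq> N" unfolding M_def by (rule generate_subgroup_incl[OF _ sN]) (use mN in blast)
  have MV: "M \<subseteq> V" using MN NV by blast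
  have sM: "subgroup M G" unfolding M_def by (rule generate_is_subgroup[OF mc])
  have mM: "m a \<in> M" if "a \<in> A" for a unfolding M_def using that by (blast intro: generate.incl)
  interpret M: subgroup M G by fact
  have aM: "abelian_sub M" using sM MV Vcomm unfolding abelian_sub_def by blast
  define C where "C = {a \<in> A. \<forall>y\<in>M. cj a y = y}"
  have aC: "abelian_sub C" unfolding C_def by (rule abelian_sub_centralizer[OF aA sM])
  note sC = abelian_sub_subgroup[OF aC]
  interpret C: subgroup C G by fact
  have CA: "C \<subseteq> A" by (auto simp: C_def)
  have MC_comm: "u \<otimes> v = v \<otimes> u" if "u \<in> M" "v \<in> C" for u v
  proof -
    have "cj v u = u" "v \<in> carrier G" "u \<in> carrier G" using that CA by (auto simp: C_def)
    then show ?thesis using cj_fix_iff[of v u] by simp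
  qed
  define B where "B = M <#> C"
  have aB: "abelian_sub B" unfolding B_def by (rule abelian_sub_set_mult[OF aM aC MC_comm])
  have BP: "B \<subseteq> P" unfolding B_def 
    by (rule set_mult_subset[OF sP order_trans[OF MV V(2)] order_trans[OF CA AP]])
  have sub: "M \<subseteq> B" "C \<subseteq> B" unfolding B_def using subset_set_mult[OF sM sC] by auto
  \<comment> \<open>Put \<open>c = inv a \<otimes> b\<close>. As \<open>d\<close> lies in
    \<open>A\<close>, it commutes with \<open>A\<close>, and comparing the conjugates of
    \<open>x\<close> by \<open>a\<close> and \<open>b\<close> gives
    \<open>cj c x = x \<otimes> d\<close>. Conjugation by \<open>c\<close> also multiplies each
    \<open>cj u x\<close> by \<open>d\<close>, so it changes \<open>m u\<close> only by conjugation
    with \<open>d\<close>; both lie in the abelian \<open>V\<close>. Thus \<open>c\<close>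
    centralizes the generators of \<open>M\<close>.\<close>
  have key: "inv a \<otimes> b \<in> C" if ab: "a \<in> A" "b \<in> A" "inv (m a) \<otimes> m b \<in> C" for a b
  proof -
    define d where "d = inv (m a) \<otimes> m b"
    define c where "c = inv a \<otimes> b"
    have d: "d \<in> A" "d \<in> V" "d \<in> C" using ab mV CA unfolding d_def by auto
    have c: "c \<in> A" using ab by (simp add: c_def)
    have [simp]: "m a \<in> carrier G" "m b \<in> carrier G" using mV ab by auto
    have "cj b x = cj a x \<otimes> d" using ab by (simp add: cjx d_def m_assoc)
    moreover have "b = a \<otimes> c" using ab by (simp add: c_def)
    ultimately have "cj a (cj c x) = cj a x \<otimes> d" using ab c by (simp add: cj_m)
    also have "d = cj a d" using cj_fix_iff[of a d] Acomm[of a d] ab d by auto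
    finally have "cj a (cj c x) = cj a (x \<otimes> d)" using ab d by (simp add: cj_hom)
    then have cx: "cj c x = x \<otimes> d" using ab c d by (simp add: cj_eq_iff)
    have cm: "cj c (m u) = m u" if u: "u \<in> A" for u
    proof -
      have [simp]: "m u \<in> carrier G" using mV u by auto
      have "cj c (cj u x) = cj u (cj c x)"
        using Acomm[OF c u] c u by (simp flip: cj_m)
      also have "\<dots> = cj u x \<otimes> cj u d" using cx u d by (simp add: cj_hom)
      also have "cj u d = d" using cj_fix_iff[of u d] Acomm[of u d] u d by auto
      finally have 1: "cj c (cj u x) = cj u x \<otimes> d" .
      have "cj c (m u) = inv (x \<otimes> d) \<otimes> (cj u x \<otimes> d)"
        using u c by (simp add: m_def cj_hom cj_inv 1 cx)
      also have "\<dots> = inv d \<otimes> m u \<otimes> d"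
        using u d by (simp add: m_def inv_mult_group m_assoc)
      also have "\<dots> = inv d \<otimes> (d \<otimes> m u)" using Vcomm[OF d(2) mV[OF u]] d by (simp add: m_assoc)
      also have "\<dots> = m u" using d by simp
      finally show ?thesis .
    qed
    have "cj c y = y" if "y \<in> M" for y
      by (rule generate_cj_fixed[OF _ mc _ that[unfolded M_def]]) (use c cm in auto)
    then show ?thesis using c by (simp add: C_def c_def)
  qed
  have "card A \<le> card B"
  proof -
    have "card ((\<lambda>a. a <# C) ` A) \<le> card ((\<lambda>b. b <# C) ` B)"
    proof -
      have "card ((\<lambda>a. a <# C) ` A) \<le> card ((\<lambda>b. b <# C) ` (m ` A))"
      proof -
        have "\<exists>f. inj_on f ((\<lambda>a. a <# C) ` A) \<and> f ` (\<lambda>a. a <# C) ` A \<subseteq> (\<lambda>b. b <# C) ` (m ` A)"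
        proof (intro exI conjI)
          let ?r = "\<lambda>Z. SOME a. a \<in> A \<and> Z = a <# C"
          have r: "?r Z \<in> A \<and> Z = ?r Z <# C" if "Z \<in> (\<lambda>a. a <# C) ` A" for Z
            by (rule someI_ex) (use that in blast)
          show "inj_on (\<lambda>Z. m (?r Z) <# C) ((\<lambda>a. a <# C) ` A)"
          proof (rule inj_onI)
            fix Y Z assume YZ: "Y \<in> (\<lambda>a. a <# C) ` A" "Z \<in> (\<lambda>a. a <# C) ` A" "m (?r Y) <# C = m (?r Z) <# C"
            have "inv (m (?r Y)) \<otimes> m (?r Z) \<in> C"
              using YZ r[OF YZ(1)] r[OF YZ(2)] mV lcoset_eq_iff[OF sC, of "m (?r Y)" "m (?r Z)"] by simp
            then have "inv (?r Y) \<otimes> ?r Z \<in> C" using key r[OF YZ(1)] r[OF YZ(2)] by blast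
            then show "Y = Z" using lcoset_eq_iff[OF sC, of "?r Y" "?r Z"] r[OF YZ(1)] r[OF YZ(2)] by simp
          qed
          show "(\<lambda>Z. m (?r Z) <# C) ` (\<lambda>a. a <# C) ` A \<subseteq> (\<lambda>b. b <# C) ` (m ` A)"
            using r by blast
        qed
        then show ?thesis using finite_subgroup[OF sA] by (meson card_inj_on_le finite_imageI)
      qed
      also have "\<dots> \<le> card ((\<lambda>b. b <# C) ` B)"
        using finite_subgroup[OF abelian_sub_subgroup[OF aB]] mM sub(1) by (intro card_mono) auto
      finally show ?thesis .
    qed
    then show ?thesis
      using card_lcosets[OF sA sC CA finite_subgroup[OF sA]]
        card_lcosets[OF abelian_sub_subgroup[OF aB] sC sub(2) finite_subgroup[OF abelian_sub_subgroup[OF aB]]]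
      by (metis mult_le_mono1)
  qed
  then have B: "max_abelian P B"
    using A aB BP unfolding max_abelian_def by (meson order_trans)
  have "A \<inter> V \<subseteq> B"
  proof
    fix a assume a: "a \<in> A \<inter> V"
    have "cj a y = y" if "y \<in> M" for y
      using cj_fix_iff[of a y] a that MV Vcomm[of a y] by auto
    then have "a \<in> C" using a by (simp add: C_def)
    then show "a \<in> B" using sub by blast
  qed
  \<comment> \<open>Conjugating \<open>a\<close> by \<open>inv x\<close> yields
    \<open>m a \<otimes> a\<close>. If \<open>M\<close> were inside \<open>A\<close>, then
    \<open>x\<close> would normalize \<open>A\<close>, against its choice outside
    \<open>N\<close>.\<close>
  moreover have "\<not> M \<subseteq> A"
  proof
    assume MA: "M \<subseteq> A"
    have "cj (inv x) a \<in> A" if a: "a \<in> A" for a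
    proof -
      have "m a = cj (inv x) a \<otimes> inv a" using a by (simp add: m_def conj_by_def m_assoc)
      then have "cj (inv x) a = m a \<otimes> a" using a by (simp add: m_assoc)
      then show ?thesis using MA mM[OF a] a by auto
    qed
    then have "cj (inv x) ` A \<subseteq> A" by blast
    then have "cj (inv x) ` A = A"
      using card_cj[of "inv x" A] finite_subgroup[OF sA] by (metis A.subset card_seteq inv_closed order_refl xc)
    then have "inv x \<in> normalizer G A" using normalizer_iff[OF A.subset] by simp
    then have "inv (inv x) \<in> normalizer G A"
      by (rule subgroup.m_inv_closed[OF normalizer_subgroup[OF A.subset]])
    then show False using x(1,2) by (simp add: N_def)
  qed
  ultimately have int: "A \<inter> V \<subset> B \<inter> V" using sub(1) MV by blast
  have "B \<subseteq> normalizer G A"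
    unfolding B_def
  proof (rule set_mult_subset[OF normalizer_subgroup[OF A.subset]])
    show "M \<subseteq> normalizer G A" using MN by (auto simp: N_def)
    show "C \<subseteq> normalizer G A" using CA subgroup_subset_normalizer[OF sA] by blast
  qed
  with that B int show thesis by blast
qed

text \<open>Among the maximal abelian subgroups outside \<open>T\<close>, take \<open>A\<close> with
  largest intersection with \<open>V\<close>. If \<open>V\<close> did not normalize
  \<open>A\<close>, replacement would give some \<open>B\<close> meeting \<open>V\<close> in more,
  so \<open>B\<close> would lie in \<open>T\<close> and centralize \<open>V\<close>. Then
  \<open>V\<close> would be inside \<open>B\<close>, which normalizes \<open>A\<close>. So
  \<open>V\<close> normalizes \<open>A\<close>, all commutators of \<open>V\<close> with
  \<open>A\<close> lie in the abelian \<open>A\<close>, and every element of \<open>A\<close> acts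
  quadratically.\<close>

lemma quadratic_element_exists:
  assumes P: "psub P" and V: "abelian_sub V" "V \<subseteq> P" "P \<subseteq> normalizer G V"
    and T: "\<And>t v. \<lbrakk>t \<in> T; v \<in> V\<rbrakk> \<Longrightarrow> t \<otimes> v = v \<otimes> t"
    and A: "max_abelian P A" "\<not> A \<subseteq> T"
  shows "\<exists>a\<in>P - T. \<forall>v\<in>V. cj a (cj a v \<otimes> inv v) = cj a v \<otimes> inv v"
proof -
  note sP = psub_subgroup[OF P]
  interpret V: subgroup V G by (rule abelian_sub_subgroup) fact
  let ?Q = "\<lambda>A. max_abelian P A \<and> \<not> A \<subseteq> T"
  have "\<forall>B. ?Q B \<longrightarrow> card (B \<inter> V) < Suc (card V)"
    using finite_subgroup[OF V.subgroup_axioms] by (simp add: card_mono less_Suc_eq_le)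
  then obtain A where A: "max_abelian P A" "\<not> A \<subseteq> T"
    and max: "\<And>B. ?Q B \<Longrightarrow> card (B \<inter> V) \<le> card (A \<inter> V)"
    using ex_has_greatest_nat[of ?Q A "\<lambda>B. card (B \<inter> V)" "Suc (card V)"] assms by blast
  note aA = max_abelian_abelian[OF A(1)]
  interpret A: subgroup A G by (rule abelian_sub_subgroup) fact
  have norm: "V \<subseteq> normalizer G A"
  proof (rule ccontr)
    assume "\<not> V \<subseteq> normalizer G A"
    from thompson_replacement[OF P V A(1) this] obtain B
      where B: "max_abelian P B" "A \<inter> V \<subset> B \<inter> V" "B \<subseteq> normalizer G A" by blast
    have "card (A \<inter> V) < card (B \<inter> V)"
      using B(2) finite_subgroup[OF V.subgroup_axioms] by (intro psubset_card_mono) auto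
    then have "B \<subseteq> T" using max[of B] B(1) by force
    then have "V \<subseteq> B" using max_abelian_contains[OF B(1) sP V(1,2)] T by blast
    with B(3) \<open>\<not> V \<subseteq> normalizer G A\<close> show False by blast
  qed
  obtain a where a: "a \<in> A" "a \<notin> T" using A by blast
  have "cj a (cj a v \<otimes> inv v) = cj a v \<otimes> inv v" if v: "v \<in> V" for v
  proof -
    have "cj v ` A = A" using v norm normalizer_iff[OF A.subset] by blast
    then have "cj v (inv a) \<in> A" using a by blast
    moreover have "cj a v \<otimes> inv v = a \<otimes> cj v (inv a)"
      using a v by (simp add: conj_by_def m_assoc)
    ultimately have w: "cj a v \<otimes> inv v \<in> A" using a by simp
    then show ?thesis using abelian_subD[OF aA a(1) w] a v cj_fix_iff[of a "cj a v \<otimes> inv v"] by simp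
  qed
  with a max_abelian_subset[OF A(1)] show ?thesis by blast
qed

section \<open>Odd primes\<close>

text \<open>In commutator notation \<open>[V, a, a] = 1\<close>. Elements that centralize
  \<open>V\<close> are included, which is how \<open>T\<close> gets into the subgroup generated by
  quadratic elements later on.\<close>

definition quadratic :: "'a set \<Rightarrow> 'a set" where
  "quadratic V = {a \<in> carrier G. \<forall>v\<in>V. cj a (cj a v \<otimes> inv v) = cj a v \<otimes> inv v}"

lemma quadratic_cj:
  assumes V: "subgroup V G" and n: "n \<in> normalizer G V" and a: "a \<in> quadratic V"
  shows "cj n a \<in> quadratic V"
proof -
  interpret V: subgroup V G by fact
  have n: "n \<in> carrier G" "cj n ` V = V" using n normalizer_iff[OF V.subset] by auto
  have ac: "a \<in> carrier G" using a by (simp add: quadratic_def)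
  have *: "cj (cj n a) (cj n w) = cj n (cj a w)" if "w \<in> carrier G" for w
    using n(1) ac that by (simp add: conj_by_def inv_mult_group m_assoc)
  have "cj (cj n a) (cj (cj n a) v \<otimes> inv v) = cj (cj n a) v \<otimes> inv v" if v: "v \<in> V" for v
  proof -
    obtain w where w: "w \<in> V" "v = cj n w" using v n(2) by blast
    then have wc: "w \<in> carrier G" by simp
    have "cj (cj n a) v \<otimes> inv v = cj n (cj a w \<otimes> inv w)"
      using w(2) wc ac n(1) by (simp add: * cj_hom cj_inv)
    moreover have "cj a (cj a w \<otimes> inv w) = cj a w \<otimes> inv w" using a w(1) by (simp add: quadratic_def)
    ultimately show ?thesis using wc ac by (simp add: *)
  qed
  then show ?thesis using n(1) ac by (simp add: quadratic_def)
qed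

lemma quadratic_generate_cj:
  assumes V: "subgroup V G" and P: "subgroup P G"
    and n: "n \<in> normalizer G V" "cj n ` (P \<inter> quadratic V) \<subseteq> P"
  shows "cj n ` generate G (P \<inter> quadratic V) = generate G (P \<inter> quadratic V)"
proof -
  have nc: "n \<in> carrier G" using n(1) normalizer_iff[OF subgroup.subset[OF V]] by simp
  have E: "P \<inter> quadratic V \<subseteq> carrier G" by (auto simp: quadratic_def)
  have sJ: "subgroup (generate G (P \<inter> quadratic V)) G" by (rule generate_is_subgroup[OF E])
  have "cj n ` (P \<inter> quadratic V) \<subseteq> P \<inter> quadratic V"
    using n(2) quadratic_cj[OF V n(1)] by blast
  then have "cj n ` (P \<inter> quadratic V) \<subseteq> generate G (P \<inter> quadratic V)"
    by (blast intro: generate.incl)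
  then show ?thesis by (intro cj_image_eqI[OF nc sJ] generate_cj_subset[OF nc E sJ])
qed

text \<open>The subgroup generated by the quadratic elements of a Sylow subgroup of \<open>N\<close> is weakly closed
  in that Sylow subgroup, which makes the trivial coset its only fixed point in \<open>control_of_fixed_points\<close>.\<close>

lemma quadratic_generate_control:
  assumes "odd p" and V: "abelian_sub V" "psub V" and N: "subgroup N G" "N \<subseteq> normalizer G V"
    and P: "syl N P" and J: "J = generate G (P \<inter> quadratic V)"
    and x: "x \<in> V" "\<And>g. g \<in> N \<inter> normalizer G J \<Longrightarrow> cj g x = x"
  shows "g \<in> N \<Longrightarrow> cj g x = x"
proof -
  note sV = abelian_sub_subgroup[OF V(1)] and sP = syl_subgroup[OF P] and PN = syl_subset[OF P]
  interpret N: subgroup N G by fact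
  have E: "P \<inter> quadratic V \<subseteq> carrier G" by (auto simp: quadratic_def)
  have EJ: "P \<inter> quadratic V \<subseteq> J" unfolding J by (blast intro: generate.incl)
  have JP: "J \<subseteq> P" unfolding J by (rule generate_subgroup_incl[OF _ sP]) simp
  have sJ: "subgroup J G" unfolding J by (rule generate_is_subgroup[OF E])
  have Jc: "J \<subseteq> carrier G" using subgroup.subset[OF sJ] .
  define D where "D = N \<inter> normalizer G J"
  have sD: "subgroup D G" unfolding D_def by (rule subgroups_Inter_pair[OF N(1) normalizer_subgroup[OF Jc]])
  interpret D: subgroup D G by fact
  have JD: "J \<subseteq> D" using JP PN subgroup_subset_normalizer[OF sJ] by (auto simp: D_def)
  have psubJ: "psub J" using psub_mono[OF syl_psub[OF P] sJ JP] .
  \<comment> \<open>\<open>N\<close> normalizes \<open>V\<close>, so it preserves quadratic action.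
    A conjugate of \<open>J\<close> inside \<open>P\<close> therefore has its generators among those
    of \<open>J\<close>, and the orders agree.\<close>
  have move: "cj n ` J = J" if "n \<in> N" "cj n ` J \<subseteq> P" for n
    unfolding J using that N(2) EJ by (intro quadratic_generate_cj[OF sV sP]) auto
  \<comment> \<open>\<open>J\<close> and \<open>cj h\<close> applied to \<open>J\<close> both lie in
    \<open>H\<close>, the conjugate of \<open>D\<close>, and the second is normal in
    \<open>H\<close>. So a Sylow subgroup \<open>P1\<close> of \<open>H\<close> that contains
    \<open>J\<close> contains both. Moving \<open>P1\<close> into \<open>P\<close> by an element of
    \<open>N\<close> turns each of them into \<open>J\<close> by \<open>move\<close>, so they
    coincide.\<close>
  have weak: "h \<in> D" if h: "h \<in> N" "J \<subseteq> cj h ` D" for h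
  proof -
    have hc: "h \<in> carrier G" using h by simp
    define H where "H = cj h ` D"
    have sH: "subgroup H G" unfolding H_def by (rule subgroup_cj[OF sD hc])
    have HN: "H \<subseteq> N" unfolding H_def using cj_image_self[OF N(1) h(1)] by (auto simp: D_def)
    have hJH: "cj h ` J \<subseteq> H" unfolding H_def using JD by blast
    have "H \<subseteq> normalizer G (cj h ` J)"
    proof
      fix y assume "y \<in> H"
      then obtain d where d: "d \<in> D" "y = cj h d" unfolding H_def by blast
      have dJ: "cj d ` J = J" using d(1) normalizer_iff[OF Jc] by (simp add: D_def)
      have "cj y ` cj h ` J = cj h ` cj d ` J"
      proof -
        have "y \<otimes> h = h \<otimes> d" using d hc by (simp add: conj_by_def m_assoc)
        then show ?thesis using d hc Jc by (simp flip: cj_image_m)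
      qed
      then show "y \<in> normalizer G (cj h ` J)"
        using dJ d hc normalizer_iff[OF cj_image_subset[OF hc Jc]] by simp
    qed
    moreover obtain P1 where P1: "syl H P1" "J \<subseteq> P1"
      using syl_contains[OF sH psubJ] h(2) unfolding H_def by blast
    ultimately have hJ: "cj h ` J \<subseteq> P1"
      by (intro normal_psub_subset_syl[OF sH psub_cj[OF psubJ hc] hJH])
    have "P1 \<subseteq> N" using syl_subset[OF P1(1)] HN by blast
    then obtain n where n: "n \<in> N" "P1 \<subseteq> cj n ` P" using syl_conj[OF N(1) P syl_psub[OF P1(1)]] by blast
    have nc: "n \<in> carrier G" using n(1) by simp
    have Pc: "P \<subseteq> carrier G" using subgroup.subset[OF sP] .
    have "cj (inv n) ` J \<subseteq> P"
      using cj_image_subset_iff[of "inv n" J P] nc Jc Pc P1(2) n(2) by auto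
    then have 1: "cj (inv n) ` J = J" using move[of "inv n"] n(1) by simp
    have "cj (inv n) ` cj h ` J \<subseteq> P"
      using cj_image_subset_iff[of "inv n" "cj h ` J" P] nc cj_image_subset[OF hc Jc] Pc hJ n(2) by auto
    then have "cj (inv n \<otimes> h) ` J = J" using move[of "inv n \<otimes> h"] n(1) h(1) nc hc Jc by (simp add: cj_image_m)
    then have "cj (inv n) ` cj h ` J = cj (inv n) ` J" using 1 nc hc Jc by (simp add: cj_image_m)
    then have "cj n ` cj (inv n) ` cj h ` J = cj n ` cj (inv n) ` J" by simp
    then have "cj h ` J = J" using cj_image_cancel(2)[OF nc] cj_image_subset[OF hc Jc] Jc by simp
    then show ?thesis using h(1) hc normalizer_iff[OF Jc] by (simp add: D_def)
  qed
  show "cj g x = x" if "g \<in> N"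
  proof (rule conjugation_control[OF \<open>odd p\<close> V(2) _ N psubJ J EJ _ sD JD _ _ x(1) _ that])
    show "u \<otimes> v = v \<otimes> u" if "u \<in> V" "v \<in> V" for u v using abelian_subD[OF V(1) that] .
    show "cj a (cj a v \<otimes> inv v) = cj a v \<otimes> inv v" if "a \<in> P \<inter> quadratic V" "v \<in> V" for a v
      using that by (simp add: quadratic_def)
  qed (use weak x(2) in \<open>auto simp: D_def\<close>)
qed

end

section \<open>The maximality argument for one central element\<close>

locale thompson_central = finite_group_prime +
  fixes S :: "'a set" and x :: 'a
  assumes odd_p: "odd p" and S: "syl (carrier G) S" and x: "x \<in> subgroup_center G S"
    and normalizer_fixes: "\<And>h. h \<in> normalizer G (thompson S) \<Longrightarrow> cj h x = x"
begin

text \<open>\<open>y\<close> plays the same role for the Sylow subgroup \<open>R\<close> as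
  \<open>x\<close> does for \<open>S\<close>. Since \<open>normalizer G S\<close> lies in
  \<open>normalizer G (thompson S)\<close> and so fixes \<open>x\<close>, the element
  \<open>y\<close> is determined by \<open>R\<close>; see \<open>pair_unique\<close>.\<close>

definition pair :: "'a set \<Rightarrow> 'a \<Rightarrow> bool" where
  "pair R y \<longleftrightarrow> (\<exists>g\<in>carrier G. R = cj g ` S \<and> y = cj g x)"

lemma S_sub: "subgroup S G" "S \<subseteq> carrier G"
  using syl_subgroup[OF S] subgroup.subset by blast+

lemma x_carrier: "x \<in> S" "x \<in> carrier G"
  using subgroup_center_subset x S_sub by blast+

lemma pair_base: "pair S x"
  unfolding pair_def by (intro bexI[of _ \<one>]) (use x_carrier S_sub in \<open>auto simp: cj_image_one\<close>)

lemma pair_cj: "\<lbrakk>pair R y; h \<in> carrier G\<rbrakk> \<Longrightarrow> pair (cj h ` R) (cj h y)"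
proof -
  assume "pair R y" "h \<in> carrier G"
  then obtain g where "g \<in> carrier G" "R = cj g ` S" "y = cj g x" by (auto simp: pair_def)
  with \<open>h \<in> carrier G\<close> show ?thesis
    unfolding pair_def using x_carrier S_sub by (intro bexI[of _ "h \<otimes> g"]) (auto simp: cj_m cj_image_m)
qed

lemma pair_syl: "pair R y \<Longrightarrow> syl (carrier G) R"
  using syl_cj[OF S subgroup_self] by (auto simp: pair_def)

lemma pair_subset: "pair R y \<Longrightarrow> R \<subseteq> carrier G"
  using syl_subset[OF pair_syl] .

lemma pair_mem: "pair R y \<Longrightarrow> y \<in> R"
  using x_carrier by (auto simp: pair_def)

lemma pair_mem_carrier: "pair R y \<Longrightarrow> y \<in> carrier G"
  using pair_mem pair_subset by blast

lemma pair_central: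
  assumes "pair R y" "r \<in> R"
  shows "cj r y = y"
proof -
  obtain g where g: "g \<in> carrier G" "R = cj g ` S" "y = cj g x" using assms by (auto simp: pair_def)
  then obtain s where s: "s \<in> S" "r = cj g s" using assms by blast
  have sc: "s \<in> carrier G" using s S_sub by blast
  have "cj s x = x" using x s(1) by (auto simp: subgroup_center_alt[OF S_sub(2)])
  moreover have "r \<otimes> g = g \<otimes> s" using g s sc by (simp add: conj_by_def m_assoc)
  then have "cj r y = cj g (cj s x)" using g s(2) sc x_carrier by (simp flip: cj_m)
  ultimately show ?thesis using g by simp
qed

lemma pair_normalizer:
  assumes "pair R y" "h \<in> normalizer G (thompson R)"
  shows "cj h y = y"
proof -
  obtain g where g: "g \<in> carrier G" "R = cj g ` S" "y = cj g x" using assms by (auto simp: pair_def)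
  have tS: "thompson S \<subseteq> carrier G" using thompson_subgroup(1)[OF S_sub(1)] subgroup.subset by blast
  have tR: "thompson R = cj g ` thompson S" using thompson_cj[OF S_sub(1) g(1)] g(2) by simp
  have h: "h \<in> carrier G" "cj h ` cj g ` thompson S = cj g ` thompson S"
    using assms(2) normalizer_iff[of "thompson R" h] cj_image_subset[OF g(1) tS] unfolding tR by auto
  define k where "k = inv g \<otimes> (h \<otimes> g)"
  have k: "k \<in> carrier G" "h \<otimes> g = g \<otimes> k" using g h by (auto simp: k_def)
  have "cj k ` thompson S = cj (inv g) ` cj h ` cj g ` thompson S"
    unfolding k_def using g(1) h(1) tS by (simp add: cj_image_m cj_image_subset)
  also have "\<dots> = thompson S" using h(2) cj_image_cancel(1)[OF g(1) tS] by simp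
  finally have "cj k x = x" using normalizer_fixes[of k] normalizer_iff[OF tS] k(1) by simp
  then show ?thesis using g h k x_carrier by (simp flip: cj_m) (simp add: cj_m)
qed

lemma pair_unique:
  assumes "pair R y" "pair R z"
  shows "y = z"
proof -
  obtain g where g: "g \<in> carrier G" "R = cj g ` S" "y = cj g x" using assms by (auto simp: pair_def)
  obtain h where h: "h \<in> carrier G" "R = cj h ` S" "z = cj h x" using assms by (auto simp: pair_def)
  have "cj (h \<otimes> inv g) ` R = cj h ` cj (inv g) ` cj g ` S"
    using g h(1) S_sub by (simp add: cj_image_m cj_image_subset)
  also have "\<dots> = R" using h(2) cj_image_cancel(1)[OF g(1) S_sub(2)] by simp
  finally have "h \<otimes> inv g \<in> normalizer G R"
    using normalizer_iff[OF pair_subset[OF assms(1)]] g h by simp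
  then have "cj (h \<otimes> inv g) y = y"
    using pair_normalizer[OF assms(1)] normalizer_thompson[OF syl_subgroup[OF pair_syl[OF assms(1)]]] by blast
  moreover have "cj (h \<otimes> inv g) y = z" using g h x_carrier by (simp add: cj_m)
  ultimately show ?thesis by simp
qed

lemma pair_exists:
  assumes "syl (carrier G) R"
  shows "\<exists>y. pair R y"
  using syl_conj_eq[OF subgroup_self S assms] unfolding pair_def by blast

text \<open>The records of the maximality argument: \<open>N(T)\<close> moves the element \<open>z\<close> that corresponds to the
  Sylow subgroup \<open>R\<close>, and \<open>P\<close> is a Sylow subgroup of \<open>N(T)\<close> inside \<open>R\<close>.\<close>

definition moved :: "'a set \<Rightarrow> 'a set \<Rightarrow> 'a set \<Rightarrow> 'a \<Rightarrow> bool" where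
  "moved T P R z \<longleftrightarrow> subgroup T G \<and> T \<subseteq> P \<and> z \<in> T \<and> syl (normalizer G T) P \<and> P \<subseteq> R \<and> pair R z
    \<and> (\<exists>n\<in>normalizer G T. cj n z \<noteq> z)"

text \<open>The number \<open>t\<close> will be the largest intersection of two Sylow subgroups that
  exhibit a failure. Beyond this size, the element of one Sylow subgroup that lies in the other must
  be the element of the other.\<close>

definition agree_above :: "nat \<Rightarrow> bool" where
  "agree_above t \<longleftrightarrow> (\<forall>R y Q z. pair R y \<longrightarrow> pair Q z \<longrightarrow> y \<in> Q \<longrightarrow> t < card (R \<inter> Q) \<longrightarrow> y = z)"

lemma card_Int_grows:
  assumes R: "psub R" and T: "subgroup T G" "T \<subset> R"
  shows "subgroup (R \<inter> normalizer G T) G" "T \<subseteq> R \<inter> normalizer G T"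
    "card T < card (R \<inter> normalizer G T)"
proof -
  have Tc: "T \<subseteq> carrier G" using subgroup.subset[OF T(1)] .
  show sub: "subgroup (R \<inter> normalizer G T) G"
    by (rule subgroups_Inter_pair[OF psub_subgroup[OF R] normalizer_subgroup[OF Tc]])
  show le: "T \<subseteq> R \<inter> normalizer G T" using T(2) subgroup_subset_normalizer[OF T(1)] by blast
  obtain g where g: "g \<in> R" "g \<notin> T" "cj g ` T = T" using normalizer_grows[OF R T] by blast
  have "g \<in> carrier G" using subsetD[OF subgroup.subset[OF psub_subgroup[OF R]] g(1)] .
  then have "g \<in> R \<inter> normalizer G T" using g normalizer_iff[OF Tc] by simp
  with le g(2) have "T \<subset> R \<inter> normalizer G T" by blast
  then show "card T < card (R \<inter> normalizer G T)" using finite_subgroup[OF sub] psubset_card_mono by blast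
qed

text \<open>Take a disagreeing couple with the largest intersection. After an adjustment inside the
  centralizer of \<open>y\<close>, the intersection \<open>T\<close> contains both \<open>y\<close>
  and \<open>z\<close>. It grows in its normalizer on the side of \<open>R\<close> and on the side
  of \<open>Q\<close>, and maximality of the intersection then links both sides to one Sylow
  subgroup of the normalizer, up to an element \<open>n\<close> that must carry \<open>z\<close> to
  \<open>y\<close>.\<close>

lemma moved_exists:
  assumes bad: "pair R0 y0" "pair Q0 z0" "y0 \<in> Q0" "y0 \<noteq> z0"
  obtains t T P R z where "moved T P R z" "t < card P" "agree_above t"
proof -
  let ?B = "\<lambda>(R, y, Q, z). pair R y \<and> pair Q z \<and> y \<in> Q \<and> y \<noteq> z"
  let ?m = "\<lambda>(R, y, Q, z :: 'a). card (R \<inter> Q)"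
  have "card (R \<inter> Q) \<le> card (carrier G)" if "pair R y" for R y Q
    using pair_subset[OF that] by (intro card_mono fin) blast
  then have bound: "\<forall>b. ?B b \<longrightarrow> ?m b < Suc (card (carrier G))"
    by (auto simp: less_Suc_eq_le)
  have "?B (R0, y0, Q0, z0)" using bad by simp
  from ex_has_greatest_nat[of ?B, OF this bound] obtain b
    where b: "?B b" "\<forall>b'. ?B b' \<longrightarrow> ?m b' \<le> ?m b" by (elim exE conjE)
  obtain R1 y Q z where "b = (R1, y, Q, z)" by (cases b)
  with b(1) have R1: "pair R1 y" and Q: "pair Q z" and y: "y \<in> Q" "y \<noteq> z" by simp_all
  have max: "card (R' \<inter> Q') \<le> card (R1 \<inter> Q)"
    if "pair R' y'" "pair Q' z'" "y' \<in> Q'" "y' \<noteq> z'" for R' y' Q' z'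
    using b(2)[rule_format, of "(R', y', Q', z')"] that \<open>b = _\<close> by simp
  define t where "t = card (R1 \<inter> Q)"
  have eq: "y' = z'" if "pair R' y'" "pair Q' z'" "y' \<in> Q'" "t < card (R' \<inter> Q')" for R' y' Q' z'
    using max[OF that(1-3)] that(4) unfolding t_def by (metis not_less)
  note sylR1 = pair_syl[OF R1] and sylQ = pair_syl[OF Q]
  have yc: "y \<in> carrier G" using pair_mem_carrier[OF R1] .
  \<comment> \<open>\<open>R1\<close> is a Sylow subgroup of the centralizer \<open>H\<close> of
    \<open>y\<close>, so a conjugate \<open>R\<close> of it under \<open>H\<close> contains
    \<open>C\<close>, the centralizer of \<open>y\<close> in \<open>Q\<close>. Its partner is still
    \<open>y\<close>, and the intersection with \<open>Q\<close> cannot have shrunk.\<close>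
  define H where "H = {g \<in> carrier G. \<forall>w\<in>{y}. cj g w = w}"
  define C where "C = {g \<in> Q. \<forall>w\<in>{y}. cj g w = w}"
  have sH: "subgroup H G" unfolding H_def by (rule subgroup_fixed_points[OF subgroup_self]) (use yc in simp)
  have sC: "subgroup C G" unfolding C_def by (rule subgroup_fixed_points[OF syl_subgroup[OF sylQ]]) (use yc in simp)
  have psubC: "psub C" using psub_mono[OF syl_psub[OF sylQ] sC] by (auto simp: C_def)
  have CH: "C \<subseteq> H" using pair_subset[OF Q] by (auto simp: C_def H_def)
  have R1H: "R1 \<subseteq> H" using pair_subset[OF R1] pair_central[OF R1] by (auto simp: H_def)
  have "syl H R1" by (rule syl_mono[OF subgroup_self sH subgroup.subset[OF sH] sylR1 R1H])
  then obtain c where c: "c \<in> H" "C \<subseteq> cj c ` R1" using syl_conj[OF sH _ psubC CH] by blast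
  have cc: "c \<in> carrier G" "cj c y = y" using c(1) by (auto simp: H_def)
  define R where "R = cj c ` R1"
  have R: "pair R y" using pair_cj[OF R1 cc(1)] cc(2) by (simp add: R_def)
  have CR: "C \<subseteq> R" using c(2) by (simp add: R_def)
  note sylR = pair_syl[OF R]
  have "R1 \<inter> Q \<subseteq> C" using pair_central[OF R1] by (auto simp: C_def)
  then have "R1 \<inter> Q \<subseteq> R \<inter> Q" using CR by blast
  then have "t \<le> card (R \<inter> Q)"
    unfolding t_def using finite_subgroup[OF syl_subgroup[OF sylR]] by (intro card_mono) auto
  moreover have "card (R \<inter> Q) \<le> t" using max[OF R Q y] by (simp add: t_def)
  ultimately have t: "card (R \<inter> Q) = t" by simp
  define T where "T = R \<inter> Q"
  have sT: "subgroup T G" unfolding T_def by (rule subgroups_Inter_pair[OF syl_subgroup[OF sylR] syl_subgroup[OF sylQ]])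
  \<comment> \<open>This puts \<open>z\<close> into \<open>C\<close> and so into \<open>R\<close>,
    which the original \<open>R1\<close> need not satisfy.\<close>
  have "cj z y = y"
    using pair_central[OF Q y(1)] cj_fix_iff[of y z] cj_fix_iff[of z y] yc pair_mem_carrier[OF Q] by metis
  then have "z \<in> C" using pair_mem[OF Q] by (simp add: C_def)
  then have zT: "z \<in> T" using CR pair_mem[OF Q] by (auto simp: T_def)
  have yT: "y \<in> T" using y(1) pair_mem[OF R] by (simp add: T_def)
  have neq: "R \<noteq> Q" using pair_unique[OF R] Q y(2) by blast
  have same_card: "card R = card Q" using sylR sylQ by (simp add: syl_def)
  have "T \<noteq> Q" 
    using neq same_card card_subset_eq[of R Q] finite_subgroup[OF syl_subgroup[OF sylR]] by (auto simp: T_def)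
  then have TQ: "T \<subset> Q" by (auto simp: T_def)
  have "T \<noteq> R"
    using neq same_card card_subset_eq[of Q R] finite_subgroup[OF syl_subgroup[OF sylQ]] by (auto simp: T_def)
  then have TR: "T \<subset> R" by (auto simp: T_def)
  have Tc: "T \<subseteq> carrier G" using subgroup.subset[OF sT] .
  define N where "N = normalizer G T"
  have sN: "subgroup N G" unfolding N_def by (rule normalizer_subgroup[OF Tc])
  note growQ = card_Int_grows[OF syl_psub[OF sylQ] sT TQ, folded N_def]
  note growR = card_Int_grows[OF syl_psub[OF sylR] sT TR, folded N_def]
  have cardT: "card T = t" using t by (simp add: T_def)
  obtain P where P: "syl N P" "Q \<inter> N \<subseteq> P"
    using syl_contains[OF sN psub_mono[OF syl_psub[OF sylQ] growQ(1)]] by blast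
  obtain n where n: "n \<in> N" "R \<inter> N \<subseteq> cj n ` P"
    using syl_conj[OF sN P(1) psub_mono[OF syl_psub[OF sylR] growR(1)]] by blast
  have nc: "n \<in> carrier G" using subsetD[OF subgroup.subset[OF sN] n(1)] .
  have Pc: "P \<subseteq> carrier G" using subgroup.subset[OF syl_subgroup[OF P(1)]] .
  obtain S1 where S1: "syl (carrier G) S1" "P \<subseteq> S1"
    using syl_contains[OF subgroup_self syl_psub[OF P(1)] Pc] by blast
  obtain z1 where z1: "pair S1 z1" using pair_exists[OF S1(1)] by blast
  have finS1: "finite S1" using finite_subgroup[OF syl_subgroup[OF S1(1)]] .
  have "card (Q \<inter> N) \<le> card (Q \<inter> S1)"
    using P(2) S1(2) finS1 by (intro card_mono) auto
  \<comment> \<open>\<open>Q\<close> and \<open>S1\<close> share \<open>Q \<inter> N\<close>, which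
    has more than \<open>t\<close> elements because normalizers grow, and \<open>S1\<close> contains
    \<open>z\<close>.\<close>
  then have "z = z1"
    using eq[OF Q z1] zT growQ(2,3) P(2) S1(2) cardT by force
  then have pS1: "pair S1 z" using z1 by simp
  have "card (R \<inter> N) \<le> card (R \<inter> cj n ` S1)"
    using n(2) S1(2) finS1 by (intro card_mono) auto
  moreover have "y \<in> cj n ` S1" using yT growR(2) n(2) S1(2) by blast
  \<comment> \<open>The same argument for \<open>R\<close> and the conjugate of \<open>S1\<close> by
    \<open>n\<close>, which share \<open>R \<inter> N\<close> and contain \<open>y\<close>.\<close>
  ultimately have "y = cj n z"
    using eq[OF R pair_cj[OF pS1 nc]] growR(3) cardT by simp
  with y(2) n(1) have mv: "\<exists>n\<in>normalizer G T. cj n z \<noteq> z" unfolding N_def by metis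
  have "card (Q \<inter> N) \<le> card P" using P(2) finite_subgroup[OF syl_subgroup[OF P(1)]] card_mono by blast
  then have "t < card P" using growQ(3) cardT by simp
  moreover have "moved T P S1 z"
    unfolding moved_def using sT growQ(2) P zT S1(2) pS1 mv by (auto simp: N_def)
  moreover have "agree_above t" unfolding agree_above_def using eq by blast
  ultimately show thesis using that by blast
qed

text \<open>Enlarge \<open>P\<close> to a Sylow subgroup \<open>P'\<close> of the normalizer of
  \<open>B\<close>, and that to a Sylow subgroup \<open>R'\<close> of \<open>G\<close>. Since
  \<open>R\<close> and \<open>R'\<close> share \<open>P\<close>, which has more than
  \<open>t\<close> elements, agreement keeps the same element \<open>z\<close> attached to
  \<open>R'\<close>. This is how new records are made without losing control of
  \<open>z\<close>.\<close>

lemma moved_extend: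
  assumes agree: "agree_above t"
    and P: "psub P" "t < card P" "P \<subseteq> R" and R: "pair R z"
    and B: "subgroup B G" "B \<subseteq> P" "z \<in> B" "P \<subseteq> normalizer G B" "n \<in> normalizer G B" "cj n z \<noteq> z"
  obtains P' R' where "moved B P' R' z" "P \<subseteq> P'"
proof -
  have Bc: "B \<subseteq> carrier G" using subgroup.subset[OF B(1)] .
  obtain P' where P': "syl (normalizer G B) P'" "P \<subseteq> P'"
    using syl_contains[OF normalizer_subgroup[OF Bc] P(1) B(4)] by blast
  obtain R' where R': "syl (carrier G) R'" "P' \<subseteq> R'"
    using syl_contains[OF subgroup_self syl_psub[OF P'(1)] subgroup.subset[OF syl_subgroup[OF P'(1)]]] by blast
  obtain z' where z': "pair R' z'" using pair_exists[OF R'(1)] by blast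
  have "card P \<le> card (R \<inter> R')"
    using P(3) P'(2) R'(2) finite_subgroup[OF syl_subgroup[OF R'(1)]] by (intro card_mono) auto
  moreover have "z \<in> R'" using B P'(2) R'(2) by blast
  ultimately have "z = z'" using agree R z' P(2) unfolding agree_above_def by (meson less_le_trans)
  then have "moved B P' R' z" unfolding moved_def using B P' R'(2) z' by blast
  with that P'(2) show thesis by blast
qed

text \<open>Choose a record with \<open>card P\<close> as large as possible and, subject to that,
  with \<open>card T\<close> as large as possible. The second condition prevents replacing
  \<open>T\<close> by the larger subgroup generated by quadratic elements; the first is contradicted
  when \<open>T\<close> is replaced by \<open>thompson P\<close>.\<close>

theorem central_weakly_closed:
  assumes g: "g \<in> carrier G" "cj g x \<in> S"
  shows "cj g x = x"
proof (rule ccontr)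
  assume "cj g x \<noteq> x"
  with g moved_exists[OF pair_cj[OF pair_base g(1)] pair_base] obtain t T0 P0 R0 z0
    where "moved T0 P0 R0 z0" "t < card P0" and agree: "agree_above t" by metis
  let ?M = "\<lambda>(T, P, R, z). moved T P R z"
  \<comment> \<open>This encodes the lexicographic order in a single number: \<open>card T\<close>
    is at most the order of the group, hence less than the factor of \<open>card P\<close>.\<close>
  let ?k = "\<lambda>(T :: 'a set, P :: 'a set, R :: 'a set, z :: 'a). card P * Suc (card (carrier G)) + card T"
  have bound: "card P \<le> card (carrier G) \<and> card T \<le> card (carrier G)" if "moved T P R z" for T P R z
  proof -
    have "P \<subseteq> carrier G" "T \<subseteq> carrier G"
      using that subgroup.subset syl_subgroup unfolding moved_def by blast+
    then show ?thesis using fin card_mono by blast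
  qed
  have "\<forall>b. ?M b \<longrightarrow> ?k b < Suc (card (carrier G) * Suc (card (carrier G)) + card (carrier G))"
    using bound by (auto simp: less_Suc_eq_le intro!: add_mono mult_le_mono)
  moreover have "?M (T0, P0, R0, z0)" using \<open>moved T0 P0 R0 z0\<close> by simp
  ultimately obtain b where b: "?M b" "\<forall>b'. ?M b' \<longrightarrow> ?k b' \<le> ?k b"
    using ex_has_greatest_nat[of ?M _ ?k] by blast
  obtain T P R z where b_eq: "b = (T, P, R, z)" by (cases b)
  have M: "moved T P R z" using b(1) b_eq by simp
  have max: "card P' < card P \<or> card P' = card P \<and> card T' \<le> card T" if "moved T' P' R' z'" for T' P' R' z'
  proof -
    have le: "card P' * Suc (card (carrier G)) + card T' \<le> card P * Suc (card (carrier G)) + card T"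
      using b(2)[rule_format, of "(T', P', R', z')"] that b_eq by simp
    have "\<not> card P < card P'"
    proof
      assume "card P < card P'"
      then have "Suc (card P) * Suc (card (carrier G)) \<le> card P' * Suc (card (carrier G))"
        by (intro mult_le_mono1) simp
      then show False using le bound[OF M] by simp
    qed
    then show ?thesis using le by (cases "card P' = card P") auto
  qed
  have "t < card P" using max[OF \<open>moved T0 P0 R0 z0\<close>] \<open>t < card P0\<close> by auto
  define N where "N = normalizer G T"
  have T: "subgroup T G" "T \<subseteq> P" "z \<in> T" and P: "syl N P" "P \<subseteq> R" and R: "pair R z"
    and mv: "\<exists>n\<in>N. cj n z \<noteq> z"
    using M by (auto simp: moved_def N_def)
  note Tc = subgroup.subset[OF T(1)] and sP = syl_subgroup[OF P(1)] and psubP = syl_psub[OF P(1)]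
  have finP: "finite P" using finite_subgroup[OF sP] .
  have sN: "subgroup N G" unfolding N_def by (rule normalizer_subgroup[OF Tc])
  have PN: "P \<subseteq> N" using syl_subset[OF P(1)] .
  note extend = moved_extend[OF agree psubP \<open>t < card P\<close> P(2) R]
  define V where "V = subgroup_center G T"
  have sV: "subgroup V G" unfolding V_def by (rule subgroup_subgroup_center[OF T(1)])
  have VT: "V \<subseteq> T" unfolding V_def by (rule subgroup_center_subset)
  have abV: "abelian_sub V"
    unfolding abelian_sub_def using sV VT subgroup_center_comm[of _ T] by (auto simp: V_def)
  have psubV: "psub V" using psub_mono[OF psubP sV] VT T(2) by blast
  have NV: "N \<subseteq> normalizer G V" unfolding N_def V_def by (rule normalizer_subgroup_center[OF T(1)])
  have zV: "z \<in> V"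
    unfolding V_def subgroup_center_alt[OF Tc] using T P(2) pair_central[OF R] by blast
  define J where "J = generate G (P \<inter> quadratic V)"
  have E: "P \<inter> quadratic V \<subseteq> carrier G" by (auto simp: quadratic_def)
  have sJ: "subgroup J G" unfolding J_def by (rule generate_is_subgroup[OF E])
  have JP: "J \<subseteq> P" unfolding J_def by (rule generate_subgroup_incl[OF _ sP]) simp
  have T_quad: "T \<subseteq> quadratic V"
  proof
    fix a assume a: "a \<in> T"
    have ac: "a \<in> carrier G" using a Tc by blast
    have "cj a v \<otimes> inv v = \<one>" if "v \<in> V" for v
    proof -
      have "v \<in> carrier G" using that VT Tc by blast
      moreover have "cj a v = v" using that a by (auto simp: V_def subgroup_center_alt[OF Tc])
      ultimately show ?thesis by simp
    qed
    then show "a \<in> quadratic V" using ac by (simp add: quadratic_def)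
  qed
  have TJ: "T \<subseteq> J" using T(2) T_quad unfolding J_def by (blast intro: generate.incl)
  have PJ: "P \<subseteq> normalizer G J"
  proof
    fix h assume h: "h \<in> P"
    have "cj h ` (P \<inter> quadratic V) \<subseteq> P" using cj_image_self[OF sP h] by blast
    then have "cj h ` J = J"
      unfolding J_def using h PN NV by (intro quadratic_generate_cj[OF sV sP]) auto
    then show "h \<in> normalizer G J"
      using normalizer_iff[OF subgroup.subset[OF sJ]] h subgroup.subset[OF sP] by blast
  qed
  \<comment> \<open>The contrapositive of \<open>quadratic_generate_control\<close>: as
    \<open>N\<close> moves \<open>z\<close>, so does the normalizer of \<open>J\<close> in
    \<open>N\<close>. Hence \<open>J\<close> gives a record as well, and maximality forces
    \<open>J = T\<close>.\<close>
  have "\<exists>n\<in>N \<inter> normalizer G J. cj n z \<noteq> z"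
    using quadratic_generate_control[OF odd_p abV psubV sN NV P(1) J_def zV] mv by blast
  then obtain n where n: "n \<in> normalizer G J" "cj n z \<noteq> z" by blast
  have "z \<in> J" using T(3) TJ by blast
  from extend[OF sJ JP this PJ n] obtain P' R' where P': "moved J P' R' z" "P \<subseteq> P'" .
  have "card P \<le> card P'"
    using P' finite_subgroup[OF syl_subgroup] card_mono unfolding moved_def by blast
  then have "card J \<le> card T" using max[OF P'(1)] by auto
  then have "J = T" using TJ card_seteq[of J T] finite_subgroup[OF sJ] by blast
  \<comment> \<open>A maximal abelian subgroup of \<open>P\<close> outside \<open>T\<close> would
    yield an element of \<open>P - T\<close> acting quadratically on \<open>V\<close>; but all
    quadratic elements of \<open>P\<close> lie in \<open>J = T\<close>.\<close>
  have in_T: "A \<subseteq> T" if A: "max_abelian P A" for A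
  proof (rule ccontr)
    assume notT: "\<not> A \<subseteq> T"
    have VP: "V \<subseteq> P" using VT T(2) by blast
    have comm: "a \<otimes> v = v \<otimes> a" if "a \<in> T" "v \<in> V" for a v
      using subgroup_center_comm[of v T a] that by (simp add: V_def)
    obtain a where a: "a \<in> P" "a \<notin> T" "\<forall>v\<in>V. cj a (cj a v \<otimes> inv v) = cj a v \<otimes> inv v"
      using quadratic_element_exists[OF psubP abV VP order_trans[OF PN NV] comm A notT] by blast
    have "a \<in> carrier G" using subsetD[OF subgroup.subset[OF sP] a(1)] .
    then have "a \<in> P \<inter> quadratic V" using a by (simp add: quadratic_def)
    then have "a \<in> J" unfolding J_def by (rule generate.incl)
    with a(2) \<open>J = T\<close> show False by simp
  qed
  \<comment> \<open>Being also \<open>thompson T\<close>, this subgroup is normalized by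
    \<open>N\<close> and contains \<open>z\<close>, so its normalizer moves \<open>z\<close> and it
    yields another record. By maximality \<open>P\<close> is then a Sylow subgroup of
    \<open>normalizer G B\<close>.\<close>
  define B where "B = thompson P"
  have B: "B = thompson T" unfolding B_def using thompson_eq[OF sP T(2) in_T] by simp
  have sB: "subgroup B G" and BP: "B \<subseteq> P" unfolding B_def using thompson_subgroup[OF sP] by auto
  have NB: "N \<subseteq> normalizer G B" unfolding N_def B by (rule normalizer_thompson[OF T(1)])
  have zB: "z \<in> B" using zV center_subset_thompson[OF T(1)] by (auto simp: B V_def)
  have PPB: "normalizer G P \<subseteq> normalizer G B" unfolding B_def by (rule normalizer_thompson[OF sP])
  have PB: "P \<subseteq> normalizer G B" using PN NB by blast
  obtain n where n: "n \<in> normalizer G B" "cj n z \<noteq> z" using mv NB by blast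
  from extend[OF sB BP zB PB n] obtain P' R' where P': "moved B P' R' z" "P \<subseteq> P'" .
  have sylP': "syl (normalizer G B) P'" using P' by (simp add: moved_def)
  have "card P' \<le> card P" using max[OF P'(1)] by auto
  then have "P' = P" using P'(2) finite_subgroup[OF syl_subgroup[OF sylP']] card_seteq by blast
  with sylP' have sylP: "syl (normalizer G B) P" by simp
  \<comment> \<open>Otherwise \<open>P\<close> grows in its normalizer inside \<open>R\<close>, and
    that normalizer also normalizes \<open>thompson P\<close>, in which no larger
    \<open>p\<close>-subgroup is left. Once \<open>P = R\<close>, the assumption on the normalizer
    of the Thompson subgroup contradicts that \<open>z\<close> is moved.\<close>
  have "P = R"
  proof (rule ccontr)
    assume "P \<noteq> R"
    then have PR: "P \<subset> R" using P(2) by blast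
    note grow = card_Int_grows[OF syl_psub[OF pair_syl[OF R]] sP PR]
    have "psub (R \<inter> normalizer G P)" using psub_mono[OF syl_psub[OF pair_syl[OF R]] grow(1)] by blast
    moreover have "R \<inter> normalizer G P \<subseteq> normalizer G B" using PPB by blast
    ultimately have "card (R \<inter> normalizer G P) \<le> card P"
      using syl_card_max[OF normalizer_subgroup[OF subgroup.subset[OF sB]] sylP] by blast
    with grow(3) show False by simp
  qed
  then have "cj n z = z" using pair_normalizer[OF R] n(1) by (simp add: B_def)
  with n(2) show False by simp
qed

end

theorem (in finite_group_prime) weakly_closed_direct_factor_odd:
  assumes "odd p" and S: "syl (carrier G) S"
  shows "\<exists>K. subgroup K G \<and> K \<subseteq> subgroup_center G S
           \<and> weakly_closed_elems G S <#> K = subgroup_center G S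
           \<and> weakly_closed_elems G S \<inter> K = {\<one>}"
proof (rule weakly_closed_direct_factor[OF S])
  note sS = syl_subgroup[OF S]
  show "subgroup (thompson S) G" "thompson S \<subseteq> S" using thompson_subgroup[OF sS] by auto
  show "S \<subseteq> normalizer G (thompson S)"
    using subgroup_subset_normalizer[OF sS] normalizer_thompson[OF sS] by blast
  show "subgroup_center G S \<subseteq> thompson S" by (rule center_subset_thompson[OF sS])
  fix x g assume "x \<in> subgroup_center G S" "\<forall>h\<in>normalizer G (thompson S). cj h x = x"
  then interpret thompson_central G p S x by unfold_locales (use assms in auto)
  show "cj g x = x" if "g \<in> carrier G" "cj g x \<in> S" using central_weakly_closed that .
qed

section \<open>Groups whose Sylow center lies in O_{p',p}\<close>

lemma (in group) card_set_mult_normal: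
  assumes fin: "finite (carrier G)" and M: "subgroup M G" and N: "N \<lhd> G"
  shows "subgroup (M <#> N) G" "card (M <#> N) * card (M \<inter> N) = card M * card N"
proof -
  interpret M: subgroup M G by fact
  interpret N: normal N G by fact
  note sN = N.subgroup_axioms
  show H: "subgroup (M <#> N) G"
  proof -
    interpret second_isomorphism_grp N G M
      by (simp add: second_isomorphism_grp_def second_isomorphism_grp_axioms_def N M)
    show ?thesis using normal_set_mult_subgroup commut_normal[OF M N] by simp
  qed
  interpret H: subgroup "M <#> N" G by (rule H)
  have I: "subgroup (M \<inter> N) G" by (rule subgroups_Inter_pair[OF M sN])
  have finM: "finite M" and finH: "finite (M <#> N)" using fin finite_subset M.subset H.subset by blast+
  have NH: "N \<subseteq> M <#> N" by (rule subset_set_mult(2)[OF M sN])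
  have image: "(\<lambda>h. h <# N) ` (M <#> N) = (\<lambda>m. m <# N) ` M"
  proof (intro equalityI subsetI)
    fix C assume "C \<in> (\<lambda>h. h <# N) ` (M <#> N)"
    then obtain m n where mn: "m \<in> M" "n \<in> N" "C = (m \<otimes> n) <# N" unfolding set_mult_def by blast
    then have "C = m <# N" using lcoset_eq_iff[OF sN, of m "m \<otimes> n"] by simp
    with mn(1) show "C \<in> (\<lambda>m. m <# N) ` M" by blast
  next
    fix C assume "C \<in> (\<lambda>m. m <# N) ` M"
    then obtain m where m: "m \<in> M" "C = m <# N" by blast
    moreover have "m \<otimes> \<one> \<in> M <#> N" unfolding set_mult_def using m(1) N.one_closed by blast
    ultimately show "C \<in> (\<lambda>h. h <# N) ` (M <#> N)" by simp
  qed
  have "card ((\<lambda>m. m <# N) ` M) = card ((\<lambda>m. m <# (M \<inter> N)) ` M)"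
  proof -
    have eq: "m <# N = m' <# N \<longleftrightarrow> m <# (M \<inter> N) = m' <# (M \<inter> N)" if "m \<in> M" "m' \<in> M" for m m'
      using lcoset_eq_iff[OF sN, of m m'] lcoset_eq_iff[OF I, of m m'] that by simp
    have "bij_betw (\<lambda>C. C <#> N) ((\<lambda>m. m <# (M \<inter> N)) ` M) ((\<lambda>m. m <# N) ` M)"
    proof -
      have "(m <# (M \<inter> N)) <#> N = m <# N" if "m \<in> M" for m
      proof (intro equalityI subsetI)
        fix y assume "y \<in> (m <# (M \<inter> N)) <#> N"
        then obtain n n' where "n \<in> N" "n' \<in> N" "y = (m \<otimes> n) \<otimes> n'"
          unfolding set_mult_def l_coset_def by blast
        moreover from this have "y = m \<otimes> (n \<otimes> n')" using that by (simp add: m_assoc)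
        ultimately show "y \<in> m <# N" unfolding l_coset_def by blast
      next
        fix y assume "y \<in> m <# N"
        then obtain n where n: "n \<in> N" "y = m \<otimes> n" unfolding l_coset_def by blast
        then have "y = (m \<otimes> \<one>) \<otimes> n" using that by simp
        then show "y \<in> (m <# (M \<inter> N)) <#> N"
          unfolding set_mult_def l_coset_def using n(1) M.one_closed N.one_closed by blast
      qed
      then show ?thesis unfolding bij_betw_def inj_on_def using eq by (auto simp: image_image)
    qed
    then show ?thesis by (simp add: bij_betw_same_card)
  qed
  moreover have "card ((\<lambda>m. m <# (M \<inter> N)) ` M) * card (M \<inter> N) = card M"
    by (rule card_lcosets[OF M I _ finM]) blast
  moreover have "card ((\<lambda>m. m <# N) ` M) * card N = card (M <#> N)"
    using card_lcosets[OF H sN NH finH] image by simp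
  ultimately show "card (M <#> N) * card (M \<inter> N) = card M * card N"
    by (metis mult.assoc mult.commute)
qed

text \<open>\<open>largest_normal\<close> is a definite description, so a largest subgroup has to be
  exhibited. Closure under products turns an inclusion-maximal candidate into one that contains all
  others.\<close>

lemma (in group) largest_normal_properties:
  assumes fin: "finite (carrier G)" and one: "P {\<one>}"
    and mult: "\<And>M N. \<lbrakk>M \<lhd> G; N \<lhd> G; P M; P N\<rbrakk> \<Longrightarrow> P (M <#> N)"
  shows "largest_normal G P \<lhd> G" "P (largest_normal G P)"
    "\<And>M. \<lbrakk>M \<lhd> G; P M\<rbrakk> \<Longrightarrow> M \<subseteq> largest_normal G P"
proof -
  let ?S = "{N. N \<lhd> G \<and> P N}"
  have "finite ?S"
    by (rule finite_subset[of _ "Pow (carrier G)"]) (use fin in \<open>auto dest: normal_imp_subgroup subgroup.subset\<close>)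
  moreover have "?S \<noteq> {}" using one one_is_normal by blast
  ultimately obtain N where N: "N \<in> ?S" "\<And>M. \<lbrakk>M \<in> ?S; N \<subseteq> M\<rbrakk> \<Longrightarrow> N = M"
    using finite_has_maximal[of ?S] by metis
  have max: "M \<subseteq> N" if M: "M \<lhd> G" "P M" for M
  proof -
    have "N <#> M \<in> ?S" using N(1) M mult normal_subgroup_set_mult_closed by blast
    then have "N = N <#> M" using N(1) subset_set_mult(1)[of N M] N(2) M(1) normal_imp_subgroup by blast
    then show ?thesis using subset_set_mult(2)[of N M] N(1) M(1) normal_imp_subgroup by blast
  qed
  have "largest_normal G P = N"
    unfolding largest_normal_def by (rule the_equality) (use N(1) max in blast)+
  with N(1) max show "largest_normal G P \<lhd> G" "P (largest_normal G P)"
    "\<And>M. \<lbrakk>M \<lhd> G; P M\<rbrakk> \<Longrightarrow> M \<subseteq> largest_normal G P" by auto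
qed

section \<open>Power maps in class two and centralizers in solvable groups\<close>

lemma (in group) class_two_pow:
  assumes d: "d \<in> carrier G" and e: "e \<in> carrier G" and c: "c \<in> carrier G"
    and comm: "e \<otimes> d = d \<otimes> e \<otimes> c" "c \<otimes> d = d \<otimes> c" "c \<otimes> e = e \<otimes> c"
  shows "(d \<otimes> e) [^] (n::nat) = d [^] n \<otimes> e [^] n \<otimes> c [^] (\<Sum>{..<n})"
proof (induction n)
  case (Suc n)
  have cd: "c [^] m \<otimes> d = d \<otimes> c [^] m" and ce: "c [^] m \<otimes> e = e \<otimes> c [^] m" for m :: nat
    using group_commutes_pow comm c d e by auto
  \<comment> \<open>Moving \<open>d\<close> to the left past \<open>m\<close> factors
    \<open>e\<close> costs \<open>m\<close> copies of \<open>c\<close>. Summing over the steps of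
    the outer induction gives the triangular exponent.\<close>
  have ed: "e [^] m \<otimes> d = d \<otimes> e [^] m \<otimes> c [^] m" for m :: nat
  proof (induction m)
    case (Suc m)
    have "e [^] Suc m \<otimes> d = e [^] m \<otimes> d \<otimes> e \<otimes> c"
      using d e c comm(1) by (simp add: m_assoc)
    also have "\<dots> = d \<otimes> e [^] m \<otimes> (c [^] m \<otimes> e) \<otimes> c"
      unfolding Suc using d e c by (simp add: m_assoc)
    finally show ?case unfolding ce using d e c by (simp add: m_assoc)
  qed (use d in simp)
  have "(d \<otimes> e) [^] Suc n = d [^] n \<otimes> e [^] n \<otimes> (c [^] (\<Sum>{..<n}) \<otimes> d) \<otimes> e"
    using d e c by (simp add: Suc m_assoc)
  also have "\<dots> = d [^] n \<otimes> (e [^] n \<otimes> d) \<otimes> (c [^] (\<Sum>{..<n}) \<otimes> e)"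
    unfolding cd using d e c by (simp add: m_assoc)
  also have "\<dots> = d [^] Suc n \<otimes> e [^] n \<otimes> (c [^] n \<otimes> e) \<otimes> c [^] (\<Sum>{..<n})"
    unfolding ed ce[of "\<Sum>{..<n}"] using d e c by (simp add: m_assoc)
  also have "\<dots> = d [^] Suc n \<otimes> e [^] Suc n \<otimes> c [^] (\<Sum>{..<Suc n})"
    unfolding ce using d e c by (simp add: m_assoc lessThan_Suc nat_pow_mult)
  finally show ?case .
qed (use d e c in simp)

context finite_group_prime
begin

text \<open>A nontrivial element of a Sylow subgroup will do: having \<open>p\<close>-power order is
  all that the coprimality arguments below require, so \<open>t\<close> is not brought down to order
  \<open>p\<close>.\<close>

lemma prime_order_element:
  assumes "subgroup H G" "p dvd card H"
  obtains t k where "t \<in> H" "t \<noteq> \<one>" "t [^] (p ^ k) = \<one>"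
proof -
  obtain T where T: "syl H T" using syl_exists[OF assms(1)] by blast
  obtain k where k: "\<And>v. v \<in> T \<Longrightarrow> v [^] (p ^ k) = \<one>" by (rule p_group_exponent[OF syl_psub[OF T]]) blast
  have "0 < multiplicity p (card H)"
    using assms(2) card_subgroup_pos[OF assms(1)] p_gt_1 by (subst multiplicity_gt_zero_iff) auto
  then have "card T \<noteq> 1" using T p_gt_1 by (simp add: syl_def)
  then have "T \<noteq> {\<one>}" by auto
  then obtain t where "t \<in> T" "t \<noteq> \<one>" using subgroup.one_closed[OF syl_subgroup[OF T]] by blast
  with k syl_subset[OF T] that show thesis by blast
qed

lemma p'_subgroupI:
  assumes H: "subgroup H G" and "\<And>y. y \<in> H \<Longrightarrow> y [^] (m::nat) = \<one>" "\<not> p dvd m"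
  shows "\<not> p dvd card H"
proof
  assume "p dvd card H"
  then obtain t k where t: "t \<in> H" "t \<noteq> \<one>" "t [^] (p ^ k) = \<one>" by (rule prime_order_element[OF H])
  have "coprime (p ^ k) m" using prime_imp_coprime[OF prime_p assms(3)] by simp
  then show False
    using pow_coprime_eq_one[OF _ t(3) assms(2)] t subgroup.mem_carrier[OF H] by blast
qed

lemma psubI_exponent:
  assumes H: "subgroup H G" and exp: "\<And>y. y \<in> H \<Longrightarrow> y [^] (p ^ e) = \<one>"
  shows "psub H"
proof -
  have pos: "card H \<noteq> 0" using card_subgroup_pos[OF H] by simp
  obtain m where m: "card H = p ^ multiplicity p (card H) * m" "\<not> p dvd m"
    using multiplicity_decompose'[of "card H" p] pos p_gt_1 by auto
  have "m = 1"
  proof (rule ccontr)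
    assume "m \<noteq> 1"
    then obtain q where q: "Factorial_Ring.prime q" "q dvd m" using prime_factor_nat by blast
    \<comment> \<open>The locale is entered a second time, for another prime divisor
      \<open>q\<close>, to obtain an element of \<open>q\<close>-power order that the exponent
      \<open>p ^ e\<close> forbids.\<close>
    interpret Q: finite_group_prime G q by unfold_locales (use fin q in auto)
    have "q dvd card H" using q(2) m(1) by (metis dvd_mult)
    then obtain t k where t: "t \<in> H" "t \<noteq> \<one>" "t [^] (q ^ k) = \<one>" by (rule Q.prime_order_element[OF H])
    have "p \<noteq> q" using q(2) m(2) by blast
    then have "coprime (q ^ k) (p ^ e)" using primes_coprime[OF prime_p q(1)] by (simp add: coprime_commute)
    then show False
      using pow_coprime_eq_one[OF _ t(3) exp[OF t(1)]] t subgroup.mem_carrier[OF H] by blast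
  qed
  with m(1) H show ?thesis by (auto simp: psub_def)
qed

text \<open>If \<open>n\<close> is a large power of \<open>p\<close>, then \<open>d \<mapsto> d\<^sup>n\<close> is an endomorphism of \<open>D\<close>, because \<open>D\<close> has class at
  most two with commutators of \<open>p\<close>-power order. Its image is a normal \<open>p'\<close>-subgroup, hence trivial.\<close>

lemma normal_p'_triv_class_two:
  assumes D: "D \<lhd> G" and Q: "psub Q"
    and comm: "derived G D \<subseteq> Q" "\<And>d q. \<lbrakk>d \<in> D; q \<in> Q\<rbrakk> \<Longrightarrow> q \<otimes> d = d \<otimes> q"
    and triv: "\<And>M. \<lbrakk>M \<lhd> G; \<not> p dvd card M\<rbrakk> \<Longrightarrow> M = {\<one>}"
  shows "psub D"
proof -
  interpret D: normal D G by fact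
  interpret Q: subgroup Q G by (rule psub_subgroup) fact
  obtain e where e: "\<And>v. v \<in> Q \<Longrightarrow> v [^] (p ^ e) = \<one>" by (rule p_group_exponent[OF Q]) blast
  define a where "a = multiplicity p (order G)"
  \<comment> \<open>The part \<open>e\<close> of the exponent kills commutators, the
    \<open>1\<close> pays for the division by two in \<open>n (n - 1) / 2\<close> when
    \<open>p = 2\<close>, and \<open>a\<close> makes \<open>n * m\<close> a multiple of the group
    order.\<close>
  define n where "n = p ^ (e + 1 + a)"
  have on: "order G \<noteq> 0" using order_gt_0_iff_finite fin by (metis less_irrefl)
  obtain m where m: "order G = p ^ a * m" "\<not> p dvd m"
    unfolding a_def using multiplicity_decompose'[of "order G" p] on p_gt_1 by auto
  have n_sum: "p ^ e dvd \<Sum>{..<n}"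
  proof -
    have "2 * \<Sum>{..<n} = n * (n - 1)" by (induction n) (auto simp: lessThan_Suc algebra_simps)
    also have "\<dots> = p ^ e * (p * p ^ a * (n - 1))" by (simp add: n_def power_add)
    finally have 1: "2 * \<Sum>{..<n} = p ^ e * (p * p ^ a * (n - 1))" .
    have "even (p * p ^ a * (n - 1))" by (cases "even p") (auto simp: n_def)
    then obtain k where "p * p ^ a * (n - 1) = 2 * k" by blast
    with 1 have "\<Sum>{..<n} = p ^ e * k" by simp
    then show ?thesis by simp
  qed
  have pow_mult: "(d \<otimes> d') [^] n = d [^] n \<otimes> d' [^] n" if d: "d \<in> D" "d' \<in> D" for d d'
  proof -
    \<comment> \<open>The commutator of \<open>inv d'\<close> and \<open>inv d\<close>; the double
      inverses match the shape of the elements of \<open>derived_set\<close>.\<close>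
    define c where "c = inv d' \<otimes> inv d \<otimes> inv (inv d') \<otimes> inv (inv d)"
    have "c \<in> derived_set G D" unfolding c_def using d by blast
    then have cQ: "c \<in> Q" using comm(1) unfolding derived_def by (blast intro: generate.incl)
    then have cc: "c \<in> carrier G" by simp
    have "d' \<otimes> d = d \<otimes> d' \<otimes> c" using d by (simp add: c_def m_assoc)
    then have "(d \<otimes> d') [^] n = d [^] n \<otimes> d' [^] n \<otimes> c [^] (\<Sum>{..<n})"
      using class_two_pow[OF _ _ cc] comm(2)[OF _ cQ] d by simp
    moreover have "c [^] (\<Sum>{..<n}) = \<one>"
    proof -
      obtain k where k: "\<Sum>{..<n} = p ^ e * k" using n_sum by blast
      show ?thesis unfolding k using e[OF cQ] cc by (simp flip: nat_pow_pow)
    qed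
    ultimately show ?thesis using d by simp
  qed
  define E where "E = (\<lambda>d. d [^] n) ` D"
  have powD: "d [^] k \<in> D" if "d \<in> D" for d and k :: nat by (induction k) (auto simp: that D.one_closed)
  have "E \<lhd> G"
  proof (rule normal_invI)
    show "subgroup E G"
    proof (rule subgroupI)
      show "E \<noteq> {}" unfolding E_def using D.one_closed by blast
      fix y z assume "y \<in> E" "z \<in> E"
      then obtain d d' where d: "d \<in> D" "d' \<in> D" "y = d [^] n" "z = d' [^] n" unfolding E_def by blast
      then have "y \<otimes> z = (d \<otimes> d') [^] n" "inv y = (inv d) [^] n"
        using pow_mult by (simp_all add: nat_pow_inv)
      then show "y \<otimes> z \<in> E" "inv y \<in> E" unfolding E_def using d(1,2) by blast+
    qed (auto simp: E_def)
  next
    fix x h assume x: "x \<in> carrier G" "h \<in> E"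
    then obtain d where d: "d \<in> D" "h = d [^] n" unfolding E_def by blast
    have "cj x (d [^] k) = (cj x d) [^] k" for k :: nat
      by (induction k) (use x d in \<open>auto simp: cj_hom\<close>)
    moreover have "cj x d \<in> D" unfolding conj_by_def using D.inv_op_closed2 x d by blast
    ultimately have "cj x h \<in> E" unfolding E_def using d by blast
    then show "x \<otimes> h \<otimes> inv x \<in> E" by (simp add: conj_by_def)
  qed
  moreover have "\<not> p dvd card E"
  proof (rule p'_subgroupI[OF normal_imp_subgroup[OF \<open>E \<lhd> G\<close>] _ m(2)])
    fix y assume "y \<in> E"
    then obtain d where d: "d \<in> D" "y = d [^] n" unfolding E_def by blast
    have "n * m = order G * p ^ (e + 1)" by (simp add: n_def m(1) power_add)
    then have "y [^] m = (d [^] order G) [^] (p ^ (e + 1))"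
      using d by (simp add: nat_pow_pow)
    then show "y [^] m = \<one>" using d pow_order_eq_1[of d] by simp
  qed
  ultimately have "E = {\<one>}" by (rule triv)
  then have "d [^] n = \<one>" if "d \<in> D" for d using that unfolding E_def by blast
  then show ?thesis unfolding n_def by (rule psubI_exponent[OF D.subgroup_axioms])
qed

text \<open>The Hall-Higman lemma for groups without nontrivial normal \<open>p'\<close>-subgroups.
  If the centralizer \<open>C\<close> of \<open>Q\<close> were not inside \<open>Q\<close>, consider
  the last term \<open>D\<close> of its derived series that is not. The derived subgroup of
  \<open>D\<close> lies in \<open>Q\<close> and is central in \<open>D\<close>, so the class-two
  lemma makes \<open>D\<close> a normal \<open>p\<close>-subgroup, which \<open>Q\<close> must
  contain.\<close>

lemma solvable_centralizer_subset:
  assumes "solvable G" and triv: "\<And>M. \<lbrakk>M \<lhd> G; \<not> p dvd card M\<rbrakk> \<Longrightarrow> M = {\<one>}"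
    and Q: "Q \<lhd> G" "psub Q" "\<And>M. \<lbrakk>M \<lhd> G; psub M\<rbrakk> \<Longrightarrow> M \<subseteq> Q"
  shows "{g \<in> carrier G. \<forall>q\<in>Q. cj g q = q} \<subseteq> Q"
proof -
  interpret Q: normal Q G by fact
  define C where "C = {g \<in> carrier G. \<forall>q\<in>Q. cj g q = q}"
  have sC: "subgroup C G" unfolding C_def by (rule subgroup_fixed_points[OF subgroup_self Q.subset])
  have "C \<lhd> G"
  proof (rule normal_invI[OF sC])
    fix x h assume x: "x \<in> carrier G" "h \<in> C"
    have hc: "h \<in> carrier G" using x by (simp add: C_def)
    have "cj (cj x h) q = q" if "q \<in> Q" for q
    proof -
      have qc: "q \<in> carrier G" using that by simp
      have "cj (inv x) q \<in> Q" using Q.inv_op_closed1 x(1) that by (simp add: conj_by_def)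
      then have "cj h (cj (inv x) q) = cj (inv x) q" using x(2) by (simp add: C_def)
      moreover have "cj (cj x h) q = cj x (cj h (cj (inv x) q))"
        using x(1) hc qc by (simp add: conj_by_def inv_mult_group m_assoc)
      ultimately show ?thesis using x(1) qc by simp
    qed
    then show "x \<otimes> h \<otimes> inv x \<in> C" using x(1) hc by (simp add: C_def conj_by_def)
  qed
  let ?D = "\<lambda>n. (derived G ^^ n) C"
  have normal: "?D n \<lhd> G" for n by (induction n) (auto simp: \<open>C \<lhd> G\<close> derived_is_normal)
  have DC: "?D n \<subseteq> C" for n by (induction n) (auto intro: derived_incl[OF _ sC, THEN subsetD])
  have "C \<subseteq> Q"
  proof (rule ccontr)
    assume notQ: "\<not> C \<subseteq> Q"
    obtain n where "?D n = {\<one>}"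
      using solvable_imp_trivial_derived_seq[OF solvable_subgroup[OF sC assms(1)]] by blast
    then have ex: "?D n \<subseteq> Q" using Q.one_closed by simp
    define m where "m = (LEAST m. ?D m \<subseteq> Q)"
    have m: "?D m \<subseteq> Q" unfolding m_def by (rule LeastI[of "\<lambda>m. ?D m \<subseteq> Q", OF ex])
    have "m \<noteq> 0" using m notQ by (intro notI) simp
    then obtain i where i: "m = Suc i" by (cases m) auto
    have notD: "\<not> ?D i \<subseteq> Q" using not_less_Least[of i "\<lambda>m. ?D m \<subseteq> Q"] i by (simp add: m_def)
    have "psub (?D i)"
    proof (rule normal_p'_triv_class_two[OF normal Q(2) _ _ triv])
      show "derived G (?D i) \<subseteq> Q" using m i by simp
      fix d q assume "d \<in> ?D i" "q \<in> Q"
      then have "d \<in> C" "q \<in> Q" using DC by auto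
      then show "q \<otimes> d = d \<otimes> q" using cj_fix_iff[of d q] by (simp add: C_def)
    qed
    then show False using Q(3)[OF normal] notD by blast
  qed
  then show ?thesis by (simp add: C_def)
qed

section \<open>The subgroups O_p', O_p and O_p',p and their orders\<close>

lemma prime_not_dvd_mult: "\<lbrakk>\<not> p dvd a; \<not> p dvd b\<rbrakk> \<Longrightarrow> \<not> p dvd a * b"
  using prime_dvd_multD[OF prime_p] by blast

lemma O_p'_properties:
  "O_p' G p \<lhd> G" "\<not> p dvd card (O_p' G p)" "\<And>M. \<lbrakk>M \<lhd> G; \<not> p dvd card M\<rbrakk> \<Longrightarrow> M \<subseteq> O_p' G p"
proof -
  have one: "is_p'_group p {\<one>}" using p_gt_1 by (simp add: is_p'_group_def)
  have "is_p'_group p (M <#> N)" if MN: "M \<lhd> G" "N \<lhd> G" "is_p'_group p M" "is_p'_group p N" for M N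
  proof -
    note prod = card_set_mult_normal[OF fin normal_imp_subgroup[OF MN(1)] MN(2)]
    have "\<not> p dvd card M * card N" using MN by (intro prime_not_dvd_mult) (auto simp: is_p'_group_def)
    then have "\<not> p dvd card (M <#> N)" using prod(2) by (metis dvd_mult2)
    then show ?thesis using finite_subgroup[OF prod(1)] by (simp add: is_p'_group_def)
  qed
  note mult = this
  have *: "O_p' G p \<lhd> G" "is_p'_group p (O_p' G p)" "\<And>M. \<lbrakk>M \<lhd> G; is_p'_group p M\<rbrakk> \<Longrightarrow> M \<subseteq> O_p' G p"
    unfolding O_p'_def
    by (rule largest_normal_properties[of "is_p'_group p"]; (rule fin one mult | assumption)+)+
  show "O_p' G p \<lhd> G" "\<not> p dvd card (O_p' G p)" using *(1,2) by (auto simp: is_p'_group_def)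
  show "M \<subseteq> O_p' G p" if "M \<lhd> G" "\<not> p dvd card M" for M
    using *(3)[OF that(1)] that finite_subgroup[OF normal_imp_subgroup[OF that(1)]] by (simp add: is_p'_group_def)
qed

lemma O_p_properties:
  "O_p G p \<lhd> G" "psub (O_p G p)" "\<And>M. \<lbrakk>M \<lhd> G; psub M\<rbrakk> \<Longrightarrow> M \<subseteq> O_p G p"
proof -
  have one: "is_p_group p {\<one>}" by (auto simp: is_p_group_def intro: exI[of _ 0])
  have "is_p_group p (M <#> N)" if MN: "M \<lhd> G" "N \<lhd> G" "is_p_group p M" "is_p_group p N" for M N
  proof -
    note prod = card_set_mult_normal[OF fin normal_imp_subgroup[OF MN(1)] MN(2)]
    obtain i j where "card M = p ^ i" "card N = p ^ j" using MN by (auto simp: is_p_group_def)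
    then have "card (M <#> N) dvd p ^ (i + j)" using prod(2) by (metis dvd_triv_left power_add)
    then have "\<exists>n. card (M <#> N) = p ^ n" using divides_primepow_nat[OF prime_p] by blast
    then show ?thesis using finite_subgroup[OF prod(1)] by (simp add: is_p_group_def)
  qed
  note mult = this
  have *: "O_p G p \<lhd> G" "is_p_group p (O_p G p)" "\<And>M. \<lbrakk>M \<lhd> G; is_p_group p M\<rbrakk> \<Longrightarrow> M \<subseteq> O_p G p"
    unfolding O_p_def
    by (rule largest_normal_properties[of "is_p_group p"]; (rule fin one mult | assumption)+)+
  show "O_p G p \<lhd> G" "psub (O_p G p)" using *(1,2) normal_imp_subgroup by (auto simp: is_p_group_def psub_def)
  show "M \<subseteq> O_p G p" if "M \<lhd> G" "psub M" for M
    using *(3)[OF that(1)] that finite_subgroup[OF normal_imp_subgroup[OF that(1)]] by (simp add: is_p_group_def psub_def)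
qed

lemma card_Union_cosets:
  assumes K: "K \<lhd> G" and A: "A \<subseteq> rcosets K"
  shows "card (\<Union>A) = card A * card K"
proof -
  have sK: "subgroup K G" using K normal_imp_subgroup by blast
  have Kc: "K \<subseteq> carrier G" using subgroup.subset[OF sK] .
  have card: "card C = card K" and finC: "finite C" if "C \<in> A" for C
  proof -
    have "C \<in> rcosets K" using that A by blast
    then show "card C = card K" "finite C"
      using card_cosets_equal[OF _ Kc] bij_betw_same_card cosets_finite[OF _ Kc fin] by metis+
  qed
  have "card (\<Union>A) = (\<Sum>C\<in>A. card C)"
  proof (rule card_Union_disjoint)
    show "pairwise disjnt A" using rcos_disjoint[OF sK] A by (rule pairwise_subset)
  qed (use finC in auto)
  then show ?thesis using card by simp
qed

lemma card_normal_Union: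
  assumes K: "K \<lhd> G" and A: "A \<lhd> (G Mod K)"
  shows "\<Union>A \<lhd> G" "K \<subseteq> \<Union>A" "card (\<Union>A) = card A * card K"
proof -
  interpret K: normal K G by fact
  interpret A: normal A "G Mod K" by fact
  show "\<Union>A \<lhd> G" by (rule K.factgroup_subgroup_union_normal[OF A])
  show "K \<subseteq> \<Union>A" using subgroup.one_closed[OF A.subgroup_axioms] unfolding one_FactGroup by (rule Union_upper)
  have "A \<subseteq> rcosets K" using A.subset unfolding FactGroup_def by simp
  then show "card (\<Union>A) = card A * card K" by (rule card_Union_cosets[OF K])
qed

section \<open>Frattini argument in O_p',p and the solvable case\<close>

lemma Int_normal_syl:
  assumes L: "L \<lhd> G" and S: "syl (carrier G) S"
  shows "syl L (S \<inter> L)"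
proof -
  interpret L: normal L G by fact
  have sI: "subgroup (S \<inter> L) G" by (rule subgroups_Inter_pair[OF syl_subgroup[OF S] L.subgroup_axioms])
  obtain T where T: "syl L T" using syl_exists[OF L.subgroup_axioms] by blast
  have Tc: "T \<subseteq> carrier G" using subgroup.subset[OF syl_subgroup[OF T]] .
  obtain g where g: "g \<in> carrier G" "T \<subseteq> cj g ` S"
    using syl_conj[OF subgroup_self S syl_psub[OF T] Tc] by blast
  have "cj (inv g) ` T \<subseteq> S"
    using cj_image_subset_iff[of "inv g" T S] g Tc syl_subset[OF S] by simp
  moreover have "cj (inv g) ` T \<subseteq> L"
    using L.inv_op_closed1 g(1) syl_subset[OF T] by (auto simp: conj_by_def)
  ultimately have "card (cj (inv g) ` T) \<le> card (S \<inter> L)"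
    using finite_subgroup[OF sI] by (intro card_mono) auto
  then have "card T \<le> card (S \<inter> L)" using card_cj[of "inv g" T] g(1) Tc by simp
  moreover have "psub (S \<inter> L)" using psub_mono[OF syl_psub[OF S] sI] by blast
  ultimately show ?thesis using syl_if_card[OF L.subgroup_axioms T] by blast
qed

text \<open>An order count: \<open>S \<inter> L\<close> is a Sylow subgroup of \<open>L\<close>, so
  it has at least \<open>p ^ i\<close> elements, and it meets \<open>K\<close> trivially. The
  product with \<open>K\<close> is therefore too large to be proper in \<open>L\<close>.\<close>

lemma p'p_factorization:
  assumes K: "K \<lhd> G" "\<not> p dvd card K" and L: "L \<lhd> G" "K \<subseteq> L" "card L = p ^ i * card K"
    and S: "syl (carrier G) S"
  shows "S \<inter> K = {\<one>}" "(S \<inter> L) <#> K = L"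
proof -
  interpret K: normal K G by fact
  interpret L: normal L G by fact
  note R = Int_normal_syl[OF L(1) S]
  note sR = syl_subgroup[OF R]
  show SK: "S \<inter> K = {\<one>}"
  proof -
    have sI: "subgroup (S \<inter> K) G" by (rule subgroups_Inter_pair[OF syl_subgroup[OF S] K.subgroup_axioms])
    have "\<not> p dvd card (S \<inter> K)"
      using K(2) card_subgroup_dvd[OF sI K.subgroup_axioms _ finite_subgroup[OF K.subgroup_axioms]]
      by (meson Int_lower2 dvd_trans)
    moreover have "psub (S \<inter> K)" using psub_mono[OF syl_psub[OF S] sI] by blast
    then obtain n where "card (S \<inter> K) = p ^ n" by (auto simp: psub_def)
    ultimately have "card (S \<inter> K) = 1" by (cases n) auto
    then show ?thesis using subgroup.one_closed[OF sI] by (metis card_1_singletonE singletonD)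
  qed
  have "p ^ i dvd card L" using L(3) by simp
  then have "i \<le> multiplicity p (card L)"
    using card_subgroup_pos[OF L.subgroup_axioms] p_gt_1 by (intro multiplicity_geI) auto
  then have "p ^ i \<le> card (S \<inter> L)" using R p_gt_1 by (simp add: syl_def power_increasing)
  note prod = card_set_mult_normal[OF fin sR K(1)]
  have "S \<inter> L \<inter> K = {\<one>}" using SK L(2) L.one_closed by blast
  then have "card ((S \<inter> L) <#> K) = card (S \<inter> L) * card K" using prod(2) by simp
  then have "card L \<le> card ((S \<inter> L) <#> K)" using \<open>p ^ i \<le> _\<close> L(3) by simp
  moreover have "(S \<inter> L) <#> K \<subseteq> L" using L(2) by (auto simp: set_mult_def)
  ultimately show "(S \<inter> L) <#> K = L" using finite_subgroup[OF L.subgroup_axioms] card_seteq by blast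
qed

text \<open>Write \<open>g\<close> as an element of \<open>L\<close> times one of
  \<open>normalizer G R\<close>, and the former as \<open>r \<otimes> k\<close> with
  \<open>r\<close> in \<open>S\<close> and \<open>k\<close> in \<open>K\<close>. The normalizer and
  \<open>r\<close> fix \<open>x\<close>, so only \<open>k\<close> could move it; but the commutator
  of \<open>k\<close> and \<open>x\<close> lies in both \<open>S\<close> and
  \<open>K\<close>.\<close>

lemma weakly_closed_direct_factor_p'p:
  assumes K: "K \<lhd> G" "\<not> p dvd card K" and L: "L \<lhd> G" "K \<subseteq> L" "card L = p ^ i * card K"
    and S: "syl (carrier G) S" and Z: "subgroup_center G S \<subseteq> L"
  shows "\<exists>K. subgroup K G \<and> K \<subseteq> subgroup_center G S
           \<and> weakly_closed_elems G S <#> K = subgroup_center G S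
           \<and> weakly_closed_elems G S \<inter> K = {\<one>}"
proof (rule weakly_closed_direct_factor[OF S])
  interpret K: normal K G by fact
  interpret L: normal L G by fact
  interpret S: subgroup S G by (rule syl_subgroup) fact
  define R where "R = S \<inter> L"
  note factor = p'p_factorization[OF K L S]
  have sylR: "syl L R" unfolding R_def by (rule Int_normal_syl[OF L(1) S])
  note sR = syl_subgroup[OF sylR]
  have Rc: "R \<subseteq> carrier G" using subgroup.subset[OF sR] .
  have cjL: "cj g ` R \<subseteq> L" if "g \<in> carrier G" for g
    using L.inv_op_closed2 that by (auto simp: conj_by_def R_def)
  show "subgroup R G" "R \<subseteq> S" using sR by (auto simp: R_def)
  show "subgroup_center G S \<subseteq> R" using Z subgroup_center_subset[of S] by (auto simp: R_def)
  show "S \<subseteq> normalizer G R"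
  proof
    fix s assume s: "s \<in> S"
    have "cj s ` R \<subseteq> R"
      using cjL[of s] s by (auto simp: R_def conj_by_def)
    then show "s \<in> normalizer G R"
      using cj_image_eqI[OF _ sR] normalizer_iff[OF Rc] s by simp
  qed
  fix x g assume x: "x \<in> subgroup_center G S" "\<forall>h\<in>normalizer G R. cj h x = x"
    and g: "g \<in> carrier G" "cj g x \<in> S"
  have xS: "x \<in> S" "x \<in> carrier G" using x(1) subgroup_center_subset[of S] by auto
  have Sx: "cj s x = x" if "s \<in> S" for s
    using x(1) that by (auto simp: subgroup_center_alt[OF S.subset])
  \<comment> \<open>The Frattini argument: the conjugate of \<open>R\<close> by \<open>g\<close> is
    again a Sylow subgroup of the normal subgroup \<open>L\<close>, so some \<open>l\<close> in
    \<open>L\<close> already achieves it, and \<open>inv l \<otimes> g\<close> normalizes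
    \<open>R\<close>.\<close>
  have "syl L (cj g ` R)"
    using sylR cjL[OF g(1)] subgroup_cj[OF sR g(1)] card_cj[OF g(1) Rc] by (simp add: syl_def)
  then obtain l where l: "l \<in> L" "cj g ` R = cj l ` R"
    using syl_conj_eq[OF L.subgroup_axioms sylR] by blast
  have lc: "l \<in> carrier G" using l(1) by simp
  have "cj (inv l \<otimes> g) ` R = R"
    using cj_image_m[of "inv l" g R] l(2) lc g(1) Rc cj_image_cancel(1)[OF lc Rc] by simp
  then have "cj (inv l \<otimes> g) x = x" using x(2) normalizer_iff[OF Rc] lc g(1) by simp
  moreover have "g = l \<otimes> (inv l \<otimes> g)" using lc g(1) by simp
  ultimately have gl: "cj g x = cj l x" using cj_m[of l "inv l \<otimes> g" x] lc g(1) xS by simp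
  obtain r k where rk: "r \<in> S" "k \<in> K" "l = r \<otimes> k"
    using l(1) factor(2) unfolding set_mult_def by blast
  have kc: "k \<in> carrier G" "r \<in> carrier G" using rk by auto
  have lx: "cj l x = cj r (cj k x)" using rk(3) kc xS by (simp add: cj_m)
  have "cj k x = cj (inv r) (cj g x)" using gl lx kc xS by simp
  then have "cj k x \<in> S" using g(2) rk(1) by (simp add: conj_by_def)
  then have "cj k x \<otimes> inv x \<in> S" using xS by simp
  moreover have "cj k x \<otimes> inv x = k \<otimes> (x \<otimes> inv k \<otimes> inv x)"
    using kc xS by (simp add: conj_by_def m_assoc)
  then have "cj k x \<otimes> inv x \<in> K" using K.inv_op_closed2[OF xS(2), of "inv k"] rk(2) by simp
  ultimately have "cj k x \<otimes> inv x = \<one>" using factor(1) by blast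
  then have "cj k x = x" using kc xS by (metis cj_closed inv_equality inv_inv inv_closed)
  then show "cj g x = x" using gl lx Sx[OF rk(1)] by simp
qed

lemma finite_group_prime_Mod:
  assumes "K \<lhd> G"
  shows "finite_group_prime (G Mod K) p"
proof -
  interpret K: normal K G by fact
  interpret M: group "G Mod K" by (rule K.factorgroup_is_group)
  show ?thesis by unfold_locales (use fin prime_p in \<open>auto simp: carrier_FactGroup\<close>)
qed

lemma O_p'p_properties:
  "O_p'p G p \<lhd> G" "O_p' G p \<subseteq> O_p'p G p" "\<exists>i. card (O_p'p G p) = p ^ i * card (O_p' G p)"
proof -
  interpret M: finite_group_prime "G Mod O_p' G p" p by (rule finite_group_prime_Mod[OF O_p'_properties(1)])
  note * = card_normal_Union[OF O_p'_properties(1) M.O_p_properties(1), folded O_p'p_def]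
  show "O_p'p G p \<lhd> G" "O_p' G p \<subseteq> O_p'p G p" using *(1,2) .
  obtain i where "card (O_p (G Mod O_p' G p) p) = p ^ i" using M.O_p_properties(2) by (auto simp: M.psub_def)
  then show "\<exists>i. card (O_p'p G p) = p ^ i * card (O_p' G p)" using *(3) by metis
qed

text \<open>Modulo \<open>K\<close> the subgroup \<open>Q\<close> is the image of
  \<open>S \<inter> O_p'p G p\<close>, so the image of a central element of \<open>S\<close>
  centralizes it. The Hall-Higman lemma in the quotient puts that image into
  \<open>Q\<close>.\<close>

lemma center_subset_O_p'p:
  assumes "solvable G" and S: "syl (carrier G) S"
  shows "subgroup_center G S \<subseteq> O_p'p G p"
proof
  define K where "K = O_p' G p"
  define Q where "Q = O_p (G Mod K) p"
  note K = O_p'_properties[folded K_def]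
  interpret K: normal K G by (rule K(1))
  interpret M: finite_group_prime "G Mod K" p by (rule finite_group_prime_Mod[OF K(1)])
  note Q = M.O_p_properties[folded Q_def]
  interpret Q: normal Q "G Mod K" by (rule Q(1))
  have L: "O_p'p G p = \<Union>Q" by (simp add: O_p'p_def Q_def K_def)
  obtain i where "card (O_p'p G p) = p ^ i * card K" using O_p'p_properties(3) K_def by blast
  note factor = p'p_factorization[OF K(1,2) O_p'p_properties(1) O_p'p_properties(2)[folded K_def] this S]
  \<comment> \<open>A normal \<open>p'\<close>-subgroup of the quotient pulls back to one of
    \<open>G\<close>, because \<open>K\<close> itself has order prime to \<open>p\<close>; so it is
    already absorbed by \<open>K\<close>.\<close>
  have triv: "A = {\<one>\<^bsub>G Mod K\<^esub>}" if A: "A \<lhd> (G Mod K)" "\<not> p dvd card A" for A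
  proof -
    interpret A: normal A "G Mod K" by fact
    note U = card_normal_Union[OF K(1) A(1)]
    have "\<not> p dvd card (\<Union>A)" unfolding U(3) by (rule prime_not_dvd_mult[OF A(2) K(2)])
    then have "\<Union>A \<subseteq> K" by (rule K(3)[OF U(1)])
    then have "C = K" if "C \<in> A" for C
    proof -
      have "C \<in> rcosets K" using that(1) A.subset by (auto simp: FactGroup_def)
      then obtain g where g: "g \<in> carrier G" "C = K #> g" by (auto simp: RCOSETS_def)
      then have "g \<in> K" using that \<open>\<Union>A \<subseteq> K\<close> rcos_self[OF g(1) K.subgroup_axioms] by blast
      then show ?thesis using g K.rcos_const[OF is_group] by simp
    qed
    moreover have "K \<in> A" using subgroup.one_closed[OF A.subgroup_axioms] unfolding one_FactGroup .
    ultimately have "A = {K}" by blast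
    then show ?thesis by simp
  qed
  have solv: "solvable (G Mod K)"
  proof -
    interpret h: group_hom G "G Mod K" "\<lambda>a. K #> a"
      by (simp add: group_hom_def group_hom_axioms_def K.r_coset_hom_Mod M.group_axioms)
    show ?thesis by (rule h.surj_hom_imp_solvable[OF _ assms(1)]) (simp add: carrier_FactGroup)
  qed
  have cent: "{g \<in> carrier (G Mod K). \<forall>q\<in>Q. M.cj g q = q} \<subseteq> Q"
    by (rule M.solvable_centralizer_subset[OF solv]; (rule triv Q | assumption)+)
  fix z assume z: "z \<in> subgroup_center G S"
  have zS: "z \<in> S" using z subgroup_center_subset by blast
  then have zc: "z \<in> carrier G" using syl_subset[OF S] by (rule rev_subsetD)
  have Kz: "K #> z \<in> carrier (G Mod K)" using zc by (simp add: carrier_FactGroup)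
  have fixes_Q: "M.cj (K #> z) q = q" if q: "q \<in> Q" for q
  proof -
    have "q \<in> rcosets K" using q Q.subset by (auto simp: FactGroup_def)
    then obtain l where l: "l \<in> carrier G" "q = K #> l" by (auto simp: RCOSETS_def)
    then have "l \<in> \<Union>Q" using q rcos_self[OF l(1) K.subgroup_axioms] by blast
    \<comment> \<open>The factors are exchanged so that \<open>K\<close> stands on the left:
      quotient elements are right cosets, and the \<open>K\<close>-factor then disappears from
      \<open>K #> l\<close>.\<close>
    then have "l \<in> K <#> (S \<inter> O_p'p G p)"
      using factor(2) L commut_normal[OF syl_subgroup[OF Int_normal_syl[OF O_p'p_properties(1) S]] K(1)] by simp
    then obtain k r where kr: "k \<in> K" "r \<in> S" "l = k \<otimes> r" unfolding set_mult_def by blast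
    have rc: "r \<in> carrier G" using kr(2) syl_subset[OF S] by (rule rev_subsetD)
    have "q = K #> r"
      using l(2) kr coset_mult_assoc[OF K.subset, of k r] rc K.rcos_const[OF is_group kr(1)] by simp
    moreover have "z \<otimes> r = r \<otimes> z" using subgroup_center_comm[OF z kr(2)] .
    ultimately have "(K #> z) \<otimes>\<^bsub>G Mod K\<^esub> q = q \<otimes>\<^bsub>G Mod K\<^esub> (K #> z)"
      using K.rcos_sum zc rc by simp
    then show ?thesis using M.cj_fix_iff[OF Kz, of q] subsetD[OF Q.subset q] by blast
  qed
  have "K #> z \<in> Q" by (rule subsetD[OF cent], intro CollectI conjI ballI) (rule Kz, rule fixes_Q)
  then have "z \<in> \<Union>Q" using rcos_self[OF zc K.subgroup_axioms] by blast
  then show "z \<in> O_p'p G p" using L by simp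
qed

end

theorem theorem1p1:
  fixes G (structure) and p :: nat and S :: "'a set"
  assumes "group G" and "finite (carrier G)" and "Factorial_Ring.prime p"
    and "sylow_subgroup G p S"
    and "odd p \<or> (p = 2 \<and> subgroup_center G S \<subseteq> O_p'p G 2) \<or> solvable G"
  shows "\<exists>K. subgroup K G \<and> K \<subseteq> subgroup_center G S
           \<and> weakly_closed_elems G S <#> K = subgroup_center G S
           \<and> weakly_closed_elems G S \<inter> K = {\<one>}"
proof -
  interpret finite_group_prime G p
    using assms(1-3) by (simp add: finite_group_prime_def finite_group_prime_axioms_def)
  have S: "syl (carrier G) S"
    using assms(4) subgroup.subset by (auto simp: sylow_subgroup_def syl_def order_def)
  show ?thesis
  proof (cases "odd p")
    case True
    then show ?thesis by (rule weakly_closed_direct_factor_odd[OF _ S])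
  next
    \<comment> \<open>For an even prime, both remaining alternatives lead to the same inclusion: the
      second one states it for \<open>p = 2\<close>, and solvability implies it.\<close>
    case False
    then have Z: "subgroup_center G S \<subseteq> O_p'p G p"
      using assms(5) center_subset_O_p'p[OF _ S] by auto
    obtain i where i: "card (O_p'p G p) = p ^ i * card (O_p' G p)" using O_p'p_properties(3) by blast
    show ?thesis
      by (rule weakly_closed_direct_factor_p'p[OF O_p'_properties(1,2) O_p'p_properties(1,2) i S Z])
  qed
qed

end
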